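(* Let $d\ge1$ be an integer and let $\chi:\mathbb R^d\times\mathbb R^{d\Delta}\to\mathbb R^d$ be a bounded measurable function such that for any compact $K\subset\mathbb R^d$, $$\sup_{b,c\in K,\ 0<|c-b|\le\varepsilon}\frac{|\chi(b,c)-(c-b)|}{|c-b|^2}\longrightarrow0\quad\text{as }\varepsilon\to0 .$$ For each $a\in\mathbb R^d$ let $(\delta(a),\gamma(a),\nu(a))$ be a Lévy triplet at $a$, and suppose that $\nu(a)\big(\{b\in\mathbb R^{d\Delta} : \chi\text{ is not continuous at }(a,b)\}\big)=0$. For $f\in C_c^\infty(\mathbb R^d)$ set $Lf(a):=T_{\chi,a}(\delta(a),\gamma(a),\nu(a))f$. For each $n\in\mathbb N$ and $a\in\mathbb R^d$ let $(\delta_n(a),\gamma_n(a),\nu_n(a))$ be a Lévy triplet at $a$ and set $L_nf(a):=T_{\chi,a}(\delta_n(a),\gamma_n(a),\nu_n(a))f$ for $f\in C^\infty_c(\mathbb R^d)$. For each $n\in\mathbb N$ and $a\in\mathbb R^d$ let $\mu_n(a)$ be a probability measure on $\mathbb R^{d\Delta}$, let $(\varepsilon_n)_n$ be a sequence of positive numbers converging to $0$, and set $T_nf(a):=\int f(b)\,\mu_n(a,db)$ for $f\in C(\mathbb R^{d\Delta})$. 1) The function $Lf$ is continuous for every $f\in C^\infty_c(\mathbb R^d)$ if and only if the following three conditions hold: - $a\mapsto\delta(a)$ is continuous on $\mathbb R^d$; - for any $f\in C(\mathbb R^{d\Delta})$, $a\mapsto\int f(b)\,\nu(a,db)$ is continuous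 on the interior of $\{f=0\}\cap\mathbb R^d$; - for any $1\le i,j\le d$, $a\mapsto\gamma_{ij}(a)+\int\chi_i(a,b)\chi_j(a,b)\,\nu(a,db)$ is continuous on $\mathbb R^d$. 2) Assume that $Lf$ is continuous for every $f\in C_c^\infty(\mathbb R^d)$. Then $L_nf\to Lf$ as $n\to\infty$, uniformly on compact sets, for all $f\in C_c^\infty(\mathbb R^d)$, if and only if the following three conditions hold: - $\delta_n(a)\to\delta(a)$ uniformly for $a$ varying in compact subsets of $\mathbb R^d$; - for any $f\in C(\mathbb R^{d\Delta})$, $\int f(b)\,\nu_n(a,db)\to\int f(b)\,\nu(a,db)$ uniformly for $a$ varying in compact subsets of the interior of $\{f=0\}\cap\mathbb R^d$; - for any $1\le i,j\le d$, $\gamma_{n,ij}(a)+\int(\chi_i\chi_j)(a,b)\,\nu_n(a,db)\to\gamma_{ij}(a)+\int(\chi_i\chi_j)(a,b)\,\nu(a,db)$ uniformly for $a$ varying in compact subsets of $\mathbb R^d$. 3) Assume that $Lf$ is continuous for every $f\in C_c^\infty(\mathbb R^d)$. Then $\varepsilon_n^{-1}(T_nf-f)\to Lf$ as $n\to\infty$, uniformly on compact sets, for all $f\in C_c^\infty(\mathbb R^d)$, if and only if the following three conditions hold: - $\varepsilon_n^{-1}\int_{\mathbb R^{d\Delta}\setminus\{a\}}\chi(a,b)\,\mu_n(a,db)\to\delta(a)$ uniformly for $a$ varying in compact subsets of $\mathbb R^d$; - for any $f\in C(\mathbb R^{d\Delta})$, $\varepsilon_n^{-1}\int f(b)\,\mu_n(a,db)\to\int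 f(b)\,\nu(a,db)$ uniformly for $a$ varying in compact subsets of the interior of $\{f=0\}\cap\mathbb R^d$; - for any $1\le i,j\le d$, $\varepsilon_n^{-1}\int_{\mathbb R^{d\Delta}\setminus\{a\}}(\chi_i\chi_j)(a,b)\,\mu_n(a,db)\to\gamma_{ij}(a)+\int(\chi_i\chi_j)(a,b)\,\nu(a,db)$ uniformly for $a$ varying in compact subsets of $\mathbb R^d$.
   Context: $\mathbb R^{d\Delta}=\mathbb R^d\cup\{\Delta\}$ is the one-point compactification of $\mathbb R^d$; $|\cdot|$ is the Euclidean norm, with the convention $1\wedge|\Delta-a|^2=1$. $C(\mathbb R^{d\Delta})$ is the set of real continuous functions on $\mathbb R^{d\Delta}$, and $C_c^\infty(\mathbb R^d)$ is the set of compactly supported infinitely differentiable functions $\mathbb R^d\to\mathbb R$, extended to $\mathbb R^{d\Delta}$ by $f(\Delta)=0$. Integrals without indicated domain are over $\mathbb R^{d\Delta}$. A Lévy triplet at $a\in\mathbb R^d$ is a triple $(\delta,\gamma,\nu)$ where $\delta\in\mathbb R^d$, $\gamma\in\mathbb R^{d\times d}$ is symmetric positive semi-definite, and $\nu$ is a (nonnegative Borel) measure on $\mathbb R^{d\Delta}$ with $\nu(\{a\})=0$ and $\int_{\mathbb R^{d\Delta}}(1\wedge|b-a|^2)\,\nu(db)<\infty$. For such a triple and $f\in C_c^\infty(\mathbb R^d)$, $$T_{\chi,a}(\delta,\gamma,\nu)f:=\frac12\sum_{i,j=1}^d\gamma_{ij}\,\partial^2_{ij}f(a)+\delta\cdot\nabla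 f(a)+\int_{\mathbb R^{d\Delta}}\big(f(b)-f(a)-\chi(a,b)\cdot\nabla f(a)\big)\,\nu(db).$$ For a measure $\nu(a)$ depending on $a$ one writes $\nu(a,db)$ for $\nu(a)(db)$, and similarly for $\nu_n(a)$, $\mu_n(a)$. $\chi_i$ is the $i$-th coordinate of $\chi$ and $(\chi_i\chi_j)(a,b)=\chi_i(a,b)\chi_j(a,b)$. *)

theory Defs
  imports "HOL-Probability.Probability"
begin

text \<open>Points of the one-point compactification of \<open>\<real>\<^sup>d\<close> are values of type \<^typ>\<open>(real^'n) option\<close>:
  \<open>Some x\<close> is the point \<open>x\<close> and \<open>None\<close> is the point at infinity \<open>\<Delta>\<close>.  The type carries no topology
  of its own; the abstract topology below is the one that is meant throughout.\<close>

definition compactified :: "(real^'n) option topology" where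
  "compactified = Alexandroff_compactification euclidean"

definition borel_compactified :: "(real^'n) option measure" where
  "borel_compactified = sigma UNIV {U. openin compactified U}"

definition C_compactified :: "((real^'n) option \<Rightarrow> real) set" where
  "C_compactified = {f. continuous_map compactified euclideanreal f}"

definition ext0 :: "(real^'n \<Rightarrow> real) \<Rightarrow> (real^'n) option \<Rightarrow> real" where
  "ext0 f b = (case b of None \<Rightarrow> 0 | Some x \<Rightarrow> f x)"

definition partial :: "'n \<Rightarrow> (real^'n \<Rightarrow> real) \<Rightarrow> real^'n \<Rightarrow> real" where
  "partial i f x = frechet_derivative f (at x) (axis i 1)"

definition grad :: "(real^'n \<Rightarrow> real) \<Rightarrow> real^'n \<Rightarrow> real^'n" where
  "grad f x = (\<chi> i. partial i f x)"

primrec Ck :: "nat \<Rightarrow> (real^'n \<Rightarrow> real) \<Rightarrow> bool" where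
  "Ck 0 f \<longleftrightarrow> continuous_on UNIV f"
| "Ck (Suc k) f \<longleftrightarrow> f differentiable_on UNIV \<and> (\<forall>i. Ck k (partial i f))"

definition Cc_infinity :: "(real^'n \<Rightarrow> real) set" where
  "Cc_infinity = {f. (\<forall>k. Ck k f) \<and> compact (closure {x. f x \<noteq> 0})}"

text \<open>\<open>1 \<and> |b - a|\<^sup>2\<close>, with value \<open>1\<close> at \<open>b = \<Delta>\<close>.\<close>

definition levy_weight :: "real^'n \<Rightarrow> (real^'n) option \<Rightarrow> real" where
  "levy_weight a b = (case b of None \<Rightarrow> 1 | Some x \<Rightarrow> min 1 ((norm (x - a))\<^sup>2))"

definition levy_triplet ::
  "real^'n \<Rightarrow> real^'n \<Rightarrow> real^'n^'n \<Rightarrow> (real^'n) option measure \<Rightarrow> bool" where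
  "levy_triplet a \<delta> \<gamma> \<nu> \<longleftrightarrow>
     transpose \<gamma> = \<gamma> \<and> (\<forall>x. 0 \<le> x \<bullet> (\<gamma> *v x)) \<and>
     sets \<nu> = sets borel_compactified \<and>
     emeasure \<nu> {Some a} = 0 \<and>
     (\<integral>\<^sup>+ b. ennreal (levy_weight a b) \<partial>\<nu>) < \<infinity>"

text \<open>The standing assumptions on the compensation function \<open>\<chi>\<close>.  The supremum is taken in
  \<^typ>\<open>ennreal\<close>, so it is \<open>0\<close> over an empty index set and \<open>\<infinity>\<close> if the quotients are unbounded.\<close>

definition compensation :: "((real^'n) \<times> (real^'n) option \<Rightarrow> real^'n) \<Rightarrow> bool" where
  "compensation chi \<longleftrightarrow>
     bounded (range chi) \<and>
     chi \<in> borel_measurable (borel \<Otimes>\<^sub>M borel_compactified) \<and>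
     (\<forall>K. compact K \<longrightarrow>
        ((\<lambda>\<epsilon>. SUP (b, c) \<in> {(b, c). b \<in> K \<and> c \<in> K \<and> 0 < norm (c - b) \<and> norm (c - b) \<le> \<epsilon>}.
            ennreal (norm (chi (b, Some c) - (c - b)) / (norm (c - b))\<^sup>2)) \<longlongrightarrow> 0)
        (at_right (0::real)))"

definition chi_discontinuities ::
  "((real^'n) \<times> (real^'n) option \<Rightarrow> real^'n) \<Rightarrow> real^'n \<Rightarrow> (real^'n) option set" where
  "chi_discontinuities chi a =
     {b. \<not> topcontinuous_at (prod_topology euclidean compactified) euclidean chi (a, b)}"

definition levy_op ::
  "((real^'n) \<times> (real^'n) option \<Rightarrow> real^'n) \<Rightarrow> real^'n \<Rightarrow>
   real^'n \<Rightarrow> real^'n^'n \<Rightarrow> (real^'n) option measure \<Rightarrow> (real^'n \<Rightarrow> real) \<Rightarrow> real" where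
  "levy_op chi a \<delta> \<gamma> \<nu> f =
     1 / 2 * (\<Sum>i\<in>UNIV. \<Sum>j\<in>UNIV. \<gamma> $ i $ j * partial i (partial j f) a)
     + \<delta> \<bullet> grad f a
     + (\<integral>b. (ext0 f b - f a - chi (a, b) \<bullet> grad f a) \<partial>\<nu>)"

definition compactly_uniform_limit ::
  "(real^'n) set \<Rightarrow> (nat \<Rightarrow> real^'n \<Rightarrow> 'b::metric_space) \<Rightarrow> (real^'n \<Rightarrow> 'b) \<Rightarrow> bool" where
  "compactly_uniform_limit S F g \<longleftrightarrow>
     (\<forall>K. compact K \<and> K \<subseteq> S \<longrightarrow> uniform_limit K F g sequentially)"

end

theory Submission
  imports Defs "HOL-Real_Asymp.Real_Asymp"
begin

text \<open>
  Continuity of \<open>Lf\<close>, and locally uniform convergence to a continuous limit, can be tested along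
  sequences \<open>a\<^sub>n \<rightarrow> a\<close>, so parts 1 and 2 reduce to one statement about triplets
  \<open>(\<delta>\<^sub>n, \<gamma>\<^sub>n, \<nu>\<^sub>n)\<close> at \<open>a\<^sub>n\<close>. Writing \<open>\<Gamma>\<^sub>i\<^sub>j = \<gamma>\<^sub>i\<^sub>j + \<integral> \<chi>\<^sub>i \<chi>\<^sub>j d\<nu>\<close>, one has
  \<open>T f = (1/2) \<Sum> \<Gamma>\<^sub>i\<^sub>j \<partial>\<^sub>i\<partial>\<^sub>j f + \<delta> \<bullet> \<nabla>f + \<integral> R\<^sub>f d\<nu>\<close>, where the Taylor remainder \<open>R\<^sub>f (a', b)\<close> is
  \<open>o(|b - a'|\<^sup>2)\<close>. If the second moments of the \<open>\<nu>\<^sub>n\<close> near \<open>a\<close> are bounded and \<open>\<nu>\<^sub>n \<rightarrow> \<nu>\<close> weakly away from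
  \<open>a\<close>, then \<open>\<integral> R\<^sub>f d\<nu>\<^sub>n\<close> converges. Conversely, test functions that are constant near \<open>a\<close> give the
  weak convergence, and locally affine and quadratic ones give the moment bound and then the limits
  of \<open>\<delta>\<^sub>n\<close> and \<open>\<Gamma>\<^sub>n\<close>. Part 3 is part 2 for the triplets
  \<open>(\<epsilon>\<^sub>n\<^sup>-\<^sup>1 \<integral> \<chi> d\<mu>\<^sub>n, 0, \<epsilon>\<^sub>n\<^sup>-\<^sup>1 \<mu>\<^sub>n)\<close> with the mass of \<open>\<mu>\<^sub>n(a)\<close> at \<open>a\<close> removed.
\<close>

subsection \<open>The compactification as a metric space\<close>

text \<open>The covariance enters through \<open>modified_cov\<close> because
  \<open>\<gamma>\<close> alone is not stable: jumps whose size shrinks to 0 may turn into diffusion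
  in the limit, and only the sum with the integral of chi_i chi_j keeps track of both. Near the
  diagonal \<open>chi\<close> agrees with b - a' up to o(|b - a'|^2), which is just enough to put it
  in place of the increment in a second-order Taylor formula; unlike the increment it is bounded and
  has a value at infinity, so one formula covers small and large jumps. The main obstacle is the
  limit of the remainder integrals: integrand and measure change together, the measures may have
  infinite mass near the base point, and \<open>chi\<close> is known to be jointly continuous only
  at almost every b for the limit measure. Weak convergence is therefore extended to varying, almost
  everywhere continuous integrands. In the converse the order of the conclusions matters: the limits
  of drift and covariance are read off only after the remainder has been controlled, so the moment
  bound has to be found while the drift is still unknown.\<close>

lemma topspace_compactified [simp]: "topspace compactified = UNIV"
  unfolding compactified_def by (auto simp: image_iff not_None_eq) 

lemma compact_space_compactified: "compact_space compactified"
  unfolding compactified_def by simp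

text \<open>The case distinction on \<open>f None \<in> V\<close> follows the two kinds of open sets
  of the compactification: open subsets of R^d, and complements of compact sets together with the
  point at infinity.\<close>

lemma continuous_map_compactifiedI:
  fixes f :: "(real^'n) option \<Rightarrow> 'b::topological_space"
  assumes cont: "continuous_on UNIV (\<lambda>x. f (Some x))"
    and lim: "((\<lambda>x. f (Some x)) \<longlongrightarrow> f None) at_infinity"
  shows "continuous_map compactified euclidean f"
  unfolding continuous_map
proof safe
  fix V :: "'b set" assume "openin euclidean V"
  then have V: "open V" by simp
  have op: "open {x. f (Some x) \<in> V}"
    using cont V by (auto simp: continuous_on_open_vimage[OF open_UNIV] vimage_def)
  show "openin compactified {x \<in> topspace compactified. f x \<in> V}"
  proof (cases "f None \<in> V")
    case False
    then have "{x \<in> topspace compactified. f x \<in> V} = Some ` {x. f (Some x) \<in> V}"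
      by (auto simp: image_iff) (metis not_None_eq)
    then show ?thesis using op by (simp add: compactified_def)
  next
    case True
    have "eventually (\<lambda>x. f (Some x) \<in> V) at_infinity"
      using topological_tendstoD[OF lim V True] .
    then obtain B where B: "\<And>x. norm x \<ge> B \<Longrightarrow> f (Some x) \<in> V"
      by (auto simp: eventually_at_infinity)
    define K where "K = - {x. f (Some x) \<in> V}"
    have "bounded K" unfolding bounded_iff K_def using B by (force intro: exI[of _ B])
    moreover have "closed K" unfolding K_def using op by (rule closed_Compl)
    ultimately have "compact K" by (simp add: compact_eq_bounded_closed)
    moreover have "{x \<in> topspace compactified. f x \<in> V} = insert None (Some ` (UNIV - K))"
      using True by (auto simp: image_iff K_def) (metis not_None_eq)
    ultimately show ?thesis
      using \<open>closed K\<close>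
      by (auto simp: compactified_def openin_Alexandroff_compactification)
  qed
qed auto

text \<open>The inversion \<open>x \<mapsto> (x, 1) / (1 + |x|\<^sup>2)\<close> embeds the compactification into \<open>\<real>\<^sup>d \<times> \<real>\<close>, with the
  point at infinity going to \<open>0\<close>; it provides the metric used throughout.\<close>

definition emb :: "(real^'n) option \<Rightarrow> (real^'n) \<times> real" where
  "emb b = (case b of None \<Rightarrow> (0, 0)
     | Some x \<Rightarrow> ((1 / (1 + (norm x)\<^sup>2)) *\<^sub>R x, 1 / (1 + (norm x)\<^sup>2)))"

lemma emb_Some: "emb (Some x) = ((1 / (1 + (norm x)\<^sup>2)) *\<^sub>R x, 1 / (1 + (norm x)\<^sup>2))"
  and emb_None: "emb None = (0, 0)"
  by (simp_all add: emb_def)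

lemma inj_emb: "inj emb"
proof (rule injI)
  fix b c :: "(real^'n) option"
  assume eq: "emb b = emb c"
  have pos: "1 + (norm x)\<^sup>2 > 0" for x :: "real^'n" by (simp add: add_pos_nonneg)
  show "b = c"
  proof (cases b; cases c)
    fix x y assume "b = Some x" "c = Some y"
    then show ?thesis using eq pos[of x] pos[of y]
      by (auto simp: emb_Some)
  qed (use eq pos in \<open>auto simp: emb_Some emb_None add_nonneg_eq_0_iff\<close>)
qed

lemma continuous_map_emb: "continuous_map compactified euclidean emb"
proof (rule continuous_map_compactifiedI)
  have nz: "1 + (norm x)\<^sup>2 \<noteq> 0" for x :: "real^'n"
    by (smt (verit) zero_le_power2)
  show "continuous_on UNIV (\<lambda>x::real^'n. emb (Some x))"
    unfolding emb_Some by (intro continuous_intros) (use nz in auto)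
  have n: "filterlim (norm :: real^'n \<Rightarrow> real) at_top at_infinity"
    by (rule filterlim_norm_at_top)
  have 1: "((\<lambda>x::real^'n. 1 / (1 + (norm x)\<^sup>2)) \<longlongrightarrow> 0) at_infinity"
    by (rule filterlim_compose[OF _ n, of "\<lambda>t. 1 / (1 + t\<^sup>2)"]) real_asymp
  have 2: "((\<lambda>x::real^'n. (1 / (1 + (norm x)\<^sup>2)) *\<^sub>R x) \<longlongrightarrow> 0) at_infinity"
  proof (rule tendsto_norm_zero_cancel)
    have "((\<lambda>x::real^'n. norm x / (1 + (norm x)\<^sup>2)) \<longlongrightarrow> 0) at_infinity"
      by (rule filterlim_compose[OF _ n, of "\<lambda>t. t / (1 + t\<^sup>2)"]) real_asymp
    then show "((\<lambda>x::real^'n. norm ((1 / (1 + (norm x)\<^sup>2)) *\<^sub>R x)) \<longlongrightarrow> 0) at_infinity"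
      by (simp add: nz)
  qed
  show "((\<lambda>x::real^'n. emb (Some x)) \<longlongrightarrow> emb None) at_infinity"
    unfolding emb_Some emb_None by (rule tendsto_Pair[OF 2 1])
qed

lemma compact_range_emb: "compact (range (emb :: (real^'n) option \<Rightarrow> _))"
  using image_compactin[OF _ continuous_map_emb, of UNIV] compact_space_compactified
  by (simp add: compact_space_def)

text \<open>The complement of \<open>U\<close> is compact, so its image under the injective
  continuous \<open>emb\<close> is compact and keeps a positive distance from \<open>emb b\<close>.
  Together with the continuity of \<open>emb\<close> this identifies \<open>compactified\<close>
  with a metric topology.\<close>

lemma openin_compactified_emb:
  assumes "openin compactified U" "b \<in> U"
  shows "\<exists>d>0. \<forall>c. dist (emb c) (emb b) < d \<longrightarrow> c \<in> U"
proof -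
  have "compactin compactified (UNIV - U)"
    using assms(1) compact_space_compactified
    by (metis closedin_compact_space closedin_diff closedin_topspace topspace_compactified)
  then have "compact (emb ` (UNIV - U))"
    using image_compactin[OF _ continuous_map_emb] by auto
  moreover have "emb b \<notin> emb ` (UNIV - U)"
    using assms(2) inj_emb by (auto dest: injD)
  ultimately obtain d where "d > 0" "\<forall>y\<in>emb ` (UNIV - U). d \<le> dist (emb b) y"
    using separate_point_closed compact_imp_closed by metis
  then show ?thesis by (intro exI[of _ d]) (force simp: dist_commute)
qed

lemma C_compactifiedI:
  fixes f :: "(real^'n) option \<Rightarrow> real"
  assumes "continuous_on UNIV (\<lambda>x. f (Some x))"
    and "((\<lambda>x. f (Some x)) \<longlongrightarrow> f None) at_infinity"
  shows "f \<in> C_compactified"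
  using continuous_map_compactifiedI[OF assms] by (simp add: C_compactified_def)

lemma C_compactified_emb:
  assumes "continuous_on UNIV g"
  shows "(\<lambda>b. g (emb b)) \<in> C_compactified"
  using continuous_map_compose[OF continuous_map_emb, of euclideanreal g] assms
  by (simp add: C_compactified_def o_def)

lemma C_compactified_mult:
  "f \<in> C_compactified \<Longrightarrow> g \<in> C_compactified \<Longrightarrow> (\<lambda>b. f b * g b) \<in> C_compactified"
  by (simp add: C_compactified_def continuous_map_real_mult)

lemma C_compactified_add:
  "f \<in> C_compactified \<Longrightarrow> g \<in> C_compactified \<Longrightarrow> (\<lambda>b. f b + g b) \<in> C_compactified"
  by (simp add: C_compactified_def continuous_map_add)

lemma C_compactified_const: "(\<lambda>b. c) \<in> C_compactified"
  by (simp add: C_compactified_def)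

lemma C_compactified_bounded:
  assumes "f \<in> C_compactified"
  obtains B where "B > 0" "\<And>b. \<bar>f b\<bar> \<le> B"
proof -
  have "compact (range f)"
    using image_compactin[of compactified UNIV euclideanreal f] assms compact_space_compactified
    by (simp add: compact_space_def C_compactified_def)
  then have "bounded (range f)" by (rule compact_imp_bounded)
  then show ?thesis using that unfolding bounded_pos by auto
qed

lemma C_compactified_continuous_on_Some:
  assumes "f \<in> C_compactified"
  shows "continuous_on UNIV (\<lambda>x. f (Some x))"
proof -
  have "continuous_map euclidean compactified Some"
    unfolding compactified_def by (rule continuous_map_Some)
  from continuous_map_compose[OF this, of euclideanreal f] assms
  show ?thesis by (simp add: C_compactified_def o_def)
qed

text \<open>The neighbourhood filter of \<open>(a, b)\<close> in the product topology, written
  through the metric of \<open>emb\<close> because the option type has no topology of its own. It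
  makes the usual \<open>tendsto\<close> calculus available in both arguments jointly.\<close>

definition nhds_emb :: "real^'n \<Rightarrow> (real^'n) option \<Rightarrow> ((real^'n) \<times> (real^'n) option) filter" where
  "nhds_emb a b = filtercomap (\<lambda>(a', b'). (a', emb b')) (nhds (a, emb b))"

lemma eventually_nhds_emb:
  "eventually P (nhds_emb a b) \<longleftrightarrow>
    (\<exists>d>0. \<forall>a' b'. dist a' a < d \<longrightarrow> dist (emb b') (emb b) < d \<longrightarrow> P (a', b'))"
proof
  assume "eventually P (nhds_emb a b)"
  then obtain d where d: "d > 0"
    "\<And>a' b'. dist (a', emb b') (a, emb b) < d \<Longrightarrow> P (a', b')"
    unfolding nhds_emb_def eventually_filtercomap eventually_nhds_metric by fastforce
  have "P (a', b')" if "dist a' a < d/2" "dist (emb b') (emb b) < d/2" for a' b'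
  proof (rule d(2))
    have "dist (a', emb b') (a, emb b) \<le> dist a' a + dist (emb b') (emb b)"
      by (simp add: dist_Pair_Pair sqrt_sum_squares_le_sum)
    then show "dist (a', emb b') (a, emb b) < d" using that by linarith
  qed
  then show "\<exists>d>0. \<forall>a' b'. dist a' a < d \<longrightarrow> dist (emb b') (emb b) < d \<longrightarrow> P (a', b')"
    using d(1) by (intro exI[of _ "d/2"]) auto
next
  assume "\<exists>d>0. \<forall>a' b'. dist a' a < d \<longrightarrow> dist (emb b') (emb b) < d \<longrightarrow> P (a', b')"
  then obtain d where d: "d > 0"
    "\<And>a' b'. dist a' a < d \<Longrightarrow> dist (emb b') (emb b) < d \<Longrightarrow> P (a', b')" by blast
  have "eventually (\<lambda>p. dist p (a, emb b) < d) (nhds (a, emb b))"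
    using d(1) by (auto simp: eventually_nhds_metric)
  moreover have "P (a', b')" if "dist (a', emb b') (a, emb b) < d" for a' b'
    using that dist_fst_le[of "(a', emb b')" "(a, emb b)"] dist_snd_le[of "(a', emb b')" "(a, emb b)"]
    by (intro d(2)) auto
  ultimately show "eventually P (nhds_emb a b)"
    unfolding nhds_emb_def eventually_filtercomap
    by (intro exI[of _ "\<lambda>p. dist p (a, emb b) < d"]) auto
qed

lemma tendsto_nhds_emb_fst: "(fst \<longlongrightarrow> a) (nhds_emb a b)"
  unfolding tendsto_iff eventually_nhds_emb by auto

lemma tendsto_nhds_emb_C:
  assumes "f \<in> C_compactified"
  shows "((\<lambda>p. f (snd p)) \<longlongrightarrow> f b) (nhds_emb a b)"
proof (rule topological_tendstoI)
  fix S assume S: "open S" "f b \<in> S"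
  have "openin compactified {x. f x \<in> S}"
    using assms S(1) by (auto simp: C_compactified_def continuous_map)
  from openin_compactified_emb[OF this, of b] S(2)
  show "\<forall>\<^sub>F p in nhds_emb a b. f (snd p) \<in> S"
    unfolding eventually_nhds_emb by auto
qed

lemma tendsto_nhds_emb_chi:
  fixes chi :: "(real^'n) \<times> (real^'n) option \<Rightarrow> 'b::topological_space"
  assumes "topcontinuous_at (prod_topology euclidean compactified) euclidean chi (a, b)"
  shows "(chi \<longlongrightarrow> chi (a, b)) (nhds_emb a b)"
proof (rule topological_tendstoI)
  fix S :: "'b set" assume S: "open S" "chi (a, b) \<in> S"
  then obtain U where U: "openin (prod_topology euclidean compactified) U" "(a, b) \<in> U"
    "\<forall>y\<in>U. chi y \<in> S"
    using assms unfolding topcontinuous_at_def by (metis open_openin)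
  then obtain V W where VW: "open V" "openin compactified W" "a \<in> V" "b \<in> W" "V \<times> W \<subseteq> U"
    unfolding openin_prod_topology_alt by (metis open_openin)
  obtain d1 where d1: "d1 > 0" "\<And>c. dist (emb c) (emb b) < d1 \<Longrightarrow> c \<in> W"
    using openin_compactified_emb[OF VW(2,4)] by blast
  obtain d2 where d2: "d2 > 0" "\<And>c. dist c a < d2 \<Longrightarrow> c \<in> V"
    using VW(1,3) unfolding open_dist by blast
  show "\<forall>\<^sub>F p in nhds_emb a b. chi p \<in> S"
    unfolding eventually_nhds_emb
    by (rule exI[of _ "min d1 d2"]) (use d1 d2 VW(5) U(3) in auto)
qed

section \<open>Borel sets and Borel functions on the compactification\<close>

lemma space_borel_compactified [simp]: "space borel_compactified = UNIV"
  by (simp add: borel_compactified_def)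

lemma measurable_compactified:
  fixes f :: "(real^'n) option \<Rightarrow> 'b::topological_space"
  assumes "continuous_map compactified euclidean f"
  shows "f \<in> borel_measurable borel_compactified"
proof (rule borel_measurableI)
  fix S :: "'b set" assume "open S"
  then have "openin compactified {x. f x \<in> S}"
    using assms by (auto simp: continuous_map)
  then have "f -` S \<in> sets borel_compactified"
    unfolding borel_compactified_def vimage_def by auto
  then show "f -` S \<inter> space borel_compactified \<in> sets borel_compactified"
    by simp
qed

lemma C_compactified_measurable: "f \<in> C_compactified \<Longrightarrow> f \<in> borel_measurable borel_compactified"
  by (simp add: C_compactified_def measurable_compactified)

lemma Some_open_in_sets: "open S \<Longrightarrow> Some ` S \<in> sets borel_compactified"
  by (auto simp: borel_compactified_def compactified_def intro!: sigma_sets.Basic)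

lemma sets_singleton_Some: "{Some a} \<in> sets borel_compactified"
proof -
  have "openin compactified (UNIV - {Some a})"
  proof -
    have "closedin compactified (Some ` {a})"
      unfolding compactified_def by (simp only: closedin_Alexandroff_compactification_image_Some) auto
    then show ?thesis by (simp add: closedin_def)
  qed
  then have "UNIV - {Some a} \<in> sets borel_compactified"
    by (auto simp: borel_compactified_def)
  then have "space borel_compactified - (UNIV - {Some a}) \<in> sets borel_compactified"
    by (rule sets.compl_sets)
  then show ?thesis by (simp add: Diff_Diff_Int)
qed

subsection \<open>Smooth test functions\<close>

lemma partial_eq:
  assumes "(f has_derivative D) (at x)"
  shows "partial i f x = D (axis i 1)"
  unfolding partial_def using frechet_derivative_at[OF assms] by simp

text \<open>A derivative sees a function only near the point. The test functions used later are
  explicit polynomials near the base point, and their partial derivatives are read off from these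
  polynomials.\<close>

lemma partial_cong_open:
  assumes "open S" "x \<in> S" "\<And>y. y \<in> S \<Longrightarrow> f y = g y"
  shows "partial i f x = partial i g x"
proof -
  have "(f has_derivative D) (at x) \<longleftrightarrow> (g has_derivative D) (at x)" for D
    using has_derivative_transform_within_open[OF _ assms(1,2), of f D UNIV g]
      has_derivative_transform_within_open[OF _ assms(1,2), of g D UNIV f] assms(3) by auto
  then show ?thesis by (simp add: partial_def frechet_derivative_def)
qed

lemma partial2_cong_open:
  assumes "open S" "x \<in> S" "\<And>y. y \<in> S \<Longrightarrow> f y = g y"
  shows "partial i (partial j f) x = partial i (partial j g) x"
  by (rule partial_cong_open[OF assms(1,2)]) (rule partial_cong_open[OF assms(1)], use assms in auto)

text \<open>For \<open>k = 0\<close> this is the classical function exp(-1/t) that is flat at 0. The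
  factors (1/t)^k make the family closed, up to linear combinations, under differentiation.\<close>

definition flat_exp :: "nat \<Rightarrow> real \<Rightarrow> real" where
  "flat_exp k t = (if t > 0 then (1 / t) ^ k * exp (- (1 / t)) else 0)"

lemma flat_exp_nonneg: "flat_exp k t \<ge> 0"
  by (simp add: flat_exp_def)

lemma flat_exp_mono0: "s \<le> t \<Longrightarrow> flat_exp 0 s \<le> flat_exp 0 t"
  by (auto simp: flat_exp_def frac_le)

lemma flat_exp_tendsto: "(flat_exp k \<longlongrightarrow> 0) (at 0)"
proof -
  have "((\<lambda>x::real. x ^ k / exp x) \<longlongrightarrow> 0) at_top"
    by (rule tendsto_power_div_exp_0)
  from filterlim_compose[OF this filterlim_inverse_at_top_right]
  have "((\<lambda>t::real. (1 / t) ^ k * exp (- (1 / t))) \<longlongrightarrow> 0) (at_right 0)"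
    by (simp add: exp_minus divide_inverse)
  then have r: "(flat_exp k \<longlongrightarrow> 0) (at_right 0)"
    by (rule Lim_transform_eventually) (auto simp: eventually_at_filter flat_exp_def)
  have l: "(flat_exp k \<longlongrightarrow> 0) (at_left 0)"
    by (rule Lim_transform_eventually[OF tendsto_const]) (auto simp: eventually_at_filter flat_exp_def)
  show ?thesis using r l by (simp add: filterlim_at_split)
qed

lemma flat_exp_deriv:
  "(flat_exp k has_real_derivative (flat_exp (k + 2) t - k * flat_exp (k + 1) t)) (at t)"
proof -
  consider "t > 0" | "t < 0" | "t = 0" by linarith
  then show ?thesis
  proof cases
    case 1
    define u where "u = 1 / t"
    have "((\<lambda>u. u ^ k * exp (- u)) has_real_derivative
        (k * u ^ (k - 1) * exp (- u) - u ^ k * exp (- u))) (at (1 / t))"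
      unfolding u_def by (auto intro!: derivative_eq_intros)
    moreover have "((\<lambda>t. 1 / t) has_real_derivative (- (u\<^sup>2))) (at t)"
      using 1 by (auto intro!: derivative_eq_intros simp: u_def power2_eq_square)
    ultimately have "((\<lambda>t. (1 / t) ^ k * exp (- (1 / t))) has_real_derivative
        (k * u ^ (k - 1) * exp (- u) - u ^ k * exp (- u)) * (- (u\<^sup>2))) (at t)"
      by (rule DERIV_chain2)
    moreover have "(k * u ^ (k - 1) * exp (- u) - u ^ k * exp (- u)) * (- (u\<^sup>2))
        = flat_exp (k + 2) t - k * flat_exp (k + 1) t"
    proof -
      have gen: "(x * E - y * E) * (- w) = y * w * E - (x * w) * E" for x y E w :: real
        by (simp add: algebra_simps)
      have fl: "flat_exp m t = u ^ m * exp (- u)" for m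
        using 1 by (simp add: flat_exp_def u_def)
      \<comment> \<open>At \<open>k = 0\<close> the exponent \<open>k - 1\<close> is truncated to 0,
        but both sides vanish because of the factor \<open>k\<close>.\<close>
      have k: "k * u ^ (k - 1) * u\<^sup>2 = k * u ^ (k + 1)"
        by (cases k) (simp_all add: power2_eq_square)
      have "(k * u ^ (k - 1) * exp (- u) - u ^ k * exp (- u)) * (- (u\<^sup>2))
          = u ^ k * u\<^sup>2 * exp (- u) - (k * u ^ (k - 1) * u\<^sup>2) * exp (- u)"
        by (rule gen)
      also have "\<dots> = flat_exp (k + 2) t - k * flat_exp (k + 1) t"
        unfolding k by (simp only: fl power_add mult.assoc)
      finally show ?thesis .
    qed
    ultimately have "((\<lambda>t. (1 / t) ^ k * exp (- (1 / t))) has_real_derivative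
        (flat_exp (k + 2) t - k * flat_exp (k + 1) t)) (at t)" by simp
    then show ?thesis
      by (rule has_field_derivative_transform_within_open[where S = "{0<..}"])
        (use 1 in \<open>auto simp: flat_exp_def\<close>)
  next
    case 2
    have "((\<lambda>t. 0) has_real_derivative (flat_exp (k + 2) t - k * flat_exp (k + 1) t)) (at t)"
      using 2 by (simp add: flat_exp_def)
    then show ?thesis
      by (rule has_field_derivative_transform_within_open[where S = "{..<0}"])
        (use 2 in \<open>auto simp: flat_exp_def\<close>)
  next
    case 3
    \<comment> \<open>The difference quotient of \<open>flat_exp k\<close> at 0 is exactly
      \<open>flat_exp (k + 1)\<close>.\<close>
    have "((\<lambda>h. (flat_exp k (0 + h) - flat_exp k 0) / h) \<longlongrightarrow> 0) (at 0)"
      by (rule Lim_transform_eventually[OF flat_exp_tendsto[of "k + 1"]])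
        (auto simp: eventually_at_filter flat_exp_def)
    then show ?thesis using 3 by (simp add: DERIV_def flat_exp_def)
  qed
qed

text \<open>Closed under partial derivatives by construction (note \<open>flat_exp_deriv\<close>), hence consisting of
  smooth functions without any chain or product rule for \<open>Ck\<close>.\<close>

inductive_set smooth_alg :: "(real^'n \<Rightarrow> real) set" where
  const: "(\<lambda>x. c) \<in> smooth_alg"
| coord: "(\<lambda>x. x $ i) \<in> smooth_alg"
| add: "f \<in> smooth_alg \<Longrightarrow> g \<in> smooth_alg \<Longrightarrow> (\<lambda>x. f x + g x) \<in> smooth_alg"
| mult: "f \<in> smooth_alg \<Longrightarrow> g \<in> smooth_alg \<Longrightarrow> (\<lambda>x. f x * g x) \<in> smooth_alg"
| flat: "f \<in> smooth_alg \<Longrightarrow> (\<lambda>x. flat_exp k (f x)) \<in> smooth_alg"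

lemma smooth_alg_diff:
  assumes "f \<in> smooth_alg" "g \<in> smooth_alg"
  shows "(\<lambda>x. f x - g x) \<in> smooth_alg"
proof -
  have "(\<lambda>x. f x + (- 1) * g x) \<in> smooth_alg" by (intro smooth_alg.intros assms)
  then show ?thesis by simp
qed

lemma smooth_alg_sum:
  assumes "\<And>i. i \<in> I \<Longrightarrow> f i \<in> smooth_alg"
  shows "(\<lambda>x. \<Sum>i\<in>I. f i x) \<in> smooth_alg"
proof (cases "finite I")
  case True
  then show ?thesis using assms
    by (induction I rule: finite_induct) (auto intro: smooth_alg.intros)
qed (simp add: smooth_alg.const)

text \<open>The coefficients \<open>D i\<close> are required to lie in the algebra again, so that
  partial derivatives can be iterated; this is what the induction on the order in
  \<open>smooth_alg_Ck\<close> consumes.\<close>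

lemma smooth_alg_has_derivative:
  fixes f :: "real^'n \<Rightarrow> real"
  assumes "f \<in> smooth_alg"
  shows "\<exists>D. (\<forall>i. D i \<in> smooth_alg) \<and>
    (\<forall>x. (f has_derivative (\<lambda>h. \<Sum>i\<in>UNIV. D i x * h $ i)) (at x))"
  using assms
proof (induction rule: smooth_alg.induct)
  case (const c)
  show ?case by (intro exI[of _ "\<lambda>i x. 0"]) (simp add: smooth_alg.const)
next
  case (coord i)
  show ?case
  proof (intro exI[of _ "\<lambda>j x. if j = i then 1 else 0"] conjI allI)
    fix x :: "real^'n"
    have eq: "(\<lambda>h. \<Sum>j\<in>UNIV. (if j = i then 1 else 0) * h $ j) = (\<lambda>h::real^'n. h $ i)"
      by (rule ext) (simp add: mult_delta_left)
    show "((\<lambda>x. x $ i) has_derivative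
        (\<lambda>h. \<Sum>j\<in>UNIV. (if j = i then 1 else 0) * h $ j)) (at x)"
      unfolding eq by (rule bounded_linear_imp_has_derivative[OF bounded_linear_vec_nth])
  qed (simp add: smooth_alg.const)
next
  case (add f g)
  obtain D where D: "\<And>i. D i \<in> smooth_alg"
    "\<And>x. (f has_derivative (\<lambda>h. \<Sum>i\<in>UNIV. D i x * h $ i)) (at x)"
    using add.IH(1) by (elim exE conjE) (rule that, (erule spec)+)
  obtain E where E: "\<And>i. E i \<in> smooth_alg"
    "\<And>x. (g has_derivative (\<lambda>h. \<Sum>i\<in>UNIV. E i x * h $ i)) (at x)"
    using add.IH(2) by (elim exE conjE) (rule that, (erule spec)+)
  show ?case
  proof (intro exI[of _ "\<lambda>i x. D i x + E i x"] conjI allI)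
    show "(\<lambda>x. D i x + E i x) \<in> smooth_alg" for i by (rule smooth_alg.add[OF D(1) E(1)])
    show "((\<lambda>x. f x + g x) has_derivative (\<lambda>h. \<Sum>i\<in>UNIV. (D i x + E i x) * h $ i)) (at x)" for x
      using has_derivative_add[OF D(2) E(2), of x] by (simp only: sum.distrib distrib_right)
  qed
next
  case (mult f g)
  obtain D where D: "\<And>i. D i \<in> smooth_alg"
    "\<And>x. (f has_derivative (\<lambda>h. \<Sum>i\<in>UNIV. D i x * h $ i)) (at x)"
    using mult.IH(1) by (elim exE conjE) (rule that, (erule spec)+)
  obtain E where E: "\<And>i. E i \<in> smooth_alg"
    "\<And>x. (g has_derivative (\<lambda>h. \<Sum>i\<in>UNIV. E i x * h $ i)) (at x)"
    using mult.IH(2) by (elim exE conjE) (rule that, (erule spec)+)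
  have eq: "(\<lambda>h. f x * (\<Sum>i\<in>UNIV. E i x * h $ i) + (\<Sum>i\<in>UNIV. D i x * h $ i) * g x)
      = (\<lambda>h. \<Sum>i\<in>UNIV. (f x * E i x + D i x * g x) * h $ i)" for x
    by (rule ext) (simp add: sum_distrib_left sum_distrib_right distrib_left distrib_right sum.distrib mult.assoc
          mult.commute mult.left_commute)
  show ?case
  proof (intro exI[of _ "\<lambda>i x. f x * E i x + D i x * g x"] conjI allI)
    show "(\<lambda>x. f x * E i x + D i x * g x) \<in> smooth_alg" for i
      using mult(1,2) D(1) E(1) by (simp add: smooth_alg.add smooth_alg.mult)
    show "((\<lambda>x. f x * g x) has_derivative
        (\<lambda>h. \<Sum>i\<in>UNIV. (f x * E i x + D i x * g x) * h $ i)) (at x)" for x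
      using has_derivative_mult[OF D(2) E(2), of x] by (simp only: eq)
  qed
next
  case (flat f k)
  obtain D where D: "\<And>i. D i \<in> smooth_alg"
    "\<And>x. (f has_derivative (\<lambda>h. \<Sum>i\<in>UNIV. D i x * h $ i)) (at x)"
    using flat.IH by (elim exE conjE) (rule that, (erule spec)+)
  define E where "E i x = (flat_exp (k + 2) (f x) - k * flat_exp (k + 1) (f x)) * D i x" for i x
  have "(\<lambda>x. flat_exp (k + 2) (f x) - k * flat_exp (k + 1) (f x)) \<in> smooth_alg"
    by (rule smooth_alg_diff[OF smooth_alg.flat[OF flat(1)]
          smooth_alg.mult[OF smooth_alg.const smooth_alg.flat[OF flat(1)]]])
  then have "E i \<in> smooth_alg" for i
    unfolding E_def by (rule smooth_alg.mult[OF _ D(1)])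
  moreover have "((\<lambda>x. flat_exp k (f x)) has_derivative (\<lambda>h. \<Sum>i\<in>UNIV. E i x * h $ i)) (at x)" for x
  proof -
    have eq: "(\<lambda>h. (\<Sum>i\<in>UNIV. D i x * h $ i)
          * (flat_exp (k + 2) (f x) - k * flat_exp (k + 1) (f x)))
        = (\<lambda>h. \<Sum>i\<in>UNIV. E i x * h $ i)"
      by (rule ext) (simp add: E_def sum_distrib_right mult.assoc mult.commute mult.left_commute)
    have "((\<lambda>x. flat_exp k (f x)) has_derivative (\<lambda>h. (\<Sum>i\<in>UNIV. D i x * h $ i)
          * (flat_exp (k + 2) (f x) - k * flat_exp (k + 1) (f x)))) (at x)"
      using has_derivative_compose[OF D(2) flat_exp_deriv[unfolded has_field_derivative_def]]
      by (simp only: mult.commute)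
    then show ?thesis unfolding eq .
  qed
  ultimately show ?case by (intro exI[of _ E] conjI allI)
qed

lemma smooth_alg_partial:
  assumes "f \<in> smooth_alg"
  shows "partial i f \<in> smooth_alg" "f differentiable_on UNIV"
proof -
  obtain D where D: "\<And>i. D i \<in> smooth_alg"
    "\<And>x. (f has_derivative (\<lambda>h. \<Sum>i\<in>UNIV. D i x * h $ i)) (at x)"
    using smooth_alg_has_derivative[OF assms] by (elim exE conjE) (rule that, (erule spec)+)
  have "partial i f x = D i x" for x
    using partial_eq[OF D(2), of i x]
    by (simp add: axis_def mult_delta_right)
  then have "partial i f = D i" by blast
  then show "partial i f \<in> smooth_alg" using D by simp
  show "f differentiable_on UNIV"
    using D(2) by (auto simp: differentiable_on_def differentiable_def)
qed

lemma smooth_alg_continuous: "f \<in> smooth_alg \<Longrightarrow> continuous_on UNIV f"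
  using smooth_alg_partial(2) differentiable_imp_continuous_on by blast

lemma smooth_alg_Ck: "f \<in> smooth_alg \<Longrightarrow> Ck k f"
  by (induction k arbitrary: f) (auto simp: smooth_alg_continuous smooth_alg_partial)

text \<open>A part of \<open>Cc_infinity\<close> with easy smoothness proofs that is still rich
  enough for the converse directions: it contains bumps and bumps times polynomials, and with
  constants added it is uniformly dense in \<open>C_compactified\<close>.\<close>

definition test_funs :: "(real^'n \<Rightarrow> real) set" where
  "test_funs = {f \<in> smooth_alg. \<exists>R. \<forall>x. norm x \<ge> R \<longrightarrow> f x = 0}"

lemma test_funs_Cc: "f \<in> test_funs \<Longrightarrow> f \<in> Cc_infinity"
proof -
  assume f: "f \<in> test_funs"
  then obtain R where R: "\<And>x. norm x \<ge> R \<Longrightarrow> f x = 0" by (auto simp: test_funs_def)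
  have "norm x \<le> R" if "f x \<noteq> 0" for x using R[of x] that by linarith
  then have "bounded {x. f x \<noteq> 0}" unfolding bounded_iff by blast
  then show ?thesis using f by (simp add: Cc_infinity_def test_funs_def smooth_alg_Ck)
qed

lemma test_funs_mult_right: "f \<in> test_funs \<Longrightarrow> g \<in> smooth_alg \<Longrightarrow> (\<lambda>x. g x * f x) \<in> test_funs"
  by (auto simp: test_funs_def intro: smooth_alg.mult)

lemma test_funs_add: "f \<in> test_funs \<Longrightarrow> g \<in> test_funs \<Longrightarrow> (\<lambda>x. f x + g x) \<in> test_funs"
  unfolding test_funs_def 
proof (clarsimp, intro conjI smooth_alg.add)
  fix R R' assume "\<forall>x. R \<le> norm x \<longrightarrow> f x = 0" "\<forall>x. R' \<le> norm x \<longrightarrow> g x = 0"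
  then show "\<exists>R. \<forall>x. R \<le> norm x \<longrightarrow> f x + g x = 0"
    by (intro exI[of _ "max R R'"]) auto
qed

lemma bump_exists:
  fixes a :: "real^'n"
  assumes "r > 0"
  obtains \<phi> where "\<phi> \<in> test_funs" "\<And>x. 0 \<le> \<phi> x" "\<And>x. \<phi> x \<le> 1"
    "\<And>x. dist x a \<le> r / 2 \<Longrightarrow> \<phi> x = 1" "\<And>x. dist x a \<ge> r \<Longrightarrow> \<phi> x = 0"
proof -
  define s where "s x = (\<Sum>i\<in>UNIV. (x $ i - a $ i) * (x $ i - a $ i))" for x :: "real^'n"
  have s: "s x = (dist x a)\<^sup>2" for x
    by (simp add: s_def dist_norm power2_norm_eq_inner inner_vec_def)
  \<comment> \<open>This is the value of \<open>u\<close> at distance r, because r^2 - r^2/4 = 3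
    r^2/4.\<close>
  define c where "c = flat_exp 0 (3 * r\<^sup>2 / 4)"
  define u where "u x = flat_exp 0 (s x - r\<^sup>2 / 4)" for x
  define \<phi> where "\<phi> x = flat_exp 0 (c - u x) * (1 / flat_exp 0 c)" for x
  have c: "c > 0" using assms by (simp add: c_def flat_exp_def)
  then have fc: "flat_exp 0 c > 0" by (simp add: flat_exp_def)
  have "s \<in> smooth_alg" unfolding s_def
    by (intro smooth_alg_sum smooth_alg.mult smooth_alg_diff smooth_alg.coord smooth_alg.const)
  then have sm: "\<phi> \<in> smooth_alg" unfolding \<phi>_def u_def
    by (intro smooth_alg.mult smooth_alg_diff smooth_alg.flat smooth_alg.const)
  have zero: "\<phi> x = 0" if "dist x a \<ge> r" for x
  proof -
    have "s x \<ge> r\<^sup>2" unfolding s using that assms by (intro power_mono) auto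
    then have "u x \<ge> c" unfolding u_def c_def by (intro flat_exp_mono0) simp
    then show ?thesis by (simp add: \<phi>_def flat_exp_def)
  qed
  show ?thesis
  proof
    have "\<phi> x = 0" if "norm x \<ge> norm a + r" for x
      by (rule zero) (use that norm_triangle_ineq2[of x a] in \<open>simp add: dist_norm\<close>)
    then show "\<phi> \<in> test_funs" using sm by (auto simp: test_funs_def)
    show "0 \<le> \<phi> x" for x by (simp add: \<phi>_def flat_exp_nonneg)
    have "flat_exp 0 (c - u x) \<le> flat_exp 0 c" for x
      by (rule flat_exp_mono0) (simp add: u_def flat_exp_nonneg)
    then show "\<phi> x \<le> 1" for x using fc by (simp add: \<phi>_def)
    show "\<phi> x = 1" if "dist x a \<le> r / 2" for x
    proof -
      have "s x \<le> (r / 2)\<^sup>2" unfolding s using that by (intro power_mono) auto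
      then have "u x = 0" by (simp add: u_def flat_exp_def power_divide)
      then show ?thesis using fc by (simp add: \<phi>_def)
    qed
  qed (rule zero)
qed

section \<open>From compactly supported functions to continuous functions on the
  compactification\<close>

lemma Cc_vanishes_at_infinity:
  assumes "compact (closure {x::real^'n. f x \<noteq> (0::real)})"
  shows "((\<lambda>x. ext0 f (Some x)) \<longlongrightarrow> ext0 f None) at_infinity"
proof -
  have "bounded {x. f x \<noteq> 0}"
    using assms by (meson bounded_subset closure_subset compact_imp_bounded)
  then obtain B where B: "\<And>x. f x \<noteq> 0 \<Longrightarrow> norm x \<le> B" unfolding bounded_iff by auto
  have "eventually (\<lambda>x. (0::real) = ext0 f (Some x)) at_infinity"
    unfolding eventually_at_infinity ext0_def using B by (intro exI[of _ "B + 1"]) force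
  then show ?thesis
    by (intro Lim_transform_eventually[OF tendsto_const]) (simp add: ext0_def)
qed

lemma Cc_continuous: "f \<in> Cc_infinity \<Longrightarrow> continuous_on UNIV f"
  unfolding Cc_infinity_def by (auto dest: spec[of _ 0])

lemma ext0_C_compactified:
  assumes "f \<in> Cc_infinity"
  shows "ext0 f \<in> C_compactified"
proof (rule C_compactifiedI)
  show "continuous_on UNIV (\<lambda>x. ext0 f (Some x))"
    using Cc_continuous[OF assms] by (simp add: ext0_def)
  show "((\<lambda>x. ext0 f (Some x)) \<longlongrightarrow> ext0 f None) at_infinity"
    by (rule Cc_vanishes_at_infinity) (use assms in \<open>simp add: Cc_infinity_def\<close>)
qed

text \<open>Stone-Weierstrass on the compact set \<open>range emb\<close>. The constant
  \<open>c\<close> supplies the value at infinity, where extended test functions vanish; sums c + g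
  form an algebra, and bumps separate points, including finite points from infinity.\<close>

lemma test_funs_dense:
  fixes f :: "(real^'n) option \<Rightarrow> real"
  assumes "f \<in> C_compactified" "e > 0"
  obtains c g where "g \<in> test_funs" "\<And>b. \<bar>f b - (c + ext0 g b)\<bar> < e"
proof -
  define S where "S = range (emb :: (real^'n) option \<Rightarrow> _)"
  define R where "R = {h. \<exists>c. \<exists>g\<in>test_funs. \<forall>b::(real^'n) option. h (emb b) = c + ext0 g b}"
  \<comment> \<open>Continuity transfers to the image because the inverse of \<open>emb\<close> is
    continuous there, by \<open>openin_compactified_emb\<close>.\<close>
  have cont: "continuous_on S h" if "k \<in> C_compactified" "\<And>b. h (emb b) = k b" for h k
    unfolding continuous_on_iff
  proof (intro ballI allI impI)
    fix y and d :: real assume "y \<in> S" "d > 0"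
    then obtain b where b: "y = emb b" unfolding S_def by auto
    have "openin compactified {x. k x \<in> ball (k b) d}"
      using that(1) by (auto simp: C_compactified_def continuous_map simp del: mem_ball)
    from openin_compactified_emb[OF this, of b] \<open>d > 0\<close>
    obtain e where "e > 0" "\<And>c. dist (emb c) (emb b) < e \<Longrightarrow> dist (k b) (k c) < d"
      by auto
    then show "\<exists>e>0. \<forall>x'\<in>S. dist x' y < e \<longrightarrow> dist (h x') (h y) < d"
      unfolding S_def b by (intro exI[of _ e]) (auto simp: that(2) dist_commute)
  qed
  interpret function_ring_on R S
  proof
    show "compact S" unfolding S_def by (rule compact_range_emb)
    show "continuous_on S h" if "h \<in> R" for h
    proof -
      from that obtain c g where "g \<in> test_funs" "\<And>b. h (emb b) = c + ext0 g b"
        unfolding R_def by blast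
      then show ?thesis
        by (intro cont[of "\<lambda>b. c + ext0 g b"] C_compactified_add C_compactified_const
              ext0_C_compactified test_funs_Cc)
    qed
    show "(\<lambda>x. h x + k x) \<in> R" if hk: "h \<in> R" "k \<in> R" for h k
    proof -
      from hk obtain c g c' g' where "g \<in> test_funs" "\<And>b. h (emb b) = c + ext0 g b"
         "g' \<in> test_funs" "\<And>b. k (emb b) = c' + ext0 g' b"
        unfolding R_def by blast
      then show ?thesis unfolding R_def
        by (intro CollectI exI[of _ "c + c'"] bexI[of _ "\<lambda>x. g x + g' x"] test_funs_add)
          (auto simp: ext0_def split: option.split)
    qed
    show "(\<lambda>x. h x * k x) \<in> R" if hk: "h \<in> R" "k \<in> R" for h k
    proof -
      from hk obtain c g c' g' where *: "g \<in> test_funs" "\<And>b. h (emb b) = c + ext0 g b"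
         "g' \<in> test_funs" "\<And>b. k (emb b) = c' + ext0 g' b"
        unfolding R_def by blast
      have "(\<lambda>x. g' x * g x + (c * g' x + c' * g x)) \<in> test_funs"
        by (intro test_funs_add test_funs_mult_right smooth_alg.const *(1,3))
          (use *(3) in \<open>simp add: test_funs_def\<close>)
      then show ?thesis unfolding R_def
        using *(2,4)
        by (intro CollectI exI[of _ "c * c'"] bexI[of _ "\<lambda>x. g' x * g x + (c * g' x + c' * g x)"])
          (auto simp: ext0_def algebra_simps split: option.split)
    qed
    show "(\<lambda>_. c) \<in> R" for c
      unfolding R_def
      by (intro CollectI exI[of _ c] bexI[of _ "\<lambda>x. 0"])
        (auto simp: ext0_def test_funs_def smooth_alg.const split: option.split)
    show "\<exists>f\<in>R. f x \<noteq> f y" if xy: "x \<in> S" "y \<in> S" "x \<noteq> y" for x y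
    proof -
      have sep: "\<exists>g\<in>test_funs. ext0 g (Some p) \<noteq> ext0 g b" if "b \<noteq> Some p" for p :: "real^'n" and b
      proof (cases b)
        case None
        obtain \<phi> where "\<phi> \<in> test_funs" "\<And>x. dist x p \<le> 1/2 \<Longrightarrow> \<phi> x = 1"
          using bump_exists[of 1 p] by (metis zero_less_one)
        then show ?thesis by (intro bexI[of _ \<phi>]) (auto simp: ext0_def None)
      next
        case (Some q)
        then have "dist q p > 0" using that by auto
        then obtain \<phi> where "\<phi> \<in> test_funs" "\<And>x. dist x p \<le> dist q p/2 \<Longrightarrow> \<phi> x = 1"
            "\<And>x. dist x p \<ge> dist q p \<Longrightarrow> \<phi> x = 0"
          using bump_exists[of "dist q p" p] by metis
        then show ?thesis by (intro bexI[of _ \<phi>]) (auto simp: ext0_def Some)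
      qed
      obtain b b' where b: "x = emb b" "y = emb b'" "b \<noteq> b'" using xy unfolding S_def by auto
      have "\<exists>g\<in>test_funs. ext0 g b \<noteq> ext0 g b'"
        using sep b(3) by (cases b; cases b') (metis option.distinct(1))+
      then obtain g where g: "g \<in> test_funs" "ext0 g b \<noteq> ext0 g b'" by blast
      have "inv emb (emb c) = c" for c :: "(real^'n) option" by (rule inv_f_f[OF inj_emb])
      then show ?thesis using g b
        by (intro bexI[of _ "\<lambda>y. ext0 g (inv emb y)"])
          (auto simp: R_def intro!: exI[of _ 0] bexI[of _ g])
    qed
  qed
  have inv: "inv emb (emb c) = c" for c :: "(real^'n) option" by (rule inv_f_f[OF inj_emb])
  have "continuous_on S (\<lambda>y. f (inv emb y))"
    by (rule cont[OF assms(1)]) (simp add: inv)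
  from Stone_Weierstrass_basic[OF this assms(2)] obtain h where
    h: "h \<in> R" "\<And>x. x \<in> S \<Longrightarrow> \<bar>f (inv emb x) - h x\<bar> < e" by blast
  from h(1) obtain c g where g: "g \<in> test_funs" "\<And>b. h (emb b) = c + ext0 g b"
    unfolding R_def by blast
  have "\<bar>f b - (c + ext0 g b)\<bar> < e" for b
    using h(2)[of "emb b"] by (simp add: S_def inv g(2))
  then show ?thesis by (rule that[OF g(1)])
qed

subsection \<open>Convergence of integrals of small-jump functions\<close>

definition levy_measure :: "real^'n \<Rightarrow> (real^'n) option measure \<Rightarrow> bool" where
  "levy_measure a N \<longleftrightarrow> sets N = sets borel_compactified \<and> emeasure N {Some a} = 0 \<and>
     (\<integral>\<^sup>+ b. ennreal (levy_weight a b) \<partial>N) < \<infinity>"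

lemma levy_triplet_levy_measure: "levy_triplet a d g N \<Longrightarrow> levy_measure a N"
  by (simp add: levy_triplet_def levy_measure_def)

lemma levy_weight_nonneg: "levy_weight a b \<ge> 0"
  by (auto simp: levy_weight_def split: option.split)

lemma levy_weight_C:
  fixes a :: "real^'n"
  shows "levy_weight a \<in> C_compactified"
proof (rule C_compactifiedI)
  show "continuous_on UNIV (\<lambda>x. levy_weight a (Some x))"
    unfolding levy_weight_def by (auto intro!: continuous_intros)
  have "eventually (\<lambda>x. 1 = levy_weight a (Some x)) at_infinity"
    unfolding eventually_at_infinity
  proof (intro exI allI impI)
    fix x :: "real^'n" assume "norm a + 1 \<le> norm x"
    then have "1 \<le> norm (x - a)" using norm_triangle_ineq2[of x a] by linarith
    then show "1 = levy_weight a (Some x)" by (simp add: levy_weight_def)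
  qed
  then show "((\<lambda>x. levy_weight a (Some x)) \<longlongrightarrow> levy_weight a None) at_infinity"
    by (intro Lim_transform_eventually[OF tendsto_const]) (auto simp: levy_weight_def)
qed

lemma levy_measure_AE: "levy_measure a N \<Longrightarrow> AE b in N. b \<noteq> Some a"
  by (rule AE_I[of _ _ "{Some a}"]) (auto simp: levy_measure_def sets_singleton_Some)

lemma levy_measure_measurable:
  "levy_measure a N \<Longrightarrow> f \<in> borel_measurable borel_compactified \<Longrightarrow> f \<in> borel_measurable N"
  by (simp add: levy_measure_def cong: measurable_cong_sets)

lemma levy_measure_integrable_weight:
  assumes "levy_measure a N"
  shows "integrable N (levy_weight a)"
proof (rule integrableI_nonneg)
  show "levy_weight a \<in> borel_measurable N"
    by (rule levy_measure_measurable[OF assms C_compactified_measurable[OF levy_weight_C]])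
qed (use assms in \<open>auto simp: levy_weight_nonneg levy_measure_def\<close>)

lemma levy_measure_integrable:
  fixes f :: "(real^'n) option \<Rightarrow> 'b::{banach, second_countable_topology}"
  assumes "levy_measure a N" "f \<in> borel_measurable borel_compactified"
    "\<And>b. b \<noteq> Some a \<Longrightarrow> norm (f b) \<le> K * levy_weight a b"
  shows "integrable N f"
proof (rule Bochner_Integration.integrable_bound)
  show "integrable N (\<lambda>b. K * levy_weight a b)"
    using levy_measure_integrable_weight[OF assms(1)] by simp
  show "f \<in> borel_measurable N" by (rule levy_measure_measurable[OF assms(1,2)])
  show "AE b in N. norm (f b) \<le> norm (K * levy_weight a b)"
    using levy_measure_AE[OF assms(1)]
    by eventually_elim (use assms(3) in \<open>force intro: order_trans\<close>)
qed

text \<open>Outside the ball of radius \<open>r\<close> the weight is at least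
  \<open>min 1 (r^2)\<close>, so a bounded function vanishing on that ball is dominated by a
  multiple of the weight.\<close>

lemma levy_measure_integrable_away:
  fixes f :: "(real^'n) option \<Rightarrow> real"
  assumes "levy_measure a N" "f \<in> borel_measurable borel_compactified"
    "r > 0" "\<And>x. dist x a < r \<Longrightarrow> f (Some x) = 0" "\<And>b. \<bar>f b\<bar> \<le> B"
  shows "integrable N f"
proof (rule levy_measure_integrable[OF assms(1,2)])
  define m where "m = min 1 (r\<^sup>2)"
  have m: "m > 0" "m \<le> 1" using assms(3) by (auto simp: m_def)
  have B: "B \<ge> 0" using assms(5)[of None] by linarith
  fix b
  show "norm (f b) \<le> B / m * levy_weight a b"
  proof (cases "\<exists>x. b = Some x \<and> dist x a < r")
    case True
    then show ?thesis using assms(4) B m by (auto simp: levy_weight_nonneg)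
  next
    case False
    have "levy_weight a b \<ge> m"
    proof (cases b)
      case (Some x)
      then have "r\<^sup>2 \<le> (dist x a)\<^sup>2" using False assms(3) by (intro power_mono) auto
      then show ?thesis by (auto simp: Some levy_weight_def m_def dist_norm)
    qed (simp add: levy_weight_def m_def)
    then have "B / m * levy_weight a b \<ge> B / m * m"
      using B m by (intro mult_left_mono) auto
    then show ?thesis using assms(5)[of b] m by simp
  qed
qed

text \<open>Piecewise linear suffices: a cutoff has to be continuous on the compactification, but it
  is never fed into the operator.\<close>

definition cutoff :: "real^'n \<Rightarrow> real \<Rightarrow> (real^'n) option \<Rightarrow> real" where
  "cutoff a r b = (case b of None \<Rightarrow> 1 | Some x \<Rightarrow> min 1 (max 0 (dist x a / r - 1)))"

lemma cutoff_bounds: "0 \<le> cutoff a r b" "cutoff a r b \<le> 1"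
  by (auto simp: cutoff_def split: option.split)

lemma cutoff_eq_0: "r > 0 \<Longrightarrow> dist x a \<le> r \<Longrightarrow> cutoff a r (Some x) = 0"
  by (simp add: cutoff_def)

lemma cutoff_eq_1: "r > 0 \<Longrightarrow> dist x a \<ge> 2 * r \<Longrightarrow> cutoff a r (Some x) = 1"
  by (simp add: cutoff_def field_simps)

lemma cutoff_None: "cutoff a r None = 1"
  by (simp add: cutoff_def)

lemma cutoff_C:
  fixes a :: "real^'n"
  assumes "r > 0"
  shows "cutoff a r \<in> C_compactified"
proof (rule C_compactifiedI)
  show "continuous_on UNIV (\<lambda>x. cutoff a r (Some x))"
    unfolding cutoff_def using assms by (auto intro!: continuous_intros)
  have "eventually (\<lambda>x. 1 = cutoff a r (Some x)) at_infinity"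
    unfolding eventually_at_infinity
  proof (intro exI allI impI)
    fix x :: "real^'n" assume "norm a + 2 * r \<le> norm x"
    then have "2 * r \<le> dist x a" using norm_triangle_ineq2[of x a] by (simp add: dist_norm)
    then show "1 = cutoff a r (Some x)" using assms by (simp add: cutoff_eq_1)
  qed
  then show "((\<lambda>x. cutoff a r (Some x)) \<longlongrightarrow> cutoff a r None) at_infinity"
    by (intro Lim_transform_eventually[OF tendsto_const]) (auto simp: cutoff_def)
qed

lemma interior_zero_ball:
  fixes f :: "(real^'n) option \<Rightarrow> real"
  shows "a \<in> interior {x. f (Some x) = 0} \<longleftrightarrow> (\<exists>r>0. \<forall>x. dist x a < r \<longrightarrow> f (Some x) = 0)"
  unfolding mem_interior by (auto simp: subset_iff dist_commute)

text \<open>The \<open>k\<close>-Lipschitz regularisation of \<open>h\<close> from above, frozen at \<open>a\<close> in the first argument. As \<open>k\<close>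
  grows it decreases to \<open>h a b\<close> wherever \<open>h\<close> is jointly continuous, so it replaces a Skorokhod-type
  coupling in the passage to the limit.\<close>

definition lip_env :: "(real^'n \<Rightarrow> (real^'n) option \<Rightarrow> real) \<Rightarrow> real^'n \<Rightarrow> nat \<Rightarrow> (real^'n) \<times> real \<Rightarrow> real" where
  "lip_env h a k y = (SUP p. h (fst p) (snd p) - k * (dist (fst p) a + dist y (emb (snd p))))"

context
  fixes h :: "real^'n \<Rightarrow> (real^'n) option \<Rightarrow> real" and B :: real
  assumes B: "\<And>a b. \<bar>h a b\<bar> \<le> B"
begin

lemma lip_env_upper:
  "h a' b' - real k * (dist a' a + dist y (emb b')) \<le> lip_env h a k y"
proof -
  have "bdd_above (range (\<lambda>p. h (fst p) (snd p) - k * (dist (fst p) a + dist y (emb (snd p)))))"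
  proof (rule bdd_aboveI2)
    fix p :: "(real^'n) \<times> (real^'n) option"
    have "real k * (dist (fst p) a + dist y (emb (snd p))) \<ge> 0" by simp
    then show "h (fst p) (snd p) - k * (dist (fst p) a + dist y (emb (snd p))) \<le> B"
      using B[of "fst p" "snd p"] by linarith
  qed
  from cSUP_upper[OF _ this, of "(a', b')"] show ?thesis by (simp add: lip_env_def)
qed

lemma lip_env_least:
  assumes "\<And>a' b'. h a' b' - real k * (dist a' a + dist y (emb b')) \<le> C"
  shows "lip_env h a k y \<le> C"
  unfolding lip_env_def by (rule cSUP_least) (use assms in auto)

lemma lip_env_bounds: "lip_env h a k (emb b) \<ge> h a b" "\<bar>lip_env h a k (emb b)\<bar> \<le> B"
proof -
  show 1: "lip_env h a k (emb b) \<ge> h a b"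
    using lip_env_upper[of a b k a "emb b"] by simp
  have "lip_env h a k (emb b) \<le> B"
  proof (rule lip_env_least)
    fix a' b'
    have "real k * (dist a' a + dist (emb b) (emb b')) \<ge> 0" by simp
    then show "h a' b' - k * (dist a' a + dist (emb b) (emb b')) \<le> B"
      using B[of a' b'] by linarith
  qed
  then show "\<bar>lip_env h a k (emb b)\<bar> \<le> B" using 1 B[of a b] by linarith
qed

lemma lip_env_lipschitz: "lip_env h a k y \<le> lip_env h a k z + k * dist y z"
proof (rule lip_env_least)
  fix a' b'
  have "k * dist z (emb b') \<le> k * (dist y z + dist y (emb b'))"
    by (rule mult_left_mono) (use dist_triangle[of z "emb b'" y] in \<open>auto simp: dist_commute\<close>)
  then show "h a' b' - real k * (dist a' a + dist y (emb b')) \<le> lip_env h a k z + k * dist y z"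
    using lip_env_upper[of a' b' k a z] by (simp add: algebra_simps)
qed

lemma lip_env_C: "(\<lambda>b. lip_env h a k (emb b)) \<in> C_compactified"
proof (rule C_compactified_emb)
  have "\<bar>lip_env h a k y - lip_env h a k z\<bar> \<le> k * dist y z" for y z
    using lip_env_lipschitz[of a k y z] lip_env_lipschitz[of a k z y] by (simp add: dist_commute)
  then have "(real k)-lipschitz_on UNIV (lip_env h a k)"
    by (auto simp: lipschitz_on_def dist_real_def)
  then show "continuous_on UNIV (lip_env h a k)" by (rule lipschitz_on_continuous_on)
qed

text \<open>Beyond distance \<open>d\<close> the penalty is at least \<open>k * d\<close>, which
  exceeds the full oscillation \<open>2 * B\<close> of \<open>h\<close> once
  \<open>k \<ge> 2 * B / d\<close>. For such \<open>k\<close> only points within \<open>d\<close>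
  compete in the supremum, and there \<open>h\<close> is within \<open>e / 2\<close> of its value at
  \<open>(a, b)\<close>.\<close>

lemma lip_env_tendsto:
  assumes "((\<lambda>(a', b'). h a' b') \<longlongrightarrow> h a b) (nhds_emb a b)"
  shows "(\<lambda>k. lip_env h a k (emb b)) \<longlonglongrightarrow> h a b"
proof (rule metric_LIMSEQ_I)
  fix e :: real assume e: "e > 0"
  have B0: "B \<ge> 0" using B[of a b] by linarith
  from tendstoD[OF assms, of "e/2"] e obtain d where d: "d > 0"
    "\<And>a' b'. dist a' a < d \<Longrightarrow> dist (emb b') (emb b) < d \<Longrightarrow> \<bar>h a' b' - h a b\<bar> < e / 2"
    unfolding eventually_nhds_emb by (auto simp: dist_real_def)
  obtain k0 :: nat where k0: "real k0 \<ge> 2 * B / d" using real_arch_simple by blast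
  show "\<exists>k0. \<forall>k\<ge>k0. dist (lip_env h a k (emb b)) (h a b) < e"
  proof (intro exI allI impI)
    fix k assume k: "k \<ge> k0"
    have "lip_env h a k (emb b) \<le> h a b + e / 2"
    proof (rule lip_env_least)
      fix a' b'
      let ?s = "dist a' a + dist (emb b) (emb b')"
      have ks: "real k * ?s \<ge> 0" by simp
      show "h a' b' - real k * ?s \<le> h a b + e / 2"
      proof (cases "?s < d")
        case True
        then have "dist a' a < d" "dist (emb b') (emb b) < d"
          using zero_le_dist[of a' a] zero_le_dist[of "emb b" "emb b'"] 
          by (auto simp: dist_commute intro: le_less_trans[rotated])
        then show ?thesis using d(2) ks by (smt (verit))
      next
        case False
        have "real k \<ge> 2 * B / d" using k k0 by (meson of_nat_mono order_trans)
        then have "2 * B \<le> real k * d" using d(1) by (simp add: field_simps)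
        also have "\<dots> \<le> real k * ?s" using False by (intro mult_left_mono) auto
        finally show ?thesis using B[of a' b'] B[of a b] e by linarith
      qed
    qed
    then show "dist (lip_env h a k (emb b)) (h a b) < e"
      using lip_env_bounds(1)[of a b k] e by (simp add: dist_real_def)
  qed
qed

end

text \<open>For fixed \<open>k\<close> the envelope satisfies h (A n) b \<le> u k b + k * dist (A n)
  a, which replaces the moving integrand by a fixed continuous function plus a vanishing constant.
  Vague convergence applies to the former; the latter is multiplied by the integral of
  \<open>\<phi>\<close>, which converges.\<close>

lemma weak_limit_upper:
  fixes h :: "real^'n \<Rightarrow> (real^'n) option \<Rightarrow> real"
  assumes lev: "\<And>n. levy_measure (A n) (N n)" "levy_measure a M"
    and A: "A \<longlonglongrightarrow> a"
    and vague: "\<And>f. f \<in> C_compactified \<Longrightarrow> a \<in> interior {x. f (Some x) = 0} \<Longrightarrow>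
      (\<lambda>n. \<integral>b. f b \<partial>N n) \<longlonglongrightarrow> (\<integral>b. f b \<partial>M)"
    and B: "\<And>a' b. \<bar>h a' b\<bar> \<le> B"
    and meas: "\<And>a'. h a' \<in> borel_measurable borel_compactified"
    and cont: "AE b in M. ((\<lambda>(a', b'). h a' b') \<longlongrightarrow> h a b) (nhds_emb a b)"
    and \<rho>: "\<rho> > 0" and \<eta>: "\<eta> > 0"
  shows "eventually (\<lambda>n. (\<integral>b. cutoff a \<rho> b * h (A n) b \<partial>N n)
    \<le> (\<integral>b. cutoff a \<rho> b * h a b \<partial>M) + \<eta>) sequentially"
proof -
  define \<phi> where "\<phi> = cutoff a \<rho>"
  define u where "u k b = lip_env h a k (emb b)" for k b
  have B0: "B \<ge> 0" using B[of a None] by linarith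
  have \<phi>: "\<phi> \<in> C_compactified" "\<And>b. 0 \<le> \<phi> b" "\<And>b. \<phi> b \<le> 1" "\<And>x. dist x a < \<rho> \<Longrightarrow> \<phi> (Some x) = 0"
    using \<rho> by (auto simp: \<phi>_def cutoff_C cutoff_bounds cutoff_eq_0)
  have \<phi>int: "a \<in> interior {x. \<phi> (Some x) * g (Some x) = 0}" for g
    unfolding interior_zero_ball[of a "\<lambda>b. \<phi> b * g b"] using \<phi>(4) \<rho> by auto
  have uC: "u k \<in> C_compactified" for k
    unfolding u_def by (rule lip_env_C[where h = h, OF B])
  have ub: "\<bar>u k b\<bar> \<le> B" for k b
    unfolding u_def by (rule lip_env_bounds(2)[where h = h, OF B])
  \<comment> \<open>The margin \<open>\<rho> / 2\<close> guarantees that \<open>\<phi>\<close>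
    vanishes on a whole ball around the moved base point \<open>a'\<close>, as integrability against
    a measure that is singular at \<open>a'\<close> requires.\<close>
  have integ: "integrable N' (\<lambda>b. \<phi> b * g b)"
    if "levy_measure a' N'" "g \<in> borel_measurable borel_compactified" "dist a' a < \<rho> / 2"
      "\<And>b. \<bar>g b\<bar> \<le> C" for a' N' g C
  proof (rule levy_measure_integrable_away[OF that(1), of _ "\<rho> / 2" C])
    show "(\<lambda>b. \<phi> b * g b) \<in> borel_measurable borel_compactified"
      using C_compactified_measurable[OF \<phi>(1)] that(2) by simp
    show "\<phi> (Some x) * g (Some x) = 0" if "dist x a' < \<rho> / 2" for x
    proof -
      have "dist x a < \<rho>" using dist_triangle[of x a a'] that \<open>dist a' a < \<rho> / 2\<close> by linarith
      then show ?thesis using \<phi>(4) by simp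
    qed
    show "\<bar>\<phi> b * g b\<bar> \<le> C" for b
      using mult_mono[of "\<bar>\<phi> b\<bar>" 1 "\<bar>g b\<bar>" C] \<phi>(2,3)[of b] that(4)[of b]
      by (simp add: abs_mult)
  qed (use \<rho> in auto)
  have a: "dist a a < \<rho> / 2" using \<rho> by simp
  have "(\<lambda>k. \<integral>b. \<phi> b * u k b \<partial>M) \<longlonglongrightarrow> (\<integral>b. \<phi> b * h a b \<partial>M)"
  proof (rule integral_dominated_convergence)
    show "(\<lambda>b. \<phi> b * h a b) \<in> borel_measurable M"
      using integ[OF lev(2) meas a B] by (rule borel_measurable_integrable)
    show "(\<lambda>b. \<phi> b * u k b) \<in> borel_measurable M" for k
      using integ[OF lev(2) C_compactified_measurable[OF uC] a ub]
      by (rule borel_measurable_integrable)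
    show "integrable M (\<lambda>b. \<phi> b * B)"
      by (rule integ[OF lev(2) _ a, of _ "B"]) (use B0 in auto)
    show "AE b in M. (\<lambda>k. \<phi> b * u k b) \<longlonglongrightarrow> \<phi> b * h a b"
      using cont
    proof eventually_elim
      case (elim b)
      show ?case unfolding u_def
        by (intro tendsto_mult tendsto_const lip_env_tendsto[where h = h, OF B elim])
    qed
    show "AE b in M. norm (\<phi> b * u k b) \<le> \<phi> b * B" for k
      using \<phi>(2) ub
      by (intro AE_I2) (auto simp: abs_mult intro!: mult_left_mono)
  qed
  \<comment> \<open>The index \<open>k\<close> is fixed here, before \<open>n\<close> grows;
    dominated convergence uses only the limit measure and the almost everywhere continuity with
    respect to it.\<close>
  from order_tendstoD(2)[OF this, of "(\<integral>b. \<phi> b * h a b \<partial>M) + \<eta> / 3"] \<eta>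
  obtain k where k: "(\<integral>b. \<phi> b * u k b \<partial>M) < (\<integral>b. \<phi> b * h a b \<partial>M) + \<eta> / 3"
    by (auto simp: eventually_sequentially)
  have "(\<lambda>n. \<integral>b. \<phi> b * u k b \<partial>N n) \<longlonglongrightarrow> (\<integral>b. \<phi> b * u k b \<partial>M)"
    by (rule vague[OF C_compactified_mult[OF \<phi>(1) uC] \<phi>int])
  then have e1: "\<forall>\<^sub>F n in sequentially. (\<integral>b. \<phi> b * u k b \<partial>N n) < (\<integral>b. \<phi> b * u k b \<partial>M) + \<eta> / 3"
    by (rule order_tendstoD) (use \<eta> in simp)
  have "(\<lambda>n. \<integral>b. \<phi> b \<partial>N n) \<longlonglongrightarrow> (\<integral>b. \<phi> b \<partial>M)"
    using vague[OF \<phi>(1)] \<phi>int[of "\<lambda>_. 1"] by simp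
  moreover have "(\<lambda>n. real k * dist (A n) a) \<longlonglongrightarrow> real k * dist a a"
    by (intro tendsto_intros A)
  ultimately have "(\<lambda>n. real k * dist (A n) a * (\<integral>b. \<phi> b \<partial>N n)) \<longlonglongrightarrow> 0"
    using tendsto_mult[of _ "real k * dist a a"] by fastforce
  then have e2: "\<forall>\<^sub>F n in sequentially. real k * dist (A n) a * (\<integral>b. \<phi> b \<partial>N n) < \<eta> / 3"
    by (rule order_tendstoD) (use \<eta> in simp)
  have e3: "\<forall>\<^sub>F n in sequentially. dist (A n) a < \<rho> / 2"
    using A \<rho> by (intro tendstoD) auto
  show ?thesis
    using e1 e2 e3
  proof eventually_elim
    case (elim n)
    have i1: "integrable (N n) (\<lambda>b. \<phi> b * u k b)"
      by (rule integ[OF lev(1) C_compactified_measurable[OF uC] elim(3) ub])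
    have i2: "integrable (N n) \<phi>"
      using integ[OF lev(1) _ elim(3), of "\<lambda>_. 1" 1] by simp
    have i3: "integrable (N n) (\<lambda>b. \<phi> b * h (A n) b)"
      by (rule integ[OF lev(1) meas elim(3) B])
    have "(\<integral>b. \<phi> b * h (A n) b \<partial>N n) \<le> (\<integral>b. \<phi> b * u k b + real k * dist (A n) a * \<phi> b \<partial>N n)"
    proof (rule integral_mono[OF i3])
      show "integrable (N n) (\<lambda>b. \<phi> b * u k b + real k * dist (A n) a * \<phi> b)"
        using i1 i2 by simp
      fix b
      have "h (A n) b \<le> u k b + real k * dist (A n) a"
        using lip_env_upper[where h = h, OF B, of "A n" b k a "emb b"] by (simp add: u_def)
      then have "\<phi> b * h (A n) b \<le> \<phi> b * (u k b + real k * dist (A n) a)"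
        using \<phi>(2) by (rule mult_left_mono)
      then show "\<phi> b * h (A n) b \<le> \<phi> b * u k b + real k * dist (A n) a * \<phi> b"
        by (simp add: algebra_simps)
    qed
    also have "\<dots> = (\<integral>b. \<phi> b * u k b \<partial>N n) + real k * dist (A n) a * (\<integral>b. \<phi> b \<partial>N n)"
      using i1 i2 by simp
    finally show ?case using elim k unfolding \<phi>_def by linarith
  qed
qed

text \<open>The lower bound is the upper bound for \<open>- h\<close>.\<close>

lemma weak_limit:
  fixes h :: "real^'n \<Rightarrow> (real^'n) option \<Rightarrow> real"
  assumes lev: "\<And>n. levy_measure (A n) (N n)" "levy_measure a M"
    and A: "A \<longlonglongrightarrow> a"
    and vague: "\<And>f. f \<in> C_compactified \<Longrightarrow> a \<in> interior {x. f (Some x) = 0} \<Longrightarrow>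
      (\<lambda>n. \<integral>b. f b \<partial>N n) \<longlonglongrightarrow> (\<integral>b. f b \<partial>M)"
    and B: "\<And>a' b. \<bar>h a' b\<bar> \<le> B"
    and meas: "\<And>a'. h a' \<in> borel_measurable borel_compactified"
    and cont: "AE b in M. ((\<lambda>(a', b'). h a' b') \<longlongrightarrow> h a b) (nhds_emb a b)"
    and \<rho>: "\<rho> > 0"
  shows "(\<lambda>n. \<integral>b. cutoff a \<rho> b * h (A n) b \<partial>N n) \<longlonglongrightarrow> (\<integral>b. cutoff a \<rho> b * h a b \<partial>M)"
proof (rule tendstoI)
  fix e :: real assume e: "e > 0"
  have 1: "\<forall>\<^sub>F n in sequentially. (\<integral>b. cutoff a \<rho> b * h (A n) b \<partial>N n)
      \<le> (\<integral>b. cutoff a \<rho> b * h a b \<partial>M) + e / 2"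
    by (rule weak_limit_upper[OF lev A vague B meas cont \<rho>]) (use e in auto)
  have "AE b in M. ((\<lambda>(a', b'). - h a' b') \<longlongrightarrow> - h a b) (nhds_emb a b)"
    using cont
  proof eventually_elim
    case (elim b)
    from tendsto_minus[OF this] show ?case by (simp add: case_prod_beta')
  qed
  then have 2: "\<forall>\<^sub>F n in sequentially. (\<integral>b. cutoff a \<rho> b * - h (A n) b \<partial>N n)
      \<le> (\<integral>b. cutoff a \<rho> b * - h a b \<partial>M) + e / 2"
    using weak_limit_upper[where h = "\<lambda>a b. - h a b", OF lev A vague _ _ _ \<rho>, of B "e / 2"] B meas e
    by simp
  show "\<forall>\<^sub>F n in sequentially. dist (\<integral>b. cutoff a \<rho> b * h (A n) b \<partial>N n)
      (\<integral>b. cutoff a \<rho> b * h a b \<partial>M) < e"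
    using 1 2 by eventually_elim (use e in \<open>auto simp: dist_real_def\<close>)
qed

section \<open>Second moments of small jumps\<close>

definition sq_dist :: "real^'n \<Rightarrow> (real^'n) option \<Rightarrow> real" where
  "sq_dist a b = (case b of None \<Rightarrow> 0 | Some x \<Rightarrow> (dist x a)\<^sup>2)"

text \<open>The function \<open>g\<close> need not have a limit at infinity. On the ball it agrees
  with its product \<open>k\<close> with a cutoff of bounded support, and \<open>k\<close> is
  continuous on the compactification.\<close>

lemma Some_ball_measurable:
  fixes a :: "real^'n" and g :: "real^'n \<Rightarrow> real"
  assumes "continuous_on UNIV g"
  shows "(\<lambda>b::(real^'n) option. indicator (Some ` ball a r) b * (case b of None \<Rightarrow> 0 | Some x \<Rightarrow> g x))
    \<in> borel_measurable borel_compactified"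
proof (cases "r > 0")
  case True
  define c where "c b = 1 - cutoff a r b" for b
  define k where "k b = c b * (case b of None \<Rightarrow> 0 | Some x \<Rightarrow> g x)" for b
  have "k \<in> C_compactified"
  proof (rule C_compactifiedI)
    have "continuous_on UNIV (\<lambda>x. c (Some x))" unfolding c_def
      by (intro continuous_intros C_compactified_continuous_on_Some cutoff_C True)
    then show "continuous_on UNIV (\<lambda>x. k (Some x))"
      unfolding k_def using assms by (auto intro!: continuous_intros)
    have "eventually (\<lambda>x. 0 = k (Some x)) at_infinity"
      unfolding eventually_at_infinity
    proof (intro exI allI impI)
      fix x :: "real^'n" assume "norm a + 2 * r \<le> norm x"
      then have "2 * r \<le> dist x a" using norm_triangle_ineq2[of x a] by (simp add: dist_norm)
      then show "0 = k (Some x)" using True by (simp add: cutoff_eq_1 k_def c_def)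
    qed
    then show "((\<lambda>x. k (Some x)) \<longlongrightarrow> k None) at_infinity"
      by (intro Lim_transform_eventually[OF tendsto_const]) (auto simp: k_def)
  qed
  then have "k \<in> borel_measurable borel_compactified" by (rule C_compactified_measurable)
  moreover have "(\<lambda>b. indicator (Some ` ball a r) b * (case b of None \<Rightarrow> 0 | Some x \<Rightarrow> g x))
      = (\<lambda>b. indicator (Some ` ball a r) b * k b)"
    using True by (intro ext) (auto simp: indicator_def k_def c_def cutoff_eq_0 dist_commute)
  ultimately show ?thesis
    using Some_open_in_sets[OF open_ball, of a r] by simp
next
  case False
  then have "ball a r = {}" by simp
  then show ?thesis unfolding \<open>ball a r = {}\<close> by simp
qed

lemma sq_dist_measurable:
  "(\<lambda>b. indicator (Some ` ball a r) b * sq_dist a' b) \<in> borel_measurable borel_compactified"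
  unfolding sq_dist_def by (rule Some_ball_measurable) (intro continuous_intros)

lemma sq_dist_integrable:
  assumes "levy_measure a' N" "dist a' a < r"
  shows "integrable N (\<lambda>b. indicator (Some ` ball a r) b * sq_dist a' b)"
\<comment> \<open>Both points lie within \<open>r\<close> of \<open>a\<close>, so the squared
  distance is at most (2r)^2. The summand 1 handles the case where the weight is the squared
  distance itself, the other one the case where the weight is 1.\<close>
proof (rule levy_measure_integrable[OF assms(1) sq_dist_measurable, of _ _ _ "1 + 4 * r\<^sup>2"])
  fix b
  show "norm (indicator (Some ` ball a r) b * sq_dist a' b) \<le> (1 + 4 * r\<^sup>2) * levy_weight a' b"
  proof (cases "\<exists>x. b = Some x \<and> dist x a < r")
    case True
    then obtain x where x: "b = Some x" "dist x a < r" by blast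
    have "dist x a' \<le> 2 * r" using dist_triangle2[of x a' a] x(2) assms(2) by linarith
    then have "(dist x a')\<^sup>2 \<le> (2 * r)\<^sup>2" by (intro power_mono) auto
    then have *: "(dist x a')\<^sup>2 \<le> 4 * r\<^sup>2" by (simp add: power_mult_distrib)
    have "(dist x a')\<^sup>2 \<le> (1 + 4 * r\<^sup>2) * min 1 ((dist x a')\<^sup>2)"
      using * by (auto simp: min_def algebra_simps)
    then show ?thesis using x
      by (simp add: sq_dist_def levy_weight_def dist_norm dist_commute indicator_def)
  next
    case False
    then have "b \<notin> Some ` ball a r" by (auto simp: dist_commute)
    then show ?thesis by (simp add: levy_weight_nonneg)
  qed
qed

text \<open>Close to \<open>a'\<close> the quadratic bound is compared with the weight, elsewhere
  the weight is at least \<open>m\<close>; the constant \<open>C + B / m\<close> serves both. The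
  point \<open>a'\<close> itself is exempt, as \<open>compensation\<close> does not constrain
  \<open>chi\<close> on the diagonal and \<open>{Some a'}\<close> is a null set.\<close>

lemma small_integrable:
  fixes g :: "(real^'n) option \<Rightarrow> real"
  assumes "levy_measure a' N" "g \<in> borel_measurable borel_compactified"
    and B: "\<And>b. \<bar>g b\<bar> \<le> B"
    and "\<epsilon> > 0" "C \<ge> 0" "\<And>x. dist x a' < \<epsilon> \<Longrightarrow> x \<noteq> a' \<Longrightarrow> \<bar>g (Some x)\<bar> \<le> C * (dist x a')\<^sup>2"
  shows "integrable N g"
proof (rule levy_measure_integrable[OF assms(1,2)])
  define m where "m = min 1 (\<epsilon>\<^sup>2)"
  have m: "m > 0" "m \<le> 1" using assms(4) by (auto simp: m_def)
  have B0: "B \<ge> 0" using B[of None] by linarith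
  have Bm: "B \<le> B / m" using B0 m by (simp add: field_simps mult_left_le)
  fix b assume b: "b \<noteq> Some a'"
  have far: "norm (g b) \<le> (C + B / m) * levy_weight a' b" if "levy_weight a' b \<ge> m"
  proof -
    have "B / m * m \<le> B / m * levy_weight a' b" using B0 m that by (intro mult_left_mono) auto
    moreover have "C * levy_weight a' b \<ge> 0" by (intro mult_nonneg_nonneg assms(5) levy_weight_nonneg)
    ultimately have "B \<le> (C + B / m) * levy_weight a' b" using m by (simp add: distrib_right)
    then show ?thesis using B[of b] by simp
  qed
  show "norm (g b) \<le> (C + B / m) * levy_weight a' b"
  proof (cases b)
    case None
    then show ?thesis by (intro far) (simp add: levy_weight_def m)
  next
    case (Some x)
    show ?thesis
    proof (cases "levy_weight a' b \<ge> m")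
      case False
      then have w: "levy_weight a' b = (dist x a')\<^sup>2" and "(dist x a')\<^sup>2 < \<epsilon>\<^sup>2"
        using m by (auto simp: Some levy_weight_def dist_norm m_def min_def split: if_splits)
      then have "dist x a' < \<epsilon>" using assms(4) by (simp add: power2_less_imp_less)
      then have "norm (g b) \<le> C * (dist x a')\<^sup>2" using assms(6)[of x] b Some by simp
      also have "\<dots> \<le> (C + B / m) * (dist x a')\<^sup>2" using B0 m by (intro mult_right_mono) auto
      finally show ?thesis using w by simp
    qed (rule far)
  qed
qed

text \<open>A cutoff splits \<open>h\<close>. The part away from \<open>a\<close> converges by
  \<open>weak_limit\<close>; the part near \<open>a\<close> is at most \<open>\<eta>\<close> times
  the second moment, uniformly in the measure, by \<open>small\<close> and
  \<open>mom\<close>.\<close>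

theorem small_jump_limit:
  fixes h :: "real^'n \<Rightarrow> (real^'n) option \<Rightarrow> real"
  assumes lev: "\<And>n. levy_measure (A n) (N n)" "levy_measure a M"
    and A: "A \<longlonglongrightarrow> a"
    and vague: "\<And>f. f \<in> C_compactified \<Longrightarrow> a \<in> interior {x. f (Some x) = 0} \<Longrightarrow>
      (\<lambda>n. \<integral>b. f b \<partial>N n) \<longlonglongrightarrow> (\<integral>b. f b \<partial>M)"
    and r: "r > 0"
    and mom: "eventually (\<lambda>n. (\<integral>b. indicator (Some ` ball a r) b * sq_dist (A n) b \<partial>N n) \<le> K) sequentially"
    and B: "\<And>a' b. \<bar>h a' b\<bar> \<le> B"
    and meas: "\<And>a'. h a' \<in> borel_measurable borel_compactified"
    and small: "\<And>\<eta>. \<eta> > 0 \<Longrightarrow> \<exists>\<epsilon>>0. \<forall>a' x. dist a' a < \<epsilon> \<longrightarrow> dist x a < \<epsilon> \<longrightarrow> x \<noteq> a' \<longrightarrow>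
      \<bar>h a' (Some x)\<bar> \<le> \<eta> * (dist x a')\<^sup>2"
    and cont: "AE b in M. ((\<lambda>(a', b'). h a' b') \<longlongrightarrow> h a b) (nhds_emb a b)"
  shows "(\<lambda>n. \<integral>b. h (A n) b \<partial>N n) \<longlonglongrightarrow> (\<integral>b. h a b \<partial>M)"
proof (rule tendstoI)
  fix e :: real assume e: "e > 0"
  \<comment> \<open>Bounds the second moments of \<open>N n\<close> and of \<open>M\<close>
    together, so that a single \<open>\<eta>\<close> makes both small-jump errors sum to less than
    \<open>e / 3\<close>.\<close>
  define K0 where "K0 = max 0 K + \<bar>\<integral>b. indicator (Some ` ball a r) b * sq_dist a b \<partial>M\<bar>"
  define \<eta> where "\<eta> = e / (3 * (K0 + 1))"
  have K0: "K0 \<ge> 0" by (simp add: K0_def)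
  then have \<eta>: "\<eta> > 0" "\<eta> * K0 < e / 3"
    using e by (auto simp: \<eta>_def field_simps)
  from small[OF \<eta>(1)] obtain \<epsilon> where \<epsilon>: "\<epsilon> > 0"
    "\<And>a' x. dist a' a < \<epsilon> \<Longrightarrow> dist x a < \<epsilon> \<Longrightarrow> x \<noteq> a' \<Longrightarrow> \<bar>h a' (Some x)\<bar> \<le> \<eta> * (dist x a')\<^sup>2"
    by blast
  \<comment> \<open>The cutoff equals 1 from distance \<open>2 * \<rho>\<close> on. What it removes
    thus lies where the estimate with \<open>\<epsilon>\<close> holds and inside the ball of radius
    \<open>r\<close> of the moment bound.\<close>
  define \<rho> where "\<rho> = min \<epsilon> r / 2"
  have \<rho>: "\<rho> > 0" "2 * \<rho> \<le> \<epsilon>" "2 * \<rho> \<le> r" using \<epsilon>(1) r by (auto simp: \<rho>_def)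
  \<comment> \<open>Stated for a general pair of base point and measure, to be used for
    \<open>(A n, N n)\<close> and for \<open>(a, M)\<close>.\<close>
  have key: "integrable N' (h a') \<and> integrable N' (\<lambda>b. cutoff a \<rho> b * h a' b) \<and>
     \<bar>(\<integral>b. h a' b \<partial>N') - (\<integral>b. cutoff a \<rho> b * h a' b \<partial>N')\<bar>
      \<le> \<eta> * (\<integral>b. indicator (Some ` ball a r) b * sq_dist a' b \<partial>N')"
    if lev': "levy_measure a' N'" and a': "dist a' a < \<rho>" for a' N'
  proof (intro conjI)
    have near: "dist x a < \<epsilon>" if "dist x a' < \<rho>" for x
      using dist_triangle[of x a a'] that a' \<rho>(2) by linarith
    show i1: "integrable N' (h a')"
      by (rule small_integrable[OF lev' meas B \<rho>(1), of \<eta>])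
        (use near \<epsilon>(2)[of a'] a' \<rho> \<eta> in auto)
    have cm: "cutoff a \<rho> \<in> borel_measurable borel_compactified"
      by (rule C_compactified_measurable[OF cutoff_C[OF \<rho>(1)]])
    show i2: "integrable N' (\<lambda>b. cutoff a \<rho> b * h a' b)"
    proof (rule Bochner_Integration.integrable_bound[OF i1])
      show "(\<lambda>b. cutoff a \<rho> b * h a' b) \<in> borel_measurable N'"
        by (rule levy_measure_measurable[OF lev']) (use cm meas in simp)
      show "AE b in N'. norm (cutoff a \<rho> b * h a' b) \<le> norm (h a' b)"
        using cutoff_bounds[of a \<rho>] by (auto simp: abs_mult intro!: mult_left_le_one_le)
    qed
    have i3: "integrable N' (\<lambda>b. indicator (Some ` ball a r) b * sq_dist a' b)"
      by (rule sq_dist_integrable[OF lev']) (use a' \<rho> in auto)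
    have "\<bar>(\<integral>b. h a' b \<partial>N') - (\<integral>b. cutoff a \<rho> b * h a' b \<partial>N')\<bar>
        = norm (\<integral>b. h a' b - cutoff a \<rho> b * h a' b \<partial>N')"
      using i1 i2 by simp
    also have "\<dots> \<le> (\<integral>b. norm (h a' b - cutoff a \<rho> b * h a' b) \<partial>N')"
      by (rule integral_norm_bound)
    also have "\<dots> \<le> (\<integral>b. \<eta> * (indicator (Some ` ball a r) b * sq_dist a' b) \<partial>N')"
    proof (rule integral_mono_AE)
      show "integrable N' (\<lambda>b. norm (h a' b - cutoff a \<rho> b * h a' b))" using i1 i2 by simp
      show "integrable N' (\<lambda>b. \<eta> * (indicator (Some ` ball a r) b * sq_dist a' b))" using i3 by simp
      show "AE b in N'. norm (h a' b - cutoff a \<rho> b * h a' b)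
          \<le> \<eta> * (indicator (Some ` ball a r) b * sq_dist a' b)"
        using levy_measure_AE[OF lev']
      proof eventually_elim
        case (elim b)
        show ?case
        proof (cases "\<exists>x. b = Some x \<and> dist x a < 2 * \<rho>")
          case True
          then obtain x where x: "b = Some x" "dist x a < 2 * \<rho>" by blast
          have "norm (h a' b - cutoff a \<rho> b * h a' b) = (1 - cutoff a \<rho> b) * \<bar>h a' b\<bar>"
          proof -
            have "h a' b - cutoff a \<rho> b * h a' b = (1 - cutoff a \<rho> b) * h a' b"
              by (simp add: algebra_simps)
            moreover have "\<bar>1 - cutoff a \<rho> b\<bar> = 1 - cutoff a \<rho> b"
              using cutoff_bounds(2)[of a \<rho> b] by simp
            ultimately show ?thesis by (simp only: real_norm_def abs_mult)
          qed
          also have "\<dots> \<le> \<bar>h a' b\<bar>"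
            using cutoff_bounds[of a \<rho> b] by (intro mult_left_le_one_le) auto
          also have "\<dots> \<le> \<eta> * (dist x a')\<^sup>2"
            using \<epsilon>(2)[of a' x] x a' \<rho> elim by auto
          finally show ?thesis using x \<rho> by (simp add: sq_dist_def indicator_def dist_commute)
        next
          case False
          then have "cutoff a \<rho> b = 1"
            using \<rho>(1) by (cases b) (auto simp: cutoff_None cutoff_eq_1 not_less)
          then show ?thesis using \<eta>(1)
            by (simp add: sq_dist_def indicator_def split: option.split)
        qed
      qed
    qed
    finally show "\<bar>(\<integral>b. h a' b \<partial>N') - (\<integral>b. cutoff a \<rho> b * h a' b \<partial>N')\<bar>
        \<le> \<eta> * (\<integral>b. indicator (Some ` ball a r) b * sq_dist a' b \<partial>N')" by simp
  qed
  have lim: "(\<lambda>n. \<integral>b. cutoff a \<rho> b * h (A n) b \<partial>N n) \<longlonglongrightarrow> (\<integral>b. cutoff a \<rho> b * h a b \<partial>M)"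
    by (rule weak_limit[OF lev A vague B meas cont \<rho>(1)])
  have e1: "\<forall>\<^sub>F n in sequentially. dist (\<integral>b. cutoff a \<rho> b * h (A n) b \<partial>N n)
      (\<integral>b. cutoff a \<rho> b * h a b \<partial>M) < e / 3"
    by (rule tendstoD[OF lim]) (use e in simp)
  have e2: "\<forall>\<^sub>F n in sequentially. dist (A n) a < \<rho>" by (rule tendstoD[OF A \<rho>(1)])
  show "\<forall>\<^sub>F n in sequentially. dist (\<integral>b. h (A n) b \<partial>N n) (\<integral>b. h a b \<partial>M) < e"
    using e1 e2 mom
  proof eventually_elim
    case (elim n)
    let ?I = "\<integral>b. indicator (Some ` ball a r) b * sq_dist (A n) b \<partial>N n"
    let ?J = "\<integral>b. indicator (Some ` ball a r) b * sq_dist a b \<partial>M"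
    have "\<eta> * ?I + \<eta> * ?J \<le> \<eta> * K0"
      unfolding distrib_left[symmetric] using elim(3) \<eta>(1)
      by (intro mult_left_mono) (auto simp: K0_def)
    moreover have "dist a a < \<rho>" using \<rho> by simp
    ultimately show ?case
      using key[OF lev(1) elim(2)] key[OF lev(2)] elim(1) \<eta>(2)
      unfolding dist_real_def by linarith
  qed
qed

subsection \<open>The compensation function and the second-order remainder\<close>

lemma Cc_differentiable: "f \<in> Cc_infinity \<Longrightarrow> f differentiable (at x)"
  unfolding Cc_infinity_def differentiable_on_def
  by (auto dest!: spec[of "\<lambda>k. Ck k f" "Suc 0"] simp: differentiable_on_def)

lemma Cc_partial:
  assumes "f \<in> Cc_infinity"
  shows "partial i f \<in> Cc_infinity"
proof -
  let ?S = "closure {x. f x \<noteq> 0}"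
  have k: "Ck k (partial i f)" for k
    using assms unfolding Cc_infinity_def by (auto dest!: spec[of "\<lambda>k. Ck k f" "Suc k"])
  have "partial i f x = 0" if "x \<notin> ?S" for x
  proof -
    have "partial i f x = partial i (\<lambda>_. 0) x"
      by (rule partial_cong_open[of "- ?S"]) (use that closure_subset[of "{x. f x \<noteq> 0}"] in auto)
    also have "\<dots> = 0" using partial_eq[OF has_derivative_const, of i 0 x] by simp
    finally show ?thesis .
  qed
  then have "{x. partial i f x \<noteq> 0} \<subseteq> ?S" by blast
  then have "closure {x. partial i f x \<noteq> 0} \<subseteq> ?S" by (rule closure_minimal) simp
  moreover have "compact ?S" using assms by (simp add: Cc_infinity_def)
  ultimately have "compact (closure {x. partial i f x \<noteq> 0})"
    by (metis closed_Int_compact closed_closure inf.absorb1)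
  then show ?thesis using k by (simp add: Cc_infinity_def)
qed

lemma Cc_bounded:
  assumes "f \<in> Cc_infinity"
  obtains B where "B > 0" "\<And>x. \<bar>f x\<bar> \<le> B" "\<And>b. \<bar>ext0 f b\<bar> \<le> B"
proof -
  obtain B where B: "B > 0" "\<And>b. \<bar>ext0 f b\<bar> \<le> B"
    using C_compactified_bounded[OF ext0_C_compactified[OF assms]] by metis
  have "\<bar>f x\<bar> \<le> B" for x using B(2)[of "Some x"] by (simp add: ext0_def)
  then show ?thesis using that B by blast
qed

lemma Cc_isCont: "f \<in> Cc_infinity \<Longrightarrow> isCont f x"
  using Cc_continuous continuous_on_eq_continuous_at[OF open_UNIV] by blast

lemma Cc_partials_bounded:
  fixes f :: "real^'n \<Rightarrow> real"
  assumes "f \<in> Cc_infinity"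
  obtains B where "B > 0" "\<And>x. \<bar>f x\<bar> \<le> B" "\<And>b. \<bar>ext0 f b\<bar> \<le> B" "\<And>i x. \<bar>partial i f x\<bar> \<le> B"
    "\<And>i j x. \<bar>partial i (partial j f) x\<bar> \<le> B"
proof -
  obtain B0 where B0: "B0 > 0" "\<And>x. \<bar>f x\<bar> \<le> B0" "\<And>b. \<bar>ext0 f b\<bar> \<le> B0"
    using Cc_bounded[OF assms] by metis
  have "\<exists>B. \<forall>x. \<bar>partial i f x\<bar> \<le> B" for i
    using Cc_bounded[OF Cc_partial[OF assms]] by metis
  then obtain B1 where B1: "\<And>i x. \<bar>partial i f x\<bar> \<le> B1 i" by metis
  have "\<exists>B. \<forall>x. \<bar>partial i (partial j f) x\<bar> \<le> B" for i j
    using Cc_bounded[OF Cc_partial[OF Cc_partial[OF assms]]] by metis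
  then obtain B2 where B2: "\<And>i j x. \<bar>partial i (partial j f) x\<bar> \<le> B2 i j" by metis
  have n1: "0 \<le> B1 i" for i using B1[of i 0] by linarith
  have n2: "0 \<le> B2 i j" for i j using B2[of i j 0] by linarith
  define S where "S = B0 + (\<Sum>i\<in>UNIV. B1 i) + (\<Sum>i\<in>UNIV. \<Sum>j\<in>UNIV. B2 i j)"
  have s1: "B1 i \<le> (\<Sum>i\<in>UNIV. B1 i)" for i by (rule member_le_sum) (use n1 in auto)
  have s2: "B2 i j \<le> (\<Sum>i\<in>UNIV. \<Sum>j\<in>UNIV. B2 i j)" for i j
    by (rule order_trans[OF member_le_sum[of j UNIV "B2 i"] member_le_sum[of i UNIV "\<lambda>i. \<Sum>j\<in>UNIV. B2 i j"]])
      (use n2 in \<open>auto intro: sum_nonneg\<close>)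
  have p1: "0 \<le> (\<Sum>i\<in>UNIV. B1 i)" by (intro sum_nonneg n1)
  have p2: "0 \<le> (\<Sum>i\<in>UNIV. \<Sum>j\<in>UNIV. B2 i j)" by (intro sum_nonneg n2)
  show ?thesis
  proof
    show "S > 0" using B0(1) p1 p2 by (simp add: S_def)
    show "\<bar>f x\<bar> \<le> S" for x using B0(2)[of x] p1 p2 by (simp add: S_def)
    show "\<bar>ext0 f x\<bar> \<le> S" for x using B0(3)[of x] p1 p2 by (simp add: S_def)
    show "\<bar>partial i f x\<bar> \<le> S" for i x using B1[of i x] s1[of i] B0(1) p2 by (simp add: S_def)
    show "\<bar>partial i (partial j f) x\<bar> \<le> S" for i j x
      using B2[of i j x] s2[of i j] B0(1) p1 by (simp add: S_def)
  qed
qed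

lemma has_derivative_partials:
  fixes f :: "real^'n \<Rightarrow> real"
  assumes "f differentiable (at x)"
  shows "(f has_derivative (\<lambda>h. \<Sum>i\<in>UNIV. h $ i * partial i f x)) (at x)"
proof -
  obtain D where D: "(f has_derivative D) (at x)" using assms by (auto simp: differentiable_def)
  then interpret bounded_linear D by (rule has_derivative_bounded_linear)
  have "D h = (\<Sum>i\<in>UNIV. h $ i * partial i f x)" for h
  proof -
    have "D h = D (\<Sum>i\<in>UNIV. h $ i *\<^sub>R axis i 1)"
      using basis_expansion[of h] by (simp add: scalar_mult_eq_scaleR)
    also have "\<dots> = (\<Sum>i\<in>UNIV. h $ i * D (axis i 1))" by (simp add: sum scaleR)
    finally show ?thesis by (simp add: partial_eq[OF D])
  qed
  then have "D = (\<lambda>h. \<Sum>i\<in>UNIV. h $ i * partial i f x)" by blast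
  then show ?thesis using D by simp
qed

lemma inner_grad: "v \<bullet> grad f x = (\<Sum>i\<in>UNIV. v $ i * partial i f x)"
  by (simp add: inner_vec_def grad_def)

text \<open>One-variable Maclaurin expansion of order two along the segment. The Lagrange form, with
  second derivatives at an intermediate point, yields remainder estimates that are uniform in the
  base point.\<close>

lemma Taylor_Cc:
  fixes f :: "real^'n \<Rightarrow> real"
  assumes f: "f \<in> Cc_infinity"
  obtains y where "y \<in> closed_segment a b"
    "f b = f a + (b - a) \<bullet> grad f a
      + 1 / 2 * (\<Sum>i\<in>UNIV. \<Sum>j\<in>UNIV. (b - a) $ i * (b - a) $ j * partial i (partial j f) y)"
proof -
  define v where "v = b - a"
  define g where "g t = a + t *\<^sub>R v" for t :: real
  have g: "(g has_derivative (\<lambda>t. t *\<^sub>R v)) (at t)" for t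
    unfolding g_def by (auto intro!: derivative_eq_intros)
  have along: "((\<lambda>t. F (g t)) has_real_derivative (\<Sum>i\<in>UNIV. v $ i * partial i F (g t))) (at t)"
    if "F \<in> Cc_infinity" for F t
  proof -
    have "((\<lambda>t. F (g t)) has_derivative (\<lambda>s. \<Sum>i\<in>UNIV. (s *\<^sub>R v) $ i * partial i F (g t))) (at t)"
      by (rule has_derivative_compose[OF g has_derivative_partials[OF Cc_differentiable[OF that]]])
    moreover have "(\<lambda>s. \<Sum>i\<in>UNIV. (s *\<^sub>R v) $ i * partial i F (g t))
        = (*) (\<Sum>i\<in>UNIV. v $ i * partial i F (g t))"
      by (rule ext) (simp add: sum_distrib_left mult.assoc mult.commute mult.left_commute)
    ultimately show ?thesis by (simp add: has_field_derivative_def)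
  qed
  define diff where "diff m t = (if m = 0 then f (g t)
     else if m = 1 then (\<Sum>j\<in>UNIV. v $ j * partial j f (g t))
     else (\<Sum>j\<in>UNIV. v $ j * (\<Sum>i\<in>UNIV. v $ i * partial i (partial j f) (g t))))" for m :: nat and t
  have d1: "(diff 0 has_real_derivative diff (Suc 0) t) (at t)" for t
    using along[OF f, of t] by (simp add: diff_def[abs_def])
  have d2: "(diff (Suc 0) has_real_derivative diff (Suc (Suc 0)) t) (at t)" for t
    unfolding diff_def[abs_def]
    by simp (intro DERIV_sum DERIV_cmult along Cc_partial f)
  have "\<exists>t>0. t < 1 \<and> diff 0 1 = (\<Sum>m<2. diff m 0 / fact m * 1 ^ m) + diff 2 t / fact 2 * 1 ^ 2"
  proof (rule Maclaurin)
    show "\<forall>m t. m < 2 \<and> 0 \<le> t \<and> t \<le> 1 \<longrightarrow> (diff m has_real_derivative diff (Suc m) t) (at t)"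
      using d1 d2 by (auto simp: less_2_cases_iff)
  qed auto
  then obtain t where t: "0 < t" "t < 1" "diff 0 1 = diff 0 0 + diff 1 0 + diff 2 t / 2"
    by (auto simp: numeral_2_eq_2)
  have "g t \<in> closed_segment a b"
    unfolding closed_segment_def g_def v_def using t(1,2)
    by (intro CollectI exI[of _ t]) (simp add: algebra_simps)
  moreover have "f b = f a + (b - a) \<bullet> grad f a
      + 1 / 2 * (\<Sum>i\<in>UNIV. \<Sum>j\<in>UNIV. (b - a) $ i * (b - a) $ j * partial i (partial j f) (g t))"
  proof -
    have "diff 2 t = (\<Sum>j\<in>UNIV. \<Sum>i\<in>UNIV. v $ i * v $ j * partial i (partial j f) (g t))"
      by (simp add: diff_def sum_distrib_left mult.assoc mult.left_commute)
    also have "\<dots> = (\<Sum>i\<in>UNIV. \<Sum>j\<in>UNIV. v $ i * v $ j * partial i (partial j f) (g t))"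
      by (rule sum.swap)
    finally have "diff 2 t = \<dots>" .
    moreover have "diff 0 1 = f b" "diff 0 0 = f a" "diff 1 0 = (b - a) \<bullet> grad f a"
      by (simp_all add: diff_def g_def v_def inner_grad)
    ultimately show ?thesis using t(3) by (simp add: v_def)
  qed
  ultimately show ?thesis by (rule that)
qed

text \<open>The value \<open>y\<close> and the increment \<open>v\<close> are separate arguments:
  with \<open>f x\<close> and \<open>x - a\<close> this is the ordinary second-order remainder,
  while \<open>rem\<close> inserts \<open>chi (a, b)\<close> as increment.\<close>

definition taylor_rem :: "(real^'n \<Rightarrow> real) \<Rightarrow> real^'n \<Rightarrow> real \<Rightarrow> real^'n \<Rightarrow> real" where
  "taylor_rem f a y v = y - f a - v \<bullet> grad f a
     - 1 / 2 * (\<Sum>i\<in>UNIV. \<Sum>j\<in>UNIV. v $ i * v $ j * partial i (partial j f) a)"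

lemma quad_form_bound:
  fixes v :: "real^'n" and c :: "'n \<Rightarrow> 'n \<Rightarrow> real"
  assumes "\<And>i j. \<bar>w i j\<bar> \<le> W" "\<And>i j. \<bar>c i j\<bar> \<le> C"
  shows "\<bar>\<Sum>i\<in>UNIV. \<Sum>j\<in>UNIV. w i j * c i j\<bar> \<le> (real CARD('n))\<^sup>2 * (W * C)"
proof -
  have W: "W \<ge> 0" using assms(1) abs_ge_zero order_trans by blast
  have "\<bar>\<Sum>i\<in>UNIV. \<Sum>j\<in>UNIV. w i j * c i j\<bar> \<le> (\<Sum>i\<in>(UNIV::'n set). \<Sum>j\<in>(UNIV::'n set). W * C)"
    by (intro order_trans[OF sum_abs] sum_mono order_trans[OF sum_abs])
      (use assms W in \<open>auto simp: abs_mult intro!: mult_mono\<close>)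
  also have "\<dots> = (real CARD('n))\<^sup>2 * (W * C)" by (simp add: power2_eq_square)
  finally show ?thesis .
qed

lemma taylor_rem_small:
  fixes f :: "real^'n \<Rightarrow> real"
  assumes f: "f \<in> Cc_infinity" and \<eta>: "\<eta> > 0"
  shows "\<exists>\<epsilon>>0. \<forall>a' x. dist a' a < \<epsilon> \<longrightarrow> dist x a < \<epsilon> \<longrightarrow>
    \<bar>taylor_rem f a' (f x) (x - a')\<bar> \<le> \<eta> * (dist x a')\<^sup>2"
proof -
  let ?d = "real CARD('n)"
  \<comment> \<open>The second partials at \<open>y\<close> and at \<open>a'\<close> are each within
    \<open>\<theta>\<close> of those at \<open>a\<close>, hence within \<open>2 * \<theta>\<close>
    of each other. The sum has d^2 terms and the prefactor 1/2, which gives exactly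
    \<open>\<eta>\<close>.\<close>
  define \<theta> where "\<theta> = \<eta> / ?d\<^sup>2"
  have d: "?d > 0" by simp
  have \<theta>: "\<theta> > 0" using \<eta> by (simp add: \<theta>_def)
  have "\<forall>i j. \<exists>\<epsilon>>0. \<forall>y. dist y a < \<epsilon> \<longrightarrow> \<bar>partial i (partial j f) y - partial i (partial j f) a\<bar> < \<theta>"
    using Cc_isCont[OF Cc_partial[OF Cc_partial[OF f]]] \<theta>
    unfolding continuous_at_eps_delta dist_real_def by blast
  then obtain e where e: "\<And>i j. e i j > 0"
    "\<And>i j y. dist y a < e i j \<Longrightarrow> \<bar>partial i (partial j f) y - partial i (partial j f) a\<bar> < \<theta>"
    by metis
  define \<epsilon> where "\<epsilon> = Min (range (\<lambda>(i, j). e i j))"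
  have \<epsilon>: "\<epsilon> > 0" "\<epsilon> \<le> e i j" for i j
    unfolding \<epsilon>_def using e(1) by (auto intro!: Min_le image_eqI[of _ _ "(i, j)"])
  show ?thesis
  proof (intro exI[of _ \<epsilon>] conjI allI impI \<epsilon>(1))
    fix a' x assume a': "dist a' a < \<epsilon>" and x: "dist x a < \<epsilon>"
    obtain y where y: "y \<in> closed_segment a' x" "f x = f a' + (x - a') \<bullet> grad f a'
      + 1 / 2 * (\<Sum>i\<in>UNIV. \<Sum>j\<in>UNIV. (x - a') $ i * (x - a') $ j * partial i (partial j f) y)"
      by (rule Taylor_Cc[OF f])
    have "closed_segment a' x \<subseteq> ball a \<epsilon>"
      by (rule closed_segment_subset) (use a' x in \<open>auto simp: dist_commute\<close>)
    then have "dist y a < \<epsilon>" using y(1) by (auto simp: dist_commute)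
    then have yc: "\<bar>partial i (partial j f) y - partial i (partial j f) a'\<bar> \<le> 2 * \<theta>" for i j
      using e(2)[of y i j] e(2)[of a' i j] a' \<epsilon>(2)[of i j] by linarith
    have "taylor_rem f a' (f x) (x - a') = 1 / 2 * (\<Sum>i\<in>UNIV. \<Sum>j\<in>UNIV.
        ((x - a') $ i * (x - a') $ j) * (partial i (partial j f) y - partial i (partial j f) a'))"
      unfolding taylor_rem_def y(2) by (simp add: right_diff_distrib sum_subtractf)
    moreover have "\<bar>\<Sum>i\<in>UNIV. \<Sum>j\<in>UNIV. ((x - a') $ i * (x - a') $ j)
        * (partial i (partial j f) y - partial i (partial j f) a')\<bar>
      \<le> ?d\<^sup>2 * ((dist x a' * dist x a') * (2 * \<theta>))"
      by (rule quad_form_bound[OF _ yc])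
        (unfold abs_mult dist_norm, intro mult_mono component_le_norm_cart, auto)
    moreover have "1 / 2 * (?d\<^sup>2 * ((dist x a' * dist x a') * (2 * \<theta>))) = \<eta> * (dist x a')\<^sup>2"
      by (simp add: \<theta>_def power2_eq_square field_simps)
    ultimately show "\<bar>taylor_rem f a' (f x) (x - a')\<bar> \<le> \<eta> * (dist x a')\<^sup>2"
      by (simp add: abs_mult)
  qed
qed

section \<open>The Taylor remainder with the compensation function as increment\<close>

locale compensated =
  fixes chi :: "(real^'n) \<times> (real^'n) option \<Rightarrow> real^'n"
  assumes comp: "compensation chi"
begin

lemma chi_bound:
  obtains B where "B > 0" "\<And>p. norm (chi p) \<le> B"
  using comp unfolding compensation_def bounded_pos by auto

lemma chi_small:
  assumes \<eta>: "\<eta> > 0"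
  shows "\<exists>\<epsilon>>0. \<forall>a' x. dist a' a < \<epsilon> \<longrightarrow> dist x a < \<epsilon> \<longrightarrow> x \<noteq> a' \<longrightarrow>
    norm (chi (a', Some x) - (x - a')) \<le> \<eta> * (dist x a')\<^sup>2"
proof -
  let ?P = "\<lambda>\<epsilon>. {(b, c). b \<in> cball a 1 \<and> c \<in> cball a 1 \<and> 0 < norm (c - b) \<and> norm (c - b) \<le> \<epsilon>}"
  let ?q = "\<lambda>(b, c). ennreal (norm (chi (b, Some c) - (c - b)) / (norm (c - b))\<^sup>2)"
  have "((\<lambda>\<epsilon>. SUP p \<in> ?P \<epsilon>. ?q p) \<longlongrightarrow> 0) (at_right (0::real))"
    using comp compact_cball[of a 1] unfolding compensation_def by blast
  then have "eventually (\<lambda>\<epsilon>. (SUP p \<in> ?P \<epsilon>. ?q p) < ennreal \<eta>) (at_right 0)"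
    by (rule order_tendstoD(2)) (use \<eta> in simp)
  then obtain e0 where e0: "e0 > 0" "\<And>\<epsilon>. 0 < \<epsilon> \<Longrightarrow> \<epsilon> < e0 \<Longrightarrow> (SUP p \<in> ?P \<epsilon>. ?q p) < ennreal \<eta>"
    unfolding eventually_at_right_field by auto
  \<comment> \<open>Two points within \<open>\<epsilon>\<close> of \<open>a\<close> lie in
    \<open>cball a 1\<close> and are at most \<open>2 * \<epsilon>\<close> apart, and this distance
    has to stay below \<open>e0\<close>.\<close>
  define \<epsilon> where "\<epsilon> = min 1 (e0 / 4)"
  have \<epsilon>: "\<epsilon> > 0" "\<epsilon> \<le> 1" "2 * \<epsilon> < e0" using e0(1) by (auto simp: \<epsilon>_def)
  show ?thesis
  proof (intro exI[of _ \<epsilon>] conjI allI impI \<epsilon>(1))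
    fix a' x assume a': "dist a' a < \<epsilon>" "dist x a < \<epsilon>" "x \<noteq> a'"
    have "norm (x - a') \<le> 2 * \<epsilon>" using dist_triangle2[of x a' a] a' by (simp add: dist_norm)
    then have "(a', x) \<in> ?P (2 * \<epsilon>)" using a' \<epsilon> by (auto simp: dist_commute)
    then have "?q (a', x) \<le> (SUP p \<in> ?P (2 * \<epsilon>). ?q p)" by (rule SUP_upper)
    also have "\<dots> < ennreal \<eta>" by (rule e0(2)) (use \<epsilon> in auto)
    finally have "norm (chi (a', Some x) - (x - a')) / (norm (x - a'))\<^sup>2 < \<eta>"
      by (simp add: ennreal_less_iff)
    then show "norm (chi (a', Some x) - (x - a')) \<le> \<eta> * (dist x a')\<^sup>2"
      using a'(3) by (simp add: dist_norm divide_less_eq)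
  qed
qed

lemma chi_measurable: "(\<lambda>b. chi (a, b)) \<in> borel_measurable borel_compactified"
proof -
  have "chi \<in> borel_measurable (borel \<Otimes>\<^sub>M borel_compactified)"
    using comp by (simp add: compensation_def)
  then show ?thesis by (rule measurable_compose[OF measurable_Pair1', rotated]) simp
qed

lemma chi_nth_measurable: "(\<lambda>b. chi (a, b) $ i) \<in> borel_measurable borel_compactified"
proof -
  have "(\<lambda>v::real^'n. v $ i) \<in> borel_measurable borel"
    by (intro borel_measurable_continuous_onI continuous_intros)
  from measurable_compose[OF chi_measurable this] show ?thesis .
qed

text \<open>With \<open>chi\<close> as increment the remainder is bounded and makes sense at
  infinity, so it can be integrated over the whole compactification.\<close>

definition rem :: "(real^'n \<Rightarrow> real) \<Rightarrow> real^'n \<Rightarrow> (real^'n) option \<Rightarrow> real" where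
  "rem f a b = taylor_rem f a (ext0 f b) (chi (a, b))"

lemma rem_measurable:
  assumes "f \<in> Cc_infinity"
  shows "rem f a \<in> borel_measurable borel_compactified"
  unfolding rem_def taylor_rem_def inner_grad
  by (intro borel_measurable_diff borel_measurable_sum borel_measurable_times borel_measurable_const
      chi_nth_measurable C_compactified_measurable[OF ext0_C_compactified[OF assms]])

lemma chi_mult_bound:
  assumes "\<And>p. norm (chi p) \<le> B"
  shows "\<bar>chi p $ i * chi q $ j\<bar> \<le> B * B"
proof -
  have "B \<ge> 0" using assms norm_ge_zero order_trans by blast
  then show ?thesis unfolding abs_mult
    by (intro mult_mono order_trans[OF component_le_norm_cart] assms) auto
qed

lemma rem_bounded:
  assumes "f \<in> Cc_infinity"
  obtains C where "\<And>a b. \<bar>rem f a b\<bar> \<le> C"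
proof -
  obtain B where B: "B > 0" "\<And>p. norm (chi p) \<le> B" using chi_bound by metis
  obtain F where F: "F > 0" "\<And>x. \<bar>f x\<bar> \<le> F" "\<And>b. \<bar>ext0 f b\<bar> \<le> F" "\<And>i x. \<bar>partial i f x\<bar> \<le> F"
    "\<And>i j x. \<bar>partial i (partial j f) x\<bar> \<le> F"
    using Cc_partials_bounded[OF assms] by metis
  let ?d = "real CARD('n)"
  have "\<bar>rem f a b\<bar> \<le> F + F + ?d * (B * F) + 1 / 2 * (?d\<^sup>2 * ((B * B) * F))" for a b
  proof -
    have 1: "\<bar>\<Sum>i\<in>UNIV. \<Sum>j\<in>UNIV. (chi (a, b) $ i * chi (a, b) $ j) * partial i (partial j f) a\<bar>
        \<le> ?d\<^sup>2 * ((B * B) * F)"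
      by (rule quad_form_bound[OF chi_mult_bound[OF B(2)] F(5)])
    have "\<bar>\<Sum>i\<in>UNIV. chi (a, b) $ i * partial i f a\<bar> \<le> (\<Sum>i\<in>(UNIV::'n set). B * F)"
      by (intro order_trans[OF sum_abs] sum_mono)
        (unfold abs_mult, intro mult_mono F order_trans[OF component_le_norm_cart B(2)], use B in auto)
    then have 2: "\<bar>chi (a, b) \<bullet> grad f a\<bar> \<le> ?d * (B * F)" by (simp add: inner_grad)
    show ?thesis using 1 2 F(2)[of a] F(3)[of b]
      unfolding rem_def taylor_rem_def by linarith
  qed
  then show ?thesis by (rule that)
qed

text \<open>The increment v = x - a' is exchanged for c = chi(a', x) in the ordinary remainder. With
  s = |v| the linear term changes by O(|c - v|), and here the rate o(s^2) in
  \<open>compensation\<close> is essential; the quadratic term changes by O(|c - v| s), which is of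
  higher order.\<close>

lemma rem_small:
  assumes f: "f \<in> Cc_infinity" and \<eta>: "\<eta> > 0"
  shows "\<exists>\<epsilon>>0. \<forall>a' x. dist a' a < \<epsilon> \<longrightarrow> dist x a < \<epsilon> \<longrightarrow> x \<noteq> a' \<longrightarrow>
      \<bar>rem f a' (Some x)\<bar> \<le> \<eta> * (dist x a')\<^sup>2"
proof -
  obtain F where F: "F > 0" "\<And>i x. \<bar>partial i f x\<bar> \<le> F" "\<And>i j x. \<bar>partial i (partial j f) x\<bar> \<le> F"
    using Cc_partials_bounded[OF f] by metis
  let ?d = "real CARD('n)"
  \<comment> \<open>The first summand bounds the linear error. The second bounds the quadratic one,
    1/2 * d^2 * 3 * F, with 3 rounded up to 4.\<close>
  define C where "C = ?d * F + 2 * ?d\<^sup>2 * F"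
  have C: "C \<ge> 0" using F by (simp add: C_def)
  define \<theta> where "\<theta> = min 1 (\<eta> / 2 / (C + 1))"
  have \<theta>: "\<theta> > 0" "\<theta> \<le> 1" "C * \<theta> \<le> \<eta> / 2"
  proof -
    show "\<theta> > 0" using C \<eta> by (simp add: \<theta>_def)
    show "\<theta> \<le> 1" by (simp add: \<theta>_def)
    have "C * \<theta> \<le> (C + 1) * (\<eta> / 2 / (C + 1))"
      using C \<eta> by (intro mult_mono) (auto simp: \<theta>_def)
    also have "(C + 1) * (\<eta> / 2 / (C + 1)) = \<eta> / 2"
      unfolding times_divide_eq_right[of "C + 1" "\<eta> / 2" "C + 1"] by (rule nonzero_mult_div_cancel_left) (use C in simp)
    finally show "C * \<theta> \<le> \<eta> / 2" .
  qed
  obtain e1 where e1: "e1 > 0" "\<And>a' x. dist a' a < e1 \<Longrightarrow> dist x a < e1 \<Longrightarrow>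
      \<bar>taylor_rem f a' (f x) (x - a')\<bar> \<le> \<eta> / 2 * (dist x a')\<^sup>2"
    using taylor_rem_small[OF f, of "\<eta> / 2" a] \<eta> by auto
  obtain e2 where e2: "e2 > 0" "\<And>a' x. dist a' a < e2 \<Longrightarrow> dist x a < e2 \<Longrightarrow> x \<noteq> a' \<Longrightarrow>
    norm (chi (a', Some x) - (x - a')) \<le> \<theta> * (dist x a')\<^sup>2"
    using chi_small[OF \<theta>(1), of a] by blast
  \<comment> \<open>The bound 1/2 forces s \<le> 1, hence s^2 \<le> s and |c| \<le> 2 s.\<close>
  define \<epsilon> where "\<epsilon> = min (min e1 e2) (1 / 2)"
  have \<epsilon>: "\<epsilon> > 0" "\<epsilon> \<le> e1" "\<epsilon> \<le> e2" "\<epsilon> \<le> 1 / 2" using e1(1) e2(1) by (auto simp: \<epsilon>_def)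
  show ?thesis
  proof (intro exI[of _ \<epsilon>] conjI allI impI \<epsilon>(1))
    fix a' x assume a': "dist a' a < \<epsilon>" "dist x a < \<epsilon>" "x \<noteq> a'"
    define v where "v = x - a'"
    define c where "c = chi (a', Some x)"
    define s where "s = norm v"
    have s: "s = dist x a'" by (simp add: s_def v_def dist_norm)
    have s1: "0 \<le> s" "s \<le> 1" using dist_triangle2[of x a' a] a' \<epsilon>(4) by (auto simp: s)
    have s2: "s\<^sup>2 \<le> s" using s1 by (simp add: power2_eq_square mult_left_le)
    have cv: "norm (c - v) \<le> \<theta> * s\<^sup>2"
      using e2(2)[of a' x] a' \<epsilon> by (simp add: c_def v_def s)
    have "\<theta> * s\<^sup>2 \<le> 1 * s" using \<theta> s2 by (intro mult_mono) auto
    then have cs: "norm c \<le> 2 * s" using cv norm_triangle_ineq2[of c v] by (simp add: s_def)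
    have ci: "\<bar>(c - v) $ i\<bar> \<le> \<theta> * s\<^sup>2" for i
      by (rule order_trans[OF component_le_norm_cart cv])
    have lin: "\<bar>(c - v) \<bullet> grad f a'\<bar> \<le> ?d * (\<theta> * s\<^sup>2 * F)"
    proof -
      have "\<bar>\<Sum>i\<in>UNIV. (c - v) $ i * partial i f a'\<bar> \<le> (\<Sum>i\<in>(UNIV::'n set). \<theta> * s\<^sup>2 * F)"
        by (intro order_trans[OF sum_abs] sum_mono)
          (unfold abs_mult, intro mult_mono F(2) ci, use \<theta> F in auto)
      then show ?thesis by (simp add: inner_grad)
    qed
    have prod: "\<bar>c $ i * c $ j - v $ i * v $ j\<bar> \<le> 3 * (\<theta> * s\<^sup>2)" for i j
    proof -
      have "c $ i * c $ j - v $ i * v $ j = (c - v) $ i * c $ j + v $ i * (c - v) $ j"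
        by (simp add: algebra_simps)
      also have "\<bar>\<dots>\<bar> \<le> \<bar>(c - v) $ i * c $ j\<bar> + \<bar>v $ i * (c - v) $ j\<bar>"
        by (rule abs_triangle_ineq)
      also have "\<dots> \<le> (\<theta> * s\<^sup>2) * (2 * s) + s * (\<theta> * s\<^sup>2)"
        unfolding abs_mult
        by (intro add_mono mult_mono ci order_trans[OF component_le_norm_cart cs])
          (use \<theta> s1 in \<open>auto simp: s_def component_le_norm_cart\<close>)
      also have "\<dots> = 3 * (\<theta> * s\<^sup>2) * s" by simp
      also have "\<dots> \<le> 3 * (\<theta> * s\<^sup>2) * 1" by (intro mult_left_mono) (use s1 \<theta> in auto)
      finally show ?thesis by simp
    qed
    have quad: "\<bar>\<Sum>i\<in>UNIV. \<Sum>j\<in>UNIV. (c $ i * c $ j - v $ i * v $ j) * partial i (partial j f) a'\<bar>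
        \<le> ?d\<^sup>2 * (3 * (\<theta> * s\<^sup>2) * F)"
      by (rule quad_form_bound[OF prod F(3)])
    have "rem f a' (Some x) = taylor_rem f a' (f x) v - (c - v) \<bullet> grad f a'
      - 1 / 2 * (\<Sum>i\<in>UNIV. \<Sum>j\<in>UNIV. (c $ i * c $ j - v $ i * v $ j) * partial i (partial j f) a')"
      unfolding rem_def taylor_rem_def c_def[symmetric]
      by (simp add: ext0_def inner_diff_left left_diff_distrib sum_subtractf diff_divide_distrib)
    then have "\<bar>rem f a' (Some x)\<bar> \<le> \<bar>taylor_rem f a' (f x) v\<bar> + ?d * (\<theta> * s\<^sup>2 * F)
        + 1 / 2 * (?d\<^sup>2 * (3 * (\<theta> * s\<^sup>2) * F))"
      using lin quad by linarith
    also have "\<dots> \<le> \<eta> / 2 * s\<^sup>2 + ?d * (\<theta> * s\<^sup>2 * F) + 1 / 2 * (?d\<^sup>2 * (4 * (\<theta> * s\<^sup>2) * F))"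
      by (intro add_mono mult_left_mono mult_right_mono order_refl)
        (use e1(2)[of a' x] a' \<epsilon> \<theta> F in \<open>auto simp: v_def s\<close>)
    also have "\<dots> = \<eta> / 2 * s\<^sup>2 + C * \<theta> * s\<^sup>2" by (simp add: C_def algebra_simps)
    also have "\<dots> \<le> \<eta> / 2 * s\<^sup>2 + \<eta> / 2 * s\<^sup>2"
      using \<theta>(3) by (intro add_mono mult_right_mono) auto
    finally show "\<bar>rem f a' (Some x)\<bar> \<le> \<eta> * (dist x a')\<^sup>2" by (simp add: s)
  qed
qed

lemma rem_continuous:
  assumes f: "f \<in> Cc_infinity"
    and "topcontinuous_at (prod_topology euclidean compactified) euclidean chi (a, b)"
  shows "((\<lambda>(a', b'). rem f a' b') \<longlongrightarrow> rem f a b) (nhds_emb a b)"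
proof -
  have 1: "((\<lambda>p. chi (fst p, snd p) $ i) \<longlongrightarrow> chi (a, b) $ i) (nhds_emb a b)" for i
    using tendsto_vec_nth[OF tendsto_nhds_emb_chi[OF assms(2)]] by simp
  have 2: "((\<lambda>p. ext0 f (snd p)) \<longlongrightarrow> ext0 f b) (nhds_emb a b)"
    by (rule tendsto_nhds_emb_C[OF ext0_C_compactified[OF f]])
  have 3: "((\<lambda>p. F (fst p)) \<longlongrightarrow> F a) (nhds_emb a b)" if "F \<in> Cc_infinity" for F
    by (rule isCont_tendsto_compose[OF Cc_isCont[OF that] tendsto_nhds_emb_fst])
  show ?thesis
    unfolding rem_def taylor_rem_def inner_grad case_prod_unfold
    by (intro tendsto_diff tendsto_mult tendsto_sum tendsto_const 1 2 3 f Cc_partial)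
qed

lemma rem_integrable:
  assumes "levy_measure a N" "f \<in> Cc_infinity"
  shows "integrable N (rem f a)"
proof -
  obtain C where C: "\<And>a b. \<bar>rem f a b\<bar> \<le> C" using rem_bounded[OF assms(2)] by metis
  obtain \<epsilon> where "\<epsilon> > 0" "\<And>a' x. dist a' a < \<epsilon> \<Longrightarrow> dist x a < \<epsilon> \<Longrightarrow> x \<noteq> a' \<Longrightarrow>
      \<bar>rem f a' (Some x)\<bar> \<le> 1 * (dist x a')\<^sup>2"
    using rem_small[OF assms(2), of 1 a] by auto
  then show ?thesis
    by (intro small_integrable[OF assms(1) rem_measurable[OF assms(2)] C, of \<epsilon> 1]) auto
qed

text \<open>For s = |x - a'| \<le> 1/2 the deviation of \<open>chi\<close> from x - a' is at most
  s^2 \<le> s/2, so |chi| is comparable with s. The upper bound makes chi_i chi_j integrable; the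
  lower one recovers second moments of the jumps from integrals of |chi|^2.\<close>

lemma chi_lower:
  "\<exists>\<epsilon>>0. \<forall>a' x. dist a' a < \<epsilon> \<longrightarrow> dist x a < \<epsilon> \<longrightarrow> x \<noteq> a' \<longrightarrow>
      norm (chi (a', Some x)) \<le> 2 * dist x a' \<and> (dist x a')\<^sup>2 \<le> 4 * (norm (chi (a', Some x)))\<^sup>2"
proof -
  obtain e where e: "e > 0" "\<And>a' x. dist a' a < e \<Longrightarrow> dist x a < e \<Longrightarrow> x \<noteq> a' \<Longrightarrow>
    norm (chi (a', Some x) - (x - a')) \<le> 1 * (dist x a')\<^sup>2"
    using chi_small[of 1 a] by auto
  define \<epsilon> where "\<epsilon> = min e (1 / 4)"
  show ?thesis
  proof (intro exI[of _ \<epsilon>] conjI allI impI)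
    show "\<epsilon> > 0" using e by (simp add: \<epsilon>_def)
    fix a' x assume a': "dist a' a < \<epsilon>" "dist x a < \<epsilon>" "x \<noteq> a'"
    define s where "s = dist x a'"
    have s: "0 \<le> s" "s \<le> 1 / 2" using dist_triangle2[of x a' a] a' by (auto simp: s_def \<epsilon>_def)
    have "s\<^sup>2 \<le> s * (1 / 2)" unfolding power2_eq_square using s by (intro mult_left_mono) auto
    then have *: "norm (chi (a', Some x) - (x - a')) \<le> s / 2"
      using e(2)[of a' x] a' by (simp add: s_def \<epsilon>_def)
    have n: "norm (x - a') = s" by (simp add: s_def dist_norm)
    show "norm (chi (a', Some x)) \<le> 2 * dist x a'"
      unfolding s_def[symmetric]
      using * norm_triangle_ineq2[of "chi (a', Some x)" "x - a'"] s n by linarith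
    have "s \<le> 2 * norm (chi (a', Some x))"
      using * norm_triangle_ineq2[of "x - a'" "chi (a', Some x)"] n by (simp add: norm_minus_commute)
    then have "s\<^sup>2 \<le> (2 * norm (chi (a', Some x)))\<^sup>2" using s by (intro power_mono) auto
    then show "(dist x a')\<^sup>2 \<le> 4 * (norm (chi (a', Some x)))\<^sup>2"
      by (simp add: s_def power_mult_distrib)
  qed
qed

lemma chi_mult_integrable:
  assumes "levy_measure a N"
  shows "integrable N (\<lambda>b. chi (a, b) $ i * chi (a, b) $ j)"
proof -
  obtain B where B: "B > 0" "\<And>p. norm (chi p) \<le> B" using chi_bound by metis
  obtain \<epsilon> where \<epsilon>: "\<epsilon> > 0" "\<And>a' x. dist a' a < \<epsilon> \<Longrightarrow> dist x a < \<epsilon> \<Longrightarrow> x \<noteq> a' \<Longrightarrow>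
      norm (chi (a', Some x)) \<le> 2 * dist x a'"
    using chi_lower[of a] by blast
  show ?thesis
  proof (rule small_integrable[where C = 4, OF assms _ chi_mult_bound[OF B(2)] \<epsilon>(1)])
    show "(\<lambda>b. chi (a, b) $ i * chi (a, b) $ j) \<in> borel_measurable borel_compactified"
      by (intro borel_measurable_times chi_nth_measurable)
    fix x assume "dist x a < \<epsilon>" "x \<noteq> a"
    then have "norm (chi (a, Some x)) \<le> 2 * dist x a" using \<epsilon> by simp
    then have "\<bar>chi (a, Some x) $ i * chi (a, Some x) $ j\<bar> \<le> (2 * dist x a) * (2 * dist x a)"
      unfolding abs_mult by (intro mult_mono order_trans[OF component_le_norm_cart]) auto
    then show "\<bar>chi (a, Some x) $ i * chi (a, Some x) $ j\<bar> \<le> 4 * (dist x a)\<^sup>2"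
      by (simp add: power2_eq_square)
  qed simp
qed

definition modified_cov :: "real^'n \<Rightarrow> real^'n^'n \<Rightarrow> (real^'n) option measure \<Rightarrow> 'n \<Rightarrow> 'n \<Rightarrow> real" where
  "modified_cov a g N i j = g $ i $ j + (\<integral>b. chi (a, b) $ i * chi (a, b) $ j \<partial>N)"

text \<open>The integrand is \<open>rem\<close> plus half the Hessian of \<open>f\<close> applied to
  \<open>chi\<close>. Both parts are O(|b - a|^2) near \<open>a\<close> and bounded, hence
  separately integrable, so the quadratic part can be moved out of the integral into
  \<open>modified_cov\<close>.\<close>

lemma levy_op_decomp:
  assumes N: "levy_measure a N" and f: "f \<in> Cc_infinity"
  shows "levy_op chi a d g N f =
     1 / 2 * (\<Sum>i\<in>UNIV. \<Sum>j\<in>UNIV. modified_cov a g N i j * partial i (partial j f) a)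
     + d \<bullet> grad f a + (\<integral>b. rem f a b \<partial>N)"
    "integrable N (\<lambda>b. ext0 f b - f a - chi (a, b) \<bullet> grad f a)"
proof -
  let ?q = "\<lambda>b. 1 / 2 * (\<Sum>i\<in>UNIV. \<Sum>j\<in>UNIV. chi (a, b) $ i * chi (a, b) $ j * partial i (partial j f) a)"
  have eq: "ext0 f b - f a - chi (a, b) \<bullet> grad f a = rem f a b + ?q b" for b
    by (simp add: rem_def taylor_rem_def)
  have i: "integrable N (\<lambda>b. chi (a, b) $ i * chi (a, b) $ j * partial i (partial j f) a)" for i j
    using chi_mult_integrable[OF N] by simp
  have q: "integrable N ?q" using i by simp
  show "integrable N (\<lambda>b. ext0 f b - f a - chi (a, b) \<bullet> grad f a)"
    unfolding eq using rem_integrable[OF N f] q by simp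
  have "(\<integral>b. ?q b \<partial>N) = 1 / 2 * (\<Sum>i\<in>UNIV. \<Sum>j\<in>UNIV.
      (\<integral>b. chi (a, b) $ i * chi (a, b) $ j \<partial>N) * partial i (partial j f) a)"
    using i by simp
  then have "(\<integral>b. ext0 f b - f a - chi (a, b) \<bullet> grad f a \<partial>N) = (\<integral>b. rem f a b \<partial>N) +
     1 / 2 * (\<Sum>i\<in>UNIV. \<Sum>j\<in>UNIV.
      (\<integral>b. chi (a, b) $ i * chi (a, b) $ j \<partial>N) * partial i (partial j f) a)"
    unfolding eq using Bochner_Integration.integral_add[OF rem_integrable[OF N f] q] by simp
  then show "levy_op chi a d g N f =
     1 / 2 * (\<Sum>i\<in>UNIV. \<Sum>j\<in>UNIV. modified_cov a g N i j * partial i (partial j f) a)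
     + d \<bullet> grad f a + (\<integral>b. rem f a b \<partial>N)"
    unfolding levy_op_def modified_cov_def by (simp add: distrib_right sum.distrib distrib_left)
qed

end

subsection \<open>Convergence along sequences\<close>

lemma partial_const: "partial i (\<lambda>_. c) x = 0"
  using partial_eq[OF has_derivative_const, of i c x] by simp

lemma partial_affine:
  "partial k (\<lambda>x. x $ i - c) x = (if k = i then 1 else 0)"
proof -
  have "((\<lambda>x. x $ i - c) has_derivative (\<lambda>h. h $ i)) (at x)"
    by (auto intro!: derivative_eq_intros bounded_linear_imp_has_derivative[OF bounded_linear_vec_nth])
  from partial_eq[OF this, of k] show ?thesis by (auto simp: axis_def)
qed

lemma partial_affine2:
  "partial k (\<lambda>x. (x $ i - c) * (x $ j - e)) x =
     (if k = i then x $ j - e else 0) + (if k = j then x $ i - c else 0)"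
proof -
  have "((\<lambda>x. (x $ i - c) * (x $ j - e)) has_derivative
      (\<lambda>h. (x $ i - c) * h $ j + h $ i * (x $ j - e))) (at x)"
    by (auto intro!: derivative_eq_intros bounded_linear_imp_has_derivative[OF bounded_linear_vec_nth])
  from partial_eq[OF this, of k] show ?thesis by (auto simp: axis_def)
qed

lemma partial_partial_affine2:
  fixes x :: "real^'n"
  shows
  "partial l (partial k (\<lambda>x. (x $ i - c) * (x $ j - e))) x =
     (if k = i \<and> l = j then 1 else 0) + (if k = j \<and> l = i then 1 else 0)"
proof -
  have eq: "partial k (\<lambda>x. (x $ i - c) * (x $ j - e)) =
      (\<lambda>x. (if k = i then 1 else 0) * (x $ j - e) + (if k = j then 1 else 0) * (x $ i - c))"
    by (rule ext) (simp add: partial_affine2)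
  have "((\<lambda>x::real^'n. u * (x $ j - e) + w * (x $ i - c)) has_derivative
      (\<lambda>h. u * h $ j + w * h $ i)) (at x)" for u w
    by (auto intro!: derivative_eq_intros bounded_linear_imp_has_derivative[OF bounded_linear_vec_nth])
  then have "partial l (\<lambda>x. u * (x $ j - e) + w * (x $ i - c)) x = u * axis l 1 $ j + w * axis l 1 $ i" for u w
    by (rule partial_eq)
  note this[of "if k = i then 1 else 0" "if k = j then 1 else 0"]
  also have "(if k = i then 1 else 0) * axis l 1 $ j + (if k = j then 1 else 0) * axis l 1 $ i
      = (if k = i \<and> l = j then 1 else 0) + (if k = j \<and> l = i then 1 else (0::real))"
    unfolding axis_def by (cases "k = i"; cases "k = j"; cases "l = i"; cases "l = j") simp_all
  finally show ?thesis by (simp only: eq)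
qed

lemma partial_partial_affine: "partial l (partial k (\<lambda>x. x $ i - c)) x = 0"
proof -
  have "partial k (\<lambda>x. x $ i - c) = (\<lambda>x. if k = i then 1 else 0)"
    by (rule ext) (rule partial_affine)
  then show ?thesis by (simp add: partial_const)
qed

lemma partial_partial_const: "partial l (partial k (\<lambda>x. c)) x = 0"
proof -
  have "partial k (\<lambda>x. c) = (\<lambda>x. 0)" by (rule ext) (rule partial_const)
  then show ?thesis by (simp add: partial_const)
qed

lemma test_funs_local_affine:
  fixes a :: "real^'n"
  obtains f where "f \<in> test_funs" "\<And>x. dist x a \<le> 1 \<Longrightarrow> f x = x $ i - a $ i"
proof -
  obtain \<phi> where \<phi>: "\<phi> \<in> test_funs" "\<And>x. dist x a \<le> 1 \<Longrightarrow> \<phi> x = 1"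
    using bump_exists[of 2 a] by (metis zero_less_numeral div_self zero_neq_numeral)
  have "(\<lambda>x. (x $ i - a $ i) * \<phi> x) \<in> test_funs"
    by (rule test_funs_mult_right[OF \<phi>(1) smooth_alg_diff[OF smooth_alg.coord smooth_alg.const]])
  then show ?thesis by (rule that) (simp add: \<phi>(2))
qed

lemma test_funs_local_quadratic:
  fixes a :: "real^'n"
  obtains f where "f \<in> test_funs" "\<And>x. dist x a \<le> 1 \<Longrightarrow> f x = (x $ i - a $ i) * (x $ j - a $ j)"
proof -
  obtain g where g: "g \<in> test_funs" "\<And>x. dist x a \<le> 1 \<Longrightarrow> g x = x $ j - a $ j"
    using test_funs_local_affine[of a j] by metis
  have "(\<lambda>x. (x $ i - a $ i) * g x) \<in> test_funs"
    by (rule test_funs_mult_right[OF g(1) smooth_alg_diff[OF smooth_alg.coord smooth_alg.const]])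
  then show ?thesis by (rule that) (simp add: g(2))
qed

lemma tendsto_eventually_le:
  fixes f :: "nat \<Rightarrow> real"
  assumes "f \<longlonglongrightarrow> l" "eventually (\<lambda>n. g n \<le> f n) sequentially"
  shows "eventually (\<lambda>n. g n \<le> l + 1) sequentially"
  using order_tendstoD(2)[OF assms(1), of "l + 1"] assms(2) by (auto elim: eventually_elim2)

lemma psd_diag_nonneg:
  fixes g :: "real^'n^'n"
  assumes "\<And>x. 0 \<le> x \<bullet> (g *v x)"
  shows "0 \<le> g $ i $ i"
  using assms[of "axis i 1"]
  by (simp add: matrix_vector_mult_basis inner_axis' column_def)

context compensated
begin

lemma modified_cov_sym:
  assumes "levy_triplet a d g N"
  shows "modified_cov a g N i j = modified_cov a g N j i"
proof -
  have "transpose g = g" using assms by (simp add: levy_triplet_def)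
  then have "g $ i $ j = g $ j $ i" by (metis transpose_def vec_lambda_beta)
  then show ?thesis by (simp add: modified_cov_def mult.commute)
qed

end

text \<open>Only the base points are assumed to converge. The condition on discontinuities of
  \<open>chi\<close> is placed on the limit measure, where the passage to the limit needs
  it.\<close>

locale triplet_sequence = compensated chi
  for chi :: "(real^'n) \<times> (real^'n) option \<Rightarrow> real^'n" +
  fixes A :: "nat \<Rightarrow> real^'n" and d :: "nat \<Rightarrow> real^'n" and g :: "nat \<Rightarrow> real^'n^'n"
    and N :: "nat \<Rightarrow> (real^'n) option measure"
    and a :: "real^'n" and d0 :: "real^'n" and g0 :: "real^'n^'n" and M :: "(real^'n) option measure"
  assumes A: "A \<longlonglongrightarrow> a"
    and triplets: "\<And>n. levy_triplet (A n) (d n) (g n) (N n)"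
    and triplet: "levy_triplet a d0 g0 M"
    and disc: "chi_discontinuities chi a \<in> null_sets M"
begin

lemma lev: "levy_measure (A n) (N n)" "levy_measure a M"
  using triplets triplet by (auto intro: levy_triplet_levy_measure)

lemma A_near: "e > 0 \<Longrightarrow> eventually (\<lambda>n. dist (A n) a < e) sequentially"
  by (rule tendstoD[OF A])

text \<open>Weak convergence away from \<open>a\<close>: the test functions vanish near
  \<open>a\<close> and therefore do not see the possibly infinite mass there.\<close>

definition vague_limit :: bool where
  "vague_limit \<longleftrightarrow> (\<forall>f\<in>C_compactified. a \<in> interior {x. f (Some x) = 0} \<longrightarrow>
      (\<lambda>n. \<integral>b. f b \<partial>N n) \<longlonglongrightarrow> (\<integral>b. f b \<partial>M))"

lemma rem_limit:
  assumes vague: "vague_limit" and "r > 0"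
    and "eventually (\<lambda>n. (\<integral>b. indicator (Some ` ball a r) b * sq_dist (A n) b \<partial>N n) \<le> K) sequentially"
    and f: "f \<in> Cc_infinity"
  shows "(\<lambda>n. \<integral>b. rem f (A n) b \<partial>N n) \<longlonglongrightarrow> (\<integral>b. rem f a b \<partial>M)"
proof -
  obtain C where C: "\<And>a b. \<bar>rem f a b\<bar> \<le> C" using rem_bounded[OF f] by metis
  have "AE b in M. b \<notin> chi_discontinuities chi a" by (rule AE_not_in[OF disc])
  then have cont: "AE b in M. ((\<lambda>(a', b'). rem f a' b') \<longlongrightarrow> rem f a b) (nhds_emb a b)"
    by eventually_elim (rule rem_continuous[OF f], simp add: chi_discontinuities_def)
  show ?thesis
    by (rule small_jump_limit[where h = "rem f", OF lev A _ assms(2,3) C rem_measurable[OF f] rem_small[OF f] cont])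
      (use vague in \<open>auto simp: vague_limit_def\<close>)
qed

lemma partials_tendsto:
  assumes "f \<in> Cc_infinity"
  shows "(\<lambda>n. partial i f (A n)) \<longlonglongrightarrow> partial i f a"
    "(\<lambda>n. partial i (partial j f) (A n)) \<longlonglongrightarrow> partial i (partial j f) a"
    "(\<lambda>n. grad f (A n)) \<longlonglongrightarrow> grad f a"
proof -
  show 1: "(\<lambda>n. partial i f (A n)) \<longlonglongrightarrow> partial i f a" for i
    by (rule isCont_tendsto_compose[OF Cc_isCont[OF Cc_partial[OF assms]] A])
  show "(\<lambda>n. partial i (partial j f) (A n)) \<longlonglongrightarrow> partial i (partial j f) a"
    by (rule isCont_tendsto_compose[OF Cc_isCont[OF Cc_partial[OF Cc_partial[OF assms]]] A])
  show "(\<lambda>n. grad f (A n)) \<longlonglongrightarrow> grad f a"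
    by (rule vec_tendstoI) (simp add: grad_def 1)
qed

text \<open>The moment bound comes from the trace of \<open>modified_cov\<close>: near
  \<open>a\<close> the squared jump is at most 4 |chi|^2, and the diagonal of \<open>g n\<close> is
  nonnegative, so the integral of |chi|^2 is at most that trace, which converges.\<close>

lemma levy_op_tendsto:
  assumes d: "d \<longlonglongrightarrow> d0" and vague: "vague_limit"
    and cov: "\<And>i j. (\<lambda>n. modified_cov (A n) (g n) (N n) i j) \<longlonglongrightarrow> modified_cov a g0 M i j"
    and f: "f \<in> Cc_infinity"
  shows "(\<lambda>n. levy_op chi (A n) (d n) (g n) (N n) f) \<longlonglongrightarrow> levy_op chi a d0 g0 M f"
proof -
  obtain r where r: "r > 0" "\<And>a' x. dist a' a < r \<Longrightarrow> dist x a < r \<Longrightarrow> x \<noteq> a' \<Longrightarrow>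
      (dist x a')\<^sup>2 \<le> 4 * (norm (chi (a', Some x)))\<^sup>2"
    using chi_lower[of a] by blast
  let ?S = "\<lambda>n. \<Sum>i\<in>UNIV. modified_cov (A n) (g n) (N n) i i"
  have lim: "(\<lambda>n. 4 * ?S n) \<longlonglongrightarrow> 4 * (\<Sum>i\<in>UNIV. modified_cov a g0 M i i)"
    by (intro tendsto_intros cov)
  have "\<forall>\<^sub>F n in sequentially.
      (\<integral>b. indicator (Some ` ball a r) b * sq_dist (A n) b \<partial>N n) \<le> 4 * ?S n"
    using A_near[OF r(1)]
  proof eventually_elim
    case (elim n)
    let ?q = "\<lambda>b. 4 * (\<Sum>i\<in>UNIV. chi (A n, b) $ i * chi (A n, b) $ i)"
    have sq: "?q b = 4 * (norm (chi (A n, b)))\<^sup>2" for b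
      by (simp add: power2_norm_eq_inner inner_vec_def)
    have "(\<integral>b. indicator (Some ` ball a r) b * sq_dist (A n) b \<partial>N n) \<le> (\<integral>b. ?q b \<partial>N n)"
    proof (rule integral_mono_AE)
      show "integrable (N n) (\<lambda>b. indicator (Some ` ball a r) b * sq_dist (A n) b)"
        by (rule sq_dist_integrable[OF lev(1) elim])
      show "integrable (N n) ?q" using chi_mult_integrable[OF lev(1)] by simp
      show "AE b in N n. indicator (Some ` ball a r) b * sq_dist (A n) b \<le> ?q b"
        using levy_measure_AE[OF lev(1)]
      proof eventually_elim
        case (elim b)
        show ?case
        proof (cases "b \<in> Some ` ball a r")
          case True
          then obtain x where "b = Some x" "dist x a < r" by (auto simp: dist_commute)
          then show ?thesis unfolding sq
            using r(2)[of "A n" x] elim \<open>dist (A n) a < r\<close> True by (simp add: sq_dist_def)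
        next
          case False
          then show ?thesis unfolding sq by simp
        qed
      qed
    qed
    also have "\<dots> = 4 * (\<Sum>i\<in>UNIV. (\<integral>b. chi (A n, b) $ i * chi (A n, b) $ i \<partial>N n))"
      using chi_mult_integrable[OF lev(1)] by simp
    also have "\<dots> \<le> 4 * ?S n"
    proof -
      have "g n $ i $ i \<ge> 0" for i
        using triplets[of n] by (intro psd_diag_nonneg) (auto simp: levy_triplet_def)
      then show ?thesis
        by (intro mult_left_mono sum_mono) (auto simp: modified_cov_def)
    qed
    finally show ?case .
  qed
  from tendsto_eventually_le[OF lim this]
  have R: "(\<lambda>n. \<integral>b. rem f (A n) b \<partial>N n) \<longlonglongrightarrow> (\<integral>b. rem f a b \<partial>M)"
    by (rule rem_limit[OF vague r(1) _ f])
  show ?thesis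
    unfolding levy_op_decomp(1)[OF lev(1) f] levy_op_decomp(1)[OF lev(2) f]
    by (intro tendsto_intros R cov d partials_tendsto f)
qed

section \<open>Necessity: what convergence of the operators on all test functions implies\<close>

context
  assumes conv: "\<And>f. f \<in> Cc_infinity \<Longrightarrow>
    (\<lambda>n. levy_op chi (A n) (d n) (g n) (N n) f) \<longlonglongrightarrow> levy_op chi a d0 g0 M f"
begin

text \<open>Since \<open>f\<close> equals \<open>- c\<close> near \<open>a\<close>, its derivatives
  vanish at nearby base points and the operator reduces to the integral of f(b) - f(a') = c + f(b).
  The constant allows the integrand a nonzero value at infinity.\<close>

lemma vague_limit_test:
  assumes f: "f \<in> test_funs" and r: "r > 0" and zero: "\<And>x. dist x a < r \<Longrightarrow> c + f x = 0"
  shows "(\<lambda>n. \<integral>b. c + ext0 f b \<partial>N n) \<longlonglongrightarrow> (\<integral>b. c + ext0 f b \<partial>M)"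
proof -
  have op: "levy_op chi a' d' g' N' f = (\<integral>b. c + ext0 f b \<partial>N')" if "dist a' a < r" for a' d' g' N'
  proof -
    have a': "a' \<in> ball a r" using that by (simp add: dist_commute)
    have eq: "f x = - c" if "x \<in> ball a r" for x
      using zero[of x] that by (simp add: dist_commute)
    have p: "partial i f a' = 0" for i
      using partial_cong_open[OF open_ball a' eq, where i = i] by (simp add: partial_const)
    have pp: "partial i (partial j f) a' = 0" for i j
      using partial2_cong_open[OF open_ball a' eq, where i = i and j = j] by (simp add: partial_partial_const)
    have "grad f a' = 0" by (simp add: grad_def p vec_eq_iff)
    then show ?thesis by (simp add: levy_op_def pp eq[OF a'] add.commute)
  qed
  have "(\<lambda>n. levy_op chi (A n) (d n) (g n) (N n) f) \<longlonglongrightarrow> levy_op chi a d0 g0 M f"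
    by (rule conv[OF test_funs_Cc[OF f]])
  then have "(\<lambda>n. levy_op chi (A n) (d n) (g n) (N n) f) \<longlonglongrightarrow> (\<integral>b. c + ext0 f b \<partial>M)"
    using op[of a] r by simp
  then show ?thesis
    by (rule Lim_transform_eventually) (use A_near[OF r] op in \<open>auto elim: eventually_mono\<close>)
qed

text \<open>Convergence of these integrals bounds the masses of the \<open>N n\<close> away from
  \<open>a\<close>; this is what converts pointwise approximation errors into errors of
  integrals.\<close>

lemma complement_bump:
  assumes r: "r > 0"
  obtains \<rho> where "\<rho> \<in> C_compactified" "\<And>b. 0 \<le> \<rho> b" "\<And>b. \<rho> b \<le> 1"
    "\<And>x. dist x a \<le> r / 2 \<Longrightarrow> \<rho> (Some x) = 0" "\<And>x. dist x a \<ge> r \<Longrightarrow> \<rho> (Some x) = 1" "\<rho> None = 1"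
    "(\<lambda>n. \<integral>b. \<rho> b \<partial>N n) \<longlonglongrightarrow> (\<integral>b. \<rho> b \<partial>M)"
proof -
  obtain \<psi> where \<psi>: "\<psi> \<in> test_funs" "\<And>x. 0 \<le> \<psi> x" "\<And>x. \<psi> x \<le> 1"
    "\<And>x. dist x a \<le> r / 2 \<Longrightarrow> \<psi> x = 1" "\<And>x. dist x a \<ge> r \<Longrightarrow> \<psi> x = 0"
    using bump_exists[OF r, of a] by metis
  define k where "k x = - 1 * \<psi> x" for x
  have k: "k \<in> test_funs" unfolding k_def by (rule test_funs_mult_right[OF \<psi>(1) smooth_alg.const])
  show ?thesis
  proof (rule that[of "\<lambda>b. 1 + ext0 k b"])
    show "(\<lambda>b. 1 + ext0 k b) \<in> C_compactified"
      by (intro C_compactified_add C_compactified_const ext0_C_compactified test_funs_Cc k)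
    show "(\<lambda>n. \<integral>b. 1 + ext0 k b \<partial>N n) \<longlonglongrightarrow> (\<integral>b. 1 + ext0 k b \<partial>M)"
      by (rule vague_limit_test[OF k, of "r / 2"]) (use r \<psi>(4) in \<open>auto simp: k_def\<close>)
  qed (use \<psi> in \<open>auto simp: k_def ext0_def split: option.split\<close>)
qed

text \<open>A uniform approximation c + f of \<open>F\<close> need not vanish near \<open>a\<close>,
  so it is multiplied by 1 - \<phi>. This costs nothing: where \<phi> is nonzero \<open>F\<close> is
  0, so c + f is already within \<open>e'\<close> of 0. The error then lives where
  \<open>\<rho>\<close> is 1 and is at most \<open>e' * \<rho>\<close>.\<close>

lemma vague_limit_of_levy_op: "vague_limit"
  unfolding vague_limit_def
proof (intro ballI impI tendstoI)
  fix F :: "(real^'n) option \<Rightarrow> real" and e :: real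
  assume F: "F \<in> C_compactified" and "a \<in> interior {x. F (Some x) = 0}" and e: "e > 0"
  then obtain r where r: "r > 0" "\<And>x. dist x a < r \<Longrightarrow> F (Some x) = 0"
    by (auto simp: interior_zero_ball)
  obtain \<rho> where \<rho>: "\<rho> \<in> C_compactified" "\<And>b. 0 \<le> \<rho> b" "\<And>b. \<rho> b \<le> 1"
    "\<And>x. dist x a \<le> r / 4 \<Longrightarrow> \<rho> (Some x) = 0" "\<And>x. dist x a \<ge> r / 2 \<Longrightarrow> \<rho> (Some x) = 1"
    "\<rho> None = 1" "(\<lambda>n. \<integral>b. \<rho> b \<partial>N n) \<longlonglongrightarrow> (\<integral>b. \<rho> b \<partial>M)"
    using complement_bump[of "r / 2"] r(1) by (auto simp: mult.commute)
  define R where "R = (\<integral>b. \<rho> b \<partial>M)"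
  have R: "R \<ge> 0" unfolding R_def using \<rho>(2) by simp
  \<comment> \<open>The integral of \<open>\<rho>\<close> is \<open>R\<close> for \<open>M\<close>
    and eventually below \<open>R + 1\<close> for \<open>N n\<close>, so each of the two
    approximation errors is at most \<open>e / 3\<close>.\<close>
  define e' where "e' = e / (3 * (R + 1))"
  have e': "e' > 0" "e' * (R + 1) \<le> e / 3" using e R by (auto simp: e'_def field_simps)
  obtain c f where f: "f \<in> test_funs" "\<And>b. \<bar>F b - (c + ext0 f b)\<bar> < e'"
    using test_funs_dense[OF F e'(1)] by metis
  obtain \<phi> where \<phi>: "\<phi> \<in> test_funs" "\<And>x. 0 \<le> \<phi> x" "\<And>x. \<phi> x \<le> 1"
    "\<And>x. dist x a \<le> r / 2 \<Longrightarrow> \<phi> x = 1" "\<And>x. dist x a \<ge> r \<Longrightarrow> \<phi> x = 0"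
    using bump_exists[OF r(1), of a] by metis
  \<comment> \<open>Chosen so that c + k = (1 - \<phi>) (c + f), while \<open>k\<close> itself has
    bounded support.\<close>
  define k where "k x = (1 - \<phi> x) * f x + (- c) * \<phi> x" for x
  have k: "k \<in> test_funs" unfolding k_def
    by (intro test_funs_add test_funs_mult_right[OF f(1)] test_funs_mult_right[OF \<phi>(1)]
        smooth_alg_diff smooth_alg.const) (use \<phi>(1) in \<open>simp add: test_funs_def\<close>)
  have k': "c + k x = (1 - \<phi> x) * (c + f x)" for x
    by (simp add: k_def algebra_simps)
  define G where "G b = c + ext0 k b" for b
  have GC: "G \<in> C_compactified" unfolding G_def
    by (intro C_compactified_add C_compactified_const ext0_C_compactified test_funs_Cc k)
  have G0: "G (Some x) = 0" if "dist x a \<le> r / 2" for x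
    using that \<phi>(4) k' by (simp add: G_def ext0_def)
  have FG: "\<bar>F b - G b\<bar> \<le> e' * \<rho> b" for b
  proof (cases b)
    case None
    then show ?thesis using f(2)[of None] \<rho>(6) by (simp add: G_def ext0_def)
  next
    case (Some x)
    consider "dist x a \<le> r / 2" | "r / 2 < dist x a" "dist x a < r" | "dist x a \<ge> r" by linarith
    then show ?thesis
    proof cases
      case 1
      then show ?thesis using r G0[OF 1] \<rho>(2) e' Some by simp
    next
      case 2
      have "\<bar>(1 - \<phi> x) * (c + f x)\<bar> \<le> 1 * e'"
        unfolding abs_mult
        by (intro mult_mono) (use f(2)[of b] 2 r(2)[of x] Some \<phi>(2,3)[of x] in \<open>auto simp: ext0_def\<close>)
      then show ?thesis using 2 r(2)[of x] \<rho>(5)[of x] Some k' by (simp add: G_def ext0_def)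
    next
      case 3
      then show ?thesis using f(2)[of b] \<rho>(5)[of x] r(1) Some k'[of x] \<phi>(5)[of x]
        by (simp add: G_def ext0_def)
    qed
  qed
  \<comment> \<open>A base point within \<open>r / 8\<close> of \<open>a\<close> has its whole
    \<open>r / 8\<close>-ball inside the \<open>r / 4\<close>-ball around \<open>a\<close>, where
    \<open>K\<close> vanishes.\<close>
  have integ: "integrable N' K" if K: "levy_measure a' N'" "dist a' a < r / 8" "K \<in> C_compactified"
    "\<And>x. dist x a \<le> r / 4 \<Longrightarrow> K (Some x) = 0" for a' N' K
  proof -
    obtain B where "\<And>b. \<bar>K b\<bar> \<le> B" using C_compactified_bounded[OF K(3)] by metis
    moreover have "K (Some x) = 0" if x: "dist x a' < r / 8" for x
      by (rule K(4)) (use dist_triangle[of x a a'] x K(2) in linarith)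
    ultimately show ?thesis
      by (intro levy_measure_integrable_away[OF K(1) C_compactified_measurable[OF K(3)], of "r / 8"])
        (use r in auto)
  qed
  have near: "\<bar>(\<integral>b. F b \<partial>N') - (\<integral>b. G b \<partial>N')\<bar> \<le> e' * (\<integral>b. \<rho> b \<partial>N')"
    if "levy_measure a' N'" "dist a' a < r / 8" for a' N'
  proof -
    have i: "integrable N' F" "integrable N' G" "integrable N' \<rho>"
      using r G0 \<rho>(4) by (auto intro!: integ[OF that] F GC \<rho>(1))
    have "\<bar>(\<integral>b. F b \<partial>N') - (\<integral>b. G b \<partial>N')\<bar> = norm (\<integral>b. F b - G b \<partial>N')"
      using i by simp
    also have "\<dots> \<le> (\<integral>b. norm (F b - G b) \<partial>N')" by (rule integral_norm_bound)
    also have "\<dots> \<le> (\<integral>b. e' * \<rho> b \<partial>N')"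
      by (rule integral_mono) (use i FG in auto)
    finally show ?thesis by simp
  qed
  have "(\<lambda>n. \<integral>b. G b \<partial>N n) \<longlonglongrightarrow> (\<integral>b. G b \<partial>M)"
    unfolding G_def
    by (rule vague_limit_test[OF k, of "r / 2"]) (use r G0 in \<open>auto simp: G_def ext0_def\<close>)
  then have e1: "\<forall>\<^sub>F n in sequentially. dist (\<integral>b. G b \<partial>N n) (\<integral>b. G b \<partial>M) < e / 3"
    by (rule tendstoD) (use e in simp)
  have e2: "\<forall>\<^sub>F n in sequentially. (\<integral>b. \<rho> b \<partial>N n) < R + 1"
    using \<rho>(7) by (rule order_tendstoD(2)) (simp add: R_def)
  have e3: "\<forall>\<^sub>F n in sequentially. dist (A n) a < r / 8" by (rule A_near) (use r in simp)
  show "\<forall>\<^sub>F n in sequentially. dist (\<integral>b. F b \<partial>N n) (\<integral>b. F b \<partial>M) < e"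
    using e1 e2 e3
  proof eventually_elim
    case (elim n)
    have "e' * (\<integral>b. \<rho> b \<partial>N n) \<le> e' * (R + 1)" using elim(2) e'(1) by (intro mult_left_mono) auto
    moreover have "e' * R \<le> e' * (R + 1)" using e'(1) by (intro mult_left_mono) auto
    moreover have "\<bar>(\<integral>b. F b \<partial>N n) - (\<integral>b. G b \<partial>N n)\<bar> \<le> e' * (\<integral>b. \<rho> b \<partial>N n)"
      by (rule near[OF lev(1) elim(3)])
    moreover have "\<bar>(\<integral>b. F b \<partial>M) - (\<integral>b. G b \<partial>M)\<bar> \<le> e' * R"
      unfolding R_def by (rule near[OF lev(2)]) (use r in simp)
    ultimately show ?case using elim(1) e'(2) unfolding dist_real_def by linarith
  qed
qed

text \<open>The drift is not yet known to be bounded, so it is eliminated: the combination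
  \<open>(x\<^sub>i - a\<^sub>i)\<^sup>2 - 2 (A\<^sub>n - a)\<^sub>i (x\<^sub>i - a\<^sub>i)\<close> of test functions has gradient \<open>0\<close> at \<open>A\<^sub>n\<close>.\<close>

lemma moment_bound_coord:
  obtains G l where "eventually (\<lambda>n. integrable (N n) (G n) \<and>
     (\<integral>b. G n b \<partial>N n) \<le> l \<and> (\<forall>b. 0 \<le> G n b) \<and>
     (\<forall>x. dist x a < 1 \<longrightarrow> (x $ i - A n $ i)\<^sup>2 \<le> G n (Some x))) sequentially"
proof -
  obtain p where p: "p \<in> test_funs" "\<And>x. dist x a \<le> 1 \<Longrightarrow> p x = x $ i - a $ i"
    using test_funs_local_affine[of a i] by metis
  obtain q where q: "q \<in> test_funs" "\<And>x. dist x a \<le> 1 \<Longrightarrow> q x = (x $ i - a $ i) * (x $ i - a $ i)"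
    using test_funs_local_quadratic[of a i i] by metis
  note pC = test_funs_Cc[OF p(1)] and qC = test_funs_Cc[OF q(1)]
  obtain Bp where Bp: "Bp > 0" "\<And>x. \<bar>p x\<bar> \<le> Bp" "\<And>b. \<bar>ext0 p b\<bar> \<le> Bp" using Cc_bounded[OF pC] by metis
  obtain Bq where Bq: "Bq > 0" "\<And>x. \<bar>q x\<bar> \<le> Bq" "\<And>b. \<bar>ext0 q b\<bar> \<le> Bq" using Cc_bounded[OF qC] by metis
  \<comment> \<open>Outside the unit ball \<open>k n\<close> is at least -(2 Bq + 4 Bp), because |s
    n| \<le> 1 eventually; adding \<open>C * \<rho>\<close> makes \<open>G n\<close> nonnegative
    everywhere.\<close>
  define C where "C = 2 * Bq + 4 * Bp"
  obtain \<rho> where \<rho>: "\<rho> \<in> C_compactified" "\<And>b. 0 \<le> \<rho> b" "\<And>b. \<rho> b \<le> 1"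
    "\<And>x. dist x a \<le> 1 / 2 \<Longrightarrow> \<rho> (Some x) = 0" "\<And>x. dist x a \<ge> 1 \<Longrightarrow> \<rho> (Some x) = 1"
    "\<rho> None = 1" "(\<lambda>n. \<integral>b. \<rho> b \<partial>N n) \<longlonglongrightarrow> (\<integral>b. \<rho> b \<partial>M)"
    using complement_bump[of 1] by auto
  define s where "s n = A n $ i - a $ i" for n
  \<comment> \<open>On the unit ball this is exactly (x_i - (A n)_i)^2, by completing the
    square.\<close>
  define k where "k n b = (ext0 q b - q (A n)) - 2 * s n * (ext0 p b - p (A n))" for n b
  define G where "G n b = k n b + C * \<rho> b" for n b
  define S where "S n = levy_op chi (A n) (d n) (g n) (N n) q
      - 2 * s n * levy_op chi (A n) (d n) (g n) (N n) p + C * (\<integral>b. \<rho> b \<partial>N n)" for n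
  define l where "l = levy_op chi a d0 g0 M q
      - 2 * (a $ i - a $ i) * levy_op chi a d0 g0 M p + C * (\<integral>b. \<rho> b \<partial>M)"
  have "s \<longlonglongrightarrow> a $ i - a $ i" unfolding s_def by (intro tendsto_intros A)
  then have "S \<longlonglongrightarrow> l" unfolding S_def l_def
    by (intro tendsto_intros conv pC qC \<rho>(7))
  then have eS: "\<forall>\<^sub>F n in sequentially. S n < l + 1" by (rule order_tendstoD) simp
  have near: "\<forall>\<^sub>F n in sequentially. dist (A n) a < 1 / 4" by (rule A_near) simp
  have "\<forall>\<^sub>F n in sequentially. integrable (N n) (G n) \<and>
     (\<integral>b. G n b \<partial>N n) \<le> l + 1 \<and> (\<forall>b. 0 \<le> G n b) \<and>
     (\<forall>x. dist x a < 1 \<longrightarrow> (x $ i - A n $ i)\<^sup>2 \<le> G n (Some x))"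
    using near eS
  proof eventually_elim
    case (elim n)
    let ?a = "A n"
    have a1: "?a \<in> ball a 1" "dist ?a a \<le> 1" using elim(1) by (auto simp: dist_commute)
    have s1: "\<bar>s n\<bar> \<le> 1"
      using component_le_norm_cart[of "?a - a" i] a1(2) by (simp add: s_def dist_norm)
    have p': "p x = x $ i - a $ i" and q': "q x = (x $ i - a $ i) * (x $ i - a $ i)"
      if "x \<in> ball a 1" for x using that p(2) q(2) by (auto simp: dist_commute)
    have gp: "v \<bullet> grad p ?a = v $ i" for v
      using partial_cong_open[OF open_ball a1(1) p']
      by (simp add: inner_grad partial_affine mult_delta_right)
    have gq: "v \<bullet> grad q ?a = 2 * s n * v $ i" for v
      using partial_cong_open[OF open_ball a1(1) q']
      by (simp add: inner_grad partial_affine2 s_def mult_delta_right distrib_left sum.distrib)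
    have hp: "partial j (partial k p) ?a = 0" for j k
      using partial2_cong_open[OF open_ball a1(1) p'] by (simp add: partial_partial_affine)
    have hq: "partial j (partial k q) ?a = (if k = i then if j = i then 2 else 0 else 0)" for j k
      using partial2_cong_open[OF open_ball a1(1) q'] by (simp add: partial_partial_affine2)
    have sum: "(\<Sum>j\<in>UNIV. \<Sum>k\<in>UNIV. g n $ j $ k * partial j (partial k q) ?a) = 2 * g n $ i $ i"
      by (simp add: hq mult_delta_right)
    have ip: "integrable (N n) (\<lambda>b. ext0 p b - p ?a - chi (?a, b) $ i)"
      using levy_op_decomp(2)[OF lev(1) pC, of n] by (simp add: gp)
    have iq: "integrable (N n) (\<lambda>b. ext0 q b - q ?a - 2 * s n * chi (?a, b) $ i)"
      using levy_op_decomp(2)[OF lev(1) qC, of n] by (simp add: gq)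
    \<comment> \<open>The gradients of \<open>q\<close> and of \<open>2 * s n\<close> times
      \<open>p\<close> at \<open>A n\<close> coincide, so the compensating terms cancel and
      \<open>k n\<close> is integrable.\<close>
    have ks: "k n b = (ext0 q b - q ?a - 2 * s n * chi (?a, b) $ i)
        - 2 * s n * (ext0 p b - p ?a - chi (?a, b) $ i)" for b
      by (simp add: k_def algebra_simps)
    have ik: "integrable (N n) (k n)" unfolding ks[abs_def] using ip iq by simp
    have ir: "integrable (N n) \<rho>"
    proof (rule levy_measure_integrable_away[OF lev(1) C_compactified_measurable[OF \<rho>(1)], of "1/4" _ 1])
      show "\<rho> (Some x) = 0" if "dist x ?a < 1 / 4" for x
        by (rule \<rho>(4)) (use dist_triangle[of x a ?a] that elim(1) in linarith)
    qed (use \<rho>(2,3) in auto)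
    have "(\<integral>b. k n b \<partial>N n) = (\<integral>b. ext0 q b - q ?a - 2 * s n * chi (?a, b) $ i \<partial>N n)
        - 2 * s n * (\<integral>b. ext0 p b - p ?a - chi (?a, b) $ i \<partial>N n)"
      unfolding ks using ip iq by simp
    also have "\<dots> = levy_op chi ?a (d n) (g n) (N n) q - 2 * s n * levy_op chi ?a (d n) (g n) (N n) p
        - g n $ i $ i"
      by (simp add: levy_op_def gp gq hp sum algebra_simps)
    finally have "(\<integral>b. G n b \<partial>N n) = S n - g n $ i $ i"
      unfolding G_def S_def using ik ir by simp
    moreover have "g n $ i $ i \<ge> 0"
      using triplets[of n] by (intro psd_diag_nonneg) (auto simp: levy_triplet_def)
    ultimately have 1: "(\<integral>b. G n b \<partial>N n) \<le> l + 1" using elim(2) by linarith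
    have 2: "integrable (N n) (G n)" unfolding G_def using ik ir by simp
    have C: "C \<ge> 0" using Bp(1) Bq(1) by (simp add: C_def)
    have 4: "(x $ i - ?a $ i)\<^sup>2 \<le> G n (Some x)" if "dist x a < 1" for x
    proof -
      have "k n (Some x) = (x $ i - ?a $ i)\<^sup>2"
        unfolding k_def ext0_def option.case p(2)[OF less_imp_le[OF that]] q(2)[OF less_imp_le[OF that]]
          p(2)[OF a1(2)] q(2)[OF a1(2)] s_def
        by (simp add: power2_eq_square algebra_simps)
      then show ?thesis using C \<rho>(2)[of "Some x"] by (simp add: G_def)
    qed
    have 5: "0 \<le> G n b" for b
    proof (cases "\<exists>x. b = Some x \<and> dist x a < 1")
      case True
      then show ?thesis using 4 by (metis order_trans zero_le_power2)
    next
      case False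
      then have "\<rho> b = 1" using \<rho>(5,6) by (cases b) (auto simp: not_less)
      moreover have "\<bar>(2 * s n) * (ext0 p b - p ?a)\<bar> \<le> 2 * (2 * Bp)"
        unfolding abs_mult[of "2 * s n"] using s1 Bp(1) Bp(2)[of ?a] Bp(3)[of b]
        by (intro mult_mono) auto
      ultimately show ?thesis using Bq(2)[of ?a] Bq(3)[of b]
        by (simp add: G_def k_def C_def)
    qed
    show ?case using 1 2 4 5 by blast
  qed
  then show ?thesis by (rule that)
qed

lemma moments_bounded:
  obtains K where
    "eventually (\<lambda>n. (\<integral>b. indicator (Some ` ball a 1) b * sq_dist (A n) b \<partial>N n) \<le> K) sequentially"
proof -
  define P where "P i G l n \<longleftrightarrow> integrable (N n) (G n) \<and> (\<integral>b. G n b \<partial>N n) \<le> l \<and> (\<forall>b. 0 \<le> G n b) \<and>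
      (\<forall>x. dist x a < 1 \<longrightarrow> (x $ i - A n $ i)\<^sup>2 \<le> G n (Some x))" for i G l n
  have "\<exists>G l. eventually (P i G l) sequentially" for i
  proof -
    obtain G l where "eventually (\<lambda>n. integrable (N n) (G n) \<and>
     (\<integral>b. G n b \<partial>N n) \<le> l \<and> (\<forall>b. 0 \<le> G n b) \<and>
     (\<forall>x. dist x a < 1 \<longrightarrow> (x $ i - A n $ i)\<^sup>2 \<le> G n (Some x))) sequentially"
      by (rule moment_bound_coord)
    then have "eventually (P i G l) sequentially" unfolding P_def by (rule eventually_mono) blast
    then show ?thesis by blast
  qed
  then obtain G l where "\<And>i. eventually (P i (G i) (l i)) sequentially" by metis
  then have "eventually (\<lambda>n. \<forall>i. P i (G i) (l i) n) sequentially"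
    by (rule eventually_all_finite)
  then have "eventually (\<lambda>n. (\<integral>b. indicator (Some ` ball a 1) b * sq_dist (A n) b \<partial>N n)
      \<le> (\<Sum>i\<in>UNIV. l i)) sequentially"
    using A_near[of 1, OF zero_less_one]
  proof eventually_elim
    case (elim n)
    have G: "integrable (N n) (G i n)" "(\<integral>b. G i n b \<partial>N n) \<le> l i" "0 \<le> G i n b"
      "dist x a < 1 \<Longrightarrow> (x $ i - A n $ i)\<^sup>2 \<le> G i n (Some x)" for i b x
      using elim(1) unfolding P_def by blast+
    have "(\<integral>b. indicator (Some ` ball a 1) b * sq_dist (A n) b \<partial>N n) \<le> (\<integral>b. (\<Sum>i\<in>UNIV. G i n b) \<partial>N n)"
    proof (rule integral_mono)
      show "integrable (N n) (\<lambda>b. indicator (Some ` ball a 1) b * sq_dist (A n) b)"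
        by (rule sq_dist_integrable[OF lev(1) elim(2)])
      show "integrable (N n) (\<lambda>b. \<Sum>i\<in>UNIV. G i n b)" using G(1) by simp
      fix b
      show "indicator (Some ` ball a 1) b * sq_dist (A n) b \<le> (\<Sum>i\<in>UNIV. G i n b)"
      proof (cases "b \<in> Some ` ball a 1")
        case True
        then obtain x where x: "b = Some x" "dist x a < 1" by (auto simp: dist_commute)
        have "(dist x (A n))\<^sup>2 = (\<Sum>i\<in>UNIV. (x $ i - A n $ i)\<^sup>2)"
          unfolding dist_norm power2_norm_eq_inner by (simp add: inner_vec_def power2_eq_square)
        also have "\<dots> \<le> (\<Sum>i\<in>UNIV. G i n b)"
          unfolding x(1) by (intro sum_mono G(4) x(2))
        finally show ?thesis using True x by (simp add: sq_dist_def)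
      next
        case False
        then show ?thesis using G(3) by (simp add: sum_nonneg)
      qed
    qed
    also have "\<dots> = (\<Sum>i\<in>UNIV. (\<integral>b. G i n b \<partial>N n))" using G(1) by simp
    also have "\<dots> \<le> (\<Sum>i\<in>UNIV. l i)" by (intro sum_mono G(2))
    finally show ?case .
  qed
  then show ?thesis by (rule that)
qed

text \<open>The moment bound makes the remainder integrals converge. Subtracting them leaves an
  expression in finitely many derivatives of \<open>f\<close> at \<open>A n\<close>, from which the
  coefficients can be isolated by the choice of \<open>f\<close>.\<close>

lemma local_part_tendsto:
  assumes f: "f \<in> Cc_infinity"
  shows "(\<lambda>n. 1 / 2 * (\<Sum>i\<in>UNIV. \<Sum>j\<in>UNIV. modified_cov (A n) (g n) (N n) i j * partial i (partial j f) (A n))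
     + d n \<bullet> grad f (A n)) \<longlonglongrightarrow>
    1 / 2 * (\<Sum>i\<in>UNIV. \<Sum>j\<in>UNIV. modified_cov a g0 M i j * partial i (partial j f) a) + d0 \<bullet> grad f a"
proof -
  obtain K where K: "eventually (\<lambda>n.
      (\<integral>b. indicator (Some ` ball a 1) b * sq_dist (A n) b \<partial>N n) \<le> K) sequentially"
    by (rule moments_bounded)
  have "(\<lambda>n. \<integral>b. rem f (A n) b \<partial>N n) \<longlonglongrightarrow> (\<integral>b. rem f a b \<partial>M)"
    by (rule rem_limit[OF vague_limit_of_levy_op zero_less_one K f])
  from tendsto_diff[OF conv[OF f] this] show ?thesis
    unfolding levy_op_decomp(1)[OF lev(1) f] levy_op_decomp(1)[OF lev(2) f] by simp
qed

text \<open>A function equal to x_i - a_i near \<open>a\<close> has zero Hessian there, so its local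
  part at \<open>A n\<close> is the i-th drift coordinate.\<close>

lemma drift_tendsto: "d \<longlonglongrightarrow> d0"
proof (rule vec_tendstoI)
  fix i
  obtain p where p: "p \<in> test_funs" "\<And>x. dist x a \<le> 1 \<Longrightarrow> p x = x $ i - a $ i"
    using test_funs_local_affine[of a i] by metis
  have p': "p x = x $ i - a $ i" if "x \<in> ball a 1" for x using that p(2) by (auto simp: dist_commute)
  have gp: "v \<bullet> grad p a' = v $ i" and hp: "partial j (partial k p) a' = 0"
    if "dist a' a < 1" for v a' j k
  proof -
    have a': "a' \<in> ball a 1" using that by (simp add: dist_commute)
    show "v \<bullet> grad p a' = v $ i"
      using partial_cong_open[OF open_ball a' p']
      by (simp add: inner_grad partial_affine mult_delta_right)
    show "partial j (partial k p) a' = 0"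
      using partial2_cong_open[OF open_ball a' p'] by (simp add: partial_partial_affine)
  qed
  have "(\<lambda>n. 1 / 2 * (\<Sum>i\<in>UNIV. \<Sum>j\<in>UNIV. modified_cov (A n) (g n) (N n) i j * partial i (partial j p) (A n))
     + d n \<bullet> grad p (A n)) \<longlonglongrightarrow> d0 $ i"
    using local_part_tendsto[OF test_funs_Cc[OF p(1)]] by (simp add: gp[of a] hp[of a])
  then show "(\<lambda>n. d n $ i) \<longlonglongrightarrow> d0 $ i"
    by (rule Lim_transform_eventually)
      (use A_near[OF zero_less_one] in \<open>auto elim!: eventually_mono simp: gp hp\<close>)
qed

text \<open>The Hessian of (x_i - a_i)(x_j - a_j) picks the entries ij and ji, which agree by
  symmetry. Its gradient vanishes at \<open>a\<close> but not at \<open>A n\<close>, so the drift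
  term has to be removed with the help of \<open>drift_tendsto\<close>.\<close>

lemma modified_cov_tendsto:
  "(\<lambda>n. modified_cov (A n) (g n) (N n) i j) \<longlonglongrightarrow> modified_cov a g0 M i j"
proof -
  obtain q where q: "q \<in> test_funs" "\<And>x. dist x a \<le> 1 \<Longrightarrow> q x = (x $ i - a $ i) * (x $ j - a $ j)"
    using test_funs_local_quadratic[of a i j] by metis
  note qC = test_funs_Cc[OF q(1)]
  have q': "q x = (x $ i - a $ i) * (x $ j - a $ j)" if "x \<in> ball a 1" for x
    using that q(2) by (auto simp: dist_commute)
  have hq: "1 / 2 * (\<Sum>k\<in>UNIV. \<Sum>l\<in>UNIV. c k l * partial k (partial l q) a') = c i j"
    if "dist a' a < 1" and c: "\<And>k l. c k l = c l k" for c a'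
  proof -
    have a': "a' \<in> ball a 1" using that by (simp add: dist_commute)
    have pp: "partial k (partial l q) a' =
        (if l = i then if k = j then 1 else 0 else 0) + (if l = j then if k = i then 1 else 0 else 0)" for k l
      using partial2_cong_open[OF open_ball a' q'] by (simp add: partial_partial_affine2)
    have "(\<Sum>k\<in>UNIV. \<Sum>l\<in>UNIV. c k l * partial k (partial l q) a') = c j i + c i j"
      by (simp add: pp distrib_left sum.distrib mult_delta_right)
    then show ?thesis using c[of i j] by simp
  qed
  have "a \<in> ball a 1" by simp
  from partial_cong_open[OF open_ball this q'] have ga: "grad q a = 0"
    by (simp add: grad_def vec_eq_iff partial_affine2)
  have "(\<lambda>n. d n \<bullet> grad q (A n)) \<longlonglongrightarrow> d0 \<bullet> grad q a"
    by (intro tendsto_inner drift_tendsto partials_tendsto qC)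
  from tendsto_diff[OF local_part_tendsto[OF qC] this]
  have "(\<lambda>n. 1 / 2 * (\<Sum>k\<in>UNIV. \<Sum>l\<in>UNIV. modified_cov (A n) (g n) (N n) k l * partial k (partial l q) (A n)))
      \<longlonglongrightarrow> modified_cov a g0 M i j"
    using hq[of a, OF _ modified_cov_sym[OF triplet]] by simp
  then show ?thesis
    by (rule Lim_transform_eventually)
      (use A_near[OF zero_less_one] hq modified_cov_sym[OF triplets] in \<open>force elim!: eventually_mono\<close>)
qed

end

theorem levy_op_tendsto_iff:
  "(\<forall>f\<in>Cc_infinity. (\<lambda>n. levy_op chi (A n) (d n) (g n) (N n) f) \<longlonglongrightarrow> levy_op chi a d0 g0 M f) \<longleftrightarrow>
    d \<longlonglongrightarrow> d0 \<and> vague_limit \<and>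
    (\<forall>i j. (\<lambda>n. modified_cov (A n) (g n) (N n) i j) \<longlonglongrightarrow> modified_cov a g0 M i j)"
  (is "?L \<longleftrightarrow> ?R")
proof
  assume ?L
  then have "(\<lambda>n. levy_op chi (A n) (d n) (g n) (N n) f) \<longlonglongrightarrow> levy_op chi a d0 g0 M f"
    if "f \<in> Cc_infinity" for f
    using that by (rule bspec)
  note conv = this
  show ?R
    by (intro conjI allI drift_tendsto[OF conv] vague_limit_of_levy_op[OF conv] modified_cov_tendsto[OF conv])
next
  assume ?R
  then show ?L by (intro ballI levy_op_tendsto) simp_all
qed

end

subsection \<open>Uniform convergence on compact sets\<close>

lemma continuous_on_open_sequentially:
  fixes F :: "'a::metric_space \<Rightarrow> 'b::topological_space"
  assumes "open S"
  shows "continuous_on S F \<longleftrightarrow> (\<forall>a\<in>S. \<forall>A. A \<longlonglongrightarrow> a \<longrightarrow> (\<lambda>n. F (A n)) \<longlonglongrightarrow> F a)"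
  unfolding continuous_on_eq_continuous_at[OF assms] continuous_at_sequentially
  by (simp add: o_def)

text \<open>Failure of uniformity on \<open>K\<close> yields only a subsequence of indices with bad
  points, which compactness thins out once more; hence the reindexing \<open>r\<close>. Continuity
  of \<open>g\<close> serves both directions, to compare its values along \<open>A\<close> with the
  value at the limit.\<close>

lemma compactly_uniform_limit_iff:
  fixes F :: "nat \<Rightarrow> real^'n \<Rightarrow> 'b::metric_space"
  assumes S: "open S" and g: "continuous_on S g"
  shows "compactly_uniform_limit S F g \<longleftrightarrow>
    (\<forall>a\<in>S. \<forall>A r. strict_mono r \<longrightarrow> A \<longlonglongrightarrow> a \<longrightarrow> (\<lambda>k. F (r k) (A k)) \<longlonglongrightarrow> g a)"
proof (intro iffI ballI allI impI)
  fix a A and r :: "nat \<Rightarrow> nat"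
  assume u: "compactly_uniform_limit S F g" and a: "a \<in> S" and r: "strict_mono r" and A: "A \<longlonglongrightarrow> a"
  obtain e where e: "e > 0" "cball a e \<subseteq> S" using S a open_contains_cball by blast
  have ul: "uniform_limit (cball a e) F g sequentially"
    using u e(2) by (simp add: compactly_uniform_limit_def)
  have gA: "(\<lambda>k. g (A k)) \<longlonglongrightarrow> g a"
    using g S a A continuous_on_open_sequentially by blast
  show "(\<lambda>k. F (r k) (A k)) \<longlonglongrightarrow> g a"
  proof (rule tendstoI)
    fix d :: real assume d: "d > 0"
    have "\<forall>\<^sub>F n in sequentially. \<forall>x\<in>cball a e. dist (F n x) (g x) < d / 2"
      by (rule uniform_limitD[OF ul]) (use d in simp)
    then have 1: "\<forall>\<^sub>F k in sequentially. \<forall>x\<in>cball a e. dist (F (r k) x) (g x) < d / 2"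
      by (rule eventually_subseq[OF r])
    have 2: "\<forall>\<^sub>F k in sequentially. dist (A k) a < e" by (rule tendstoD[OF A e(1)])
    have 3: "\<forall>\<^sub>F k in sequentially. dist (g (A k)) (g a) < d / 2"
      by (rule tendstoD[OF gA]) (use d in simp)
    show "\<forall>\<^sub>F k in sequentially. dist (F (r k) (A k)) (g a) < d"
      using 1 2 3
    proof eventually_elim
      case (elim k)
      have "dist (F (r k) (A k)) (g (A k)) < d / 2"
        using elim(1,2) by (simp add: dist_commute)
      then show ?case using elim(3) dist_triangle[of "F (r k) (A k)" "g a" "g (A k)"] by linarith
    qed
  qed
next
  assume seq: "\<forall>a\<in>S. \<forall>A r. strict_mono r \<longrightarrow> A \<longlonglongrightarrow> a \<longrightarrow> (\<lambda>k. F (r k) (A k)) \<longlonglongrightarrow> g a"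
  show "compactly_uniform_limit S F g"
    unfolding compactly_uniform_limit_def
  proof (intro allI impI, elim conjE, rule ccontr)
    fix K assume K: "compact K" "K \<subseteq> S" and "\<not> uniform_limit K F g sequentially"
    then obtain e where e: "e > 0" "\<not> (\<forall>\<^sub>F n in sequentially. \<forall>x\<in>K. dist (F n x) (g x) < e)"
      unfolding uniform_limit_iff by blast
    from not_eventually_sequentiallyD[OF e(2)] obtain r :: "nat \<Rightarrow> nat" where r: "strict_mono r"
      "\<And>n. \<exists>x\<in>K. \<not> dist (F (r n) x) (g x) < e" by blast
    then obtain X where X: "\<And>n. X n \<in> K" "\<And>n. \<not> dist (F (r n) (X n)) (g (X n)) < e" by metis
    obtain l s where l: "l \<in> K" "strict_mono (s :: nat \<Rightarrow> nat)" "(X \<circ> s) \<longlonglongrightarrow> l"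
      using K(1) X(1) unfolding compact_eq_seq_compact_metric seq_compact_def by metis
    have lS: "l \<in> S" using l(1) K(2) by blast
    have "(\<lambda>k. F ((r \<circ> s) k) ((X \<circ> s) k)) \<longlonglongrightarrow> g l"
      using seq lS l(3) strict_mono_o[OF r(1) l(2)] by blast
    moreover have "(\<lambda>k. g ((X \<circ> s) k)) \<longlonglongrightarrow> g l"
      using g S lS l(3) continuous_on_open_sequentially by blast
    ultimately have "(\<lambda>k. dist (F ((r \<circ> s) k) ((X \<circ> s) k)) (g ((X \<circ> s) k))) \<longlonglongrightarrow> dist (g l) (g l)"
      by (rule tendsto_dist)
    then have "\<forall>\<^sub>F k in sequentially. dist (F ((r \<circ> s) k) ((X \<circ> s) k)) (g ((X \<circ> s) k)) < e"
      by (rule order_tendstoD) (use e(1) in simp)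
    then obtain k where "dist (F ((r \<circ> s) k) ((X \<circ> s) k)) (g ((X \<circ> s) k)) < e"
      by (auto simp: eventually_sequentially)
    then show False using X(2)[of "s k"] by simp
  qed
qed

lemma compactly_uniform_limit_cong:
  assumes "\<And>n a. a \<in> S \<Longrightarrow> F n a = G n a"
  shows "compactly_uniform_limit S F g \<longleftrightarrow> compactly_uniform_limit S G g"
proof -
  have "uniform_limit K F g sequentially \<longleftrightarrow> uniform_limit K G g sequentially" if "K \<subseteq> S" for K
    by (rule uniform_limit_cong') (use assms that in auto)
  then show ?thesis by (auto simp: compactly_uniform_limit_def)
qed

locale levy_family = compensated chi
  for chi :: "(real^'n) \<times> (real^'n) option \<Rightarrow> real^'n" +
  fixes \<delta> :: "real^'n \<Rightarrow> real^'n"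
    and \<gamma> :: "real^'n \<Rightarrow> real^'n^'n"
    and \<nu> :: "real^'n \<Rightarrow> (real^'n) option measure"
  assumes levy: "\<And>a. levy_triplet a (\<delta> a) (\<gamma> a) (\<nu> a)"
    and null: "\<And>a. chi_discontinuities chi a \<in> null_sets (\<nu> a)"
begin

lemma sequence_iff:
  assumes "A \<longlonglongrightarrow> a" "\<And>n. levy_triplet (A n) (d n) (g n) (N n)"
  shows "(\<forall>f\<in>Cc_infinity. (\<lambda>n. levy_op chi (A n) (d n) (g n) (N n) f)
      \<longlonglongrightarrow> levy_op chi a (\<delta> a) (\<gamma> a) (\<nu> a) f) \<longleftrightarrow>
    d \<longlonglongrightarrow> \<delta> a \<and>
    (\<forall>f\<in>C_compactified. a \<in> interior {x. f (Some x) = 0} \<longrightarrow>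
      (\<lambda>n. \<integral>b. f b \<partial>N n) \<longlonglongrightarrow> (\<integral>b. f b \<partial>\<nu> a)) \<and>
    (\<forall>i j. (\<lambda>n. modified_cov (A n) (g n) (N n) i j) \<longlonglongrightarrow> modified_cov a (\<gamma> a) (\<nu> a) i j)"
proof -
  interpret triplet_sequence chi A d g N a "\<delta> a" "\<gamma> a" "\<nu> a"
    by unfold_locales (use assms levy null in auto)
  show ?thesis using levy_op_tendsto_iff unfolding vague_limit_def .
qed

text \<open>The family itself, evaluated along a sequence of base points, plays the role of the
  approximating triplets.\<close>

lemma continuous_iff:
  "(\<forall>f\<in>Cc_infinity. continuous_on UNIV (\<lambda>a. levy_op chi a (\<delta> a) (\<gamma> a) (\<nu> a) f)) \<longleftrightarrow>
    continuous_on UNIV \<delta> \<and>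
    (\<forall>f\<in>C_compactified. continuous_on (interior {a. f (Some a) = 0}) (\<lambda>a. \<integral>b. f b \<partial>\<nu> a)) \<and>
    (\<forall>i j. continuous_on UNIV (\<lambda>a. modified_cov a (\<gamma> a) (\<nu> a) i j))"
proof -
  have "(\<forall>f\<in>Cc_infinity. continuous_on UNIV (\<lambda>a. levy_op chi a (\<delta> a) (\<gamma> a) (\<nu> a) f)) \<longleftrightarrow>
    (\<forall>a A. A \<longlonglongrightarrow> a \<longrightarrow> (\<forall>f\<in>Cc_infinity.
      (\<lambda>n. levy_op chi (A n) (\<delta> (A n)) (\<gamma> (A n)) (\<nu> (A n)) f)
        \<longlonglongrightarrow> levy_op chi a (\<delta> a) (\<gamma> a) (\<nu> a) f))"
    unfolding continuous_on_open_sequentially[OF open_UNIV] by blast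
  also have "\<dots> \<longleftrightarrow> (\<forall>a A. A \<longlonglongrightarrow> a \<longrightarrow> (\<lambda>n. \<delta> (A n)) \<longlonglongrightarrow> \<delta> a \<and>
    (\<forall>f\<in>C_compactified. a \<in> interior {x. f (Some x) = 0} \<longrightarrow>
      (\<lambda>n. \<integral>b. f b \<partial>\<nu> (A n)) \<longlonglongrightarrow> (\<integral>b. f b \<partial>\<nu> a)) \<and>
    (\<forall>i j. (\<lambda>n. modified_cov (A n) (\<gamma> (A n)) (\<nu> (A n)) i j)
      \<longlonglongrightarrow> modified_cov a (\<gamma> a) (\<nu> a) i j))"
    using sequence_iff[OF _ levy] by (intro all_cong1 imp_cong refl) auto
  also have "\<dots> \<longleftrightarrow> continuous_on UNIV \<delta> \<and>
    (\<forall>f\<in>C_compactified. continuous_on (interior {a. f (Some a) = 0}) (\<lambda>a. \<integral>b. f b \<partial>\<nu> a)) \<and>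
    (\<forall>i j. continuous_on UNIV (\<lambda>a. modified_cov a (\<gamma> a) (\<nu> a) i j))"
    unfolding continuous_on_open_sequentially[OF open_UNIV]
      continuous_on_open_sequentially[OF open_interior] by blast
  finally show ?thesis .
qed

lemma convergence_iff:
  assumes cont: "\<forall>f\<in>Cc_infinity. continuous_on UNIV (\<lambda>a. levy_op chi a (\<delta> a) (\<gamma> a) (\<nu> a) f)"
    and levy_n: "\<And>n a. levy_triplet a (d n a) (g n a) (N n a)"
  shows "(\<forall>f\<in>Cc_infinity. compactly_uniform_limit UNIV (\<lambda>n a. levy_op chi a (d n a) (g n a) (N n a) f)
        (\<lambda>a. levy_op chi a (\<delta> a) (\<gamma> a) (\<nu> a) f)) \<longleftrightarrow>
     compactly_uniform_limit UNIV d \<delta> \<and>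
     (\<forall>f\<in>C_compactified. compactly_uniform_limit (interior {a. f (Some a) = 0})
        (\<lambda>n a. \<integral>b. f b \<partial>N n a) (\<lambda>a. \<integral>b. f b \<partial>\<nu> a)) \<and>
     (\<forall>i j. compactly_uniform_limit UNIV
        (\<lambda>n a. modified_cov a (g n a) (N n a) i j) (\<lambda>a. modified_cov a (\<gamma> a) (\<nu> a) i j))"
proof -
  \<comment> \<open>The sequential criterion for uniform limits requires continuous limits, and
    \<open>continuous_iff\<close> provides this for all three conditions.\<close>
  have c: "continuous_on UNIV \<delta>"
    "\<And>f. f \<in> C_compactified \<Longrightarrow> continuous_on (interior {a. f (Some a) = 0}) (\<lambda>a. \<integral>b. f b \<partial>\<nu> a)"
    "\<And>i j. continuous_on UNIV (\<lambda>a. modified_cov a (\<gamma> a) (\<nu> a) i j)"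
    using cont unfolding continuous_iff by blast+
  have "(\<forall>f\<in>Cc_infinity. compactly_uniform_limit UNIV (\<lambda>n a. levy_op chi a (d n a) (g n a) (N n a) f)
        (\<lambda>a. levy_op chi a (\<delta> a) (\<gamma> a) (\<nu> a) f)) \<longleftrightarrow>
    (\<forall>f\<in>Cc_infinity. \<forall>a\<in>UNIV. \<forall>A r. strict_mono r \<longrightarrow> A \<longlonglongrightarrow> a \<longrightarrow>
      (\<lambda>k. levy_op chi (A k) (d (r k) (A k)) (g (r k) (A k)) (N (r k) (A k)) f)
        \<longlonglongrightarrow> levy_op chi a (\<delta> a) (\<gamma> a) (\<nu> a) f)"
    using cont by (intro ball_cong refl compactly_uniform_limit_iff open_UNIV) blast
  also have "\<dots> \<longleftrightarrow> (\<forall>a A r. strict_mono r \<longrightarrow> A \<longlonglongrightarrow> a \<longrightarrow> (\<forall>f\<in>Cc_infinity.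
      (\<lambda>k. levy_op chi (A k) (d (r k) (A k)) (g (r k) (A k)) (N (r k) (A k)) f)
        \<longlonglongrightarrow> levy_op chi a (\<delta> a) (\<gamma> a) (\<nu> a) f))"
    by blast
  also have "\<dots> \<longleftrightarrow> (\<forall>a A r. strict_mono r \<longrightarrow> A \<longlonglongrightarrow> a \<longrightarrow>
    (\<lambda>k. d (r k) (A k)) \<longlonglongrightarrow> \<delta> a \<and>
    (\<forall>f\<in>C_compactified. a \<in> interior {x. f (Some x) = 0} \<longrightarrow>
      (\<lambda>k. \<integral>b. f b \<partial>N (r k) (A k)) \<longlonglongrightarrow> (\<integral>b. f b \<partial>\<nu> a)) \<and>
    (\<forall>i j. (\<lambda>k. modified_cov (A k) (g (r k) (A k)) (N (r k) (A k)) i j)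
      \<longlonglongrightarrow> modified_cov a (\<gamma> a) (\<nu> a) i j))"
    using sequence_iff[OF _ levy_n] by (intro all_cong1 imp_cong refl) auto
  also have "\<dots> \<longleftrightarrow>
    (\<forall>a\<in>UNIV. \<forall>A r. strict_mono r \<longrightarrow> A \<longlonglongrightarrow> a \<longrightarrow> (\<lambda>k. d (r k) (A k)) \<longlonglongrightarrow> \<delta> a) \<and>
    (\<forall>f\<in>C_compactified. \<forall>a\<in>interior {x. f (Some x) = 0}. \<forall>A r. strict_mono r \<longrightarrow> A \<longlonglongrightarrow> a \<longrightarrow>
      (\<lambda>k. \<integral>b. f b \<partial>N (r k) (A k)) \<longlonglongrightarrow> (\<integral>b. f b \<partial>\<nu> a)) \<and>
    (\<forall>i j. \<forall>a\<in>UNIV. \<forall>A r. strict_mono r \<longrightarrow> A \<longlonglongrightarrow> a \<longrightarrow>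
      (\<lambda>k. modified_cov (A k) (g (r k) (A k)) (N (r k) (A k)) i j)
      \<longlonglongrightarrow> modified_cov a (\<gamma> a) (\<nu> a) i j)"
    by blast
  also have "\<dots> \<longleftrightarrow> compactly_uniform_limit UNIV d \<delta> \<and>
     (\<forall>f\<in>C_compactified. compactly_uniform_limit (interior {a. f (Some a) = 0})
        (\<lambda>n a. \<integral>b. f b \<partial>N n a) (\<lambda>a. \<integral>b. f b \<partial>\<nu> a)) \<and>
     (\<forall>i j. compactly_uniform_limit UNIV
        (\<lambda>n a. modified_cov a (g n a) (N n a) i j) (\<lambda>a. modified_cov a (\<gamma> a) (\<nu> a) i j))"
    by (intro conj_cong ball_cong all_cong1 refl compactly_uniform_limit_iff[symmetric] open_UNIV
        open_interior c)
  finally show ?thesis .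
qed

end

section \<open>Scaled transition probabilities as Levy measures\<close>

definition jump_measure :: "real^'n \<Rightarrow> real \<Rightarrow> (real^'n) option measure \<Rightarrow> (real^'n) option measure" where
  "jump_measure a e m = density m (\<lambda>b. ennreal (indicator (- {Some a}) b / e))"

context compensated
begin

context
  fixes m :: "(real^'n) option measure" and e :: real and a :: "real^'n"
  assumes m: "sets m = sets borel_compactified" "prob_space m" and e: "e > 0"
begin

lemma prob_measurable: "f \<in> borel_measurable borel_compactified \<Longrightarrow> f \<in> borel_measurable m"
  using m(1) by (simp cong: measurable_cong_sets)

lemma indicator_measurable: "(\<lambda>b. indicator (- {Some a}) b / e :: real) \<in> borel_measurable m"
proof -
  have "- {Some a} \<in> sets borel_compactified"
    using sets.compl_sets[OF sets_singleton_Some[of a]] by (simp add: Compl_eq_Diff_UNIV)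
  then show ?thesis using m(1) by simp
qed

lemma integral_jump_measure:
  fixes f :: "(real^'n) option \<Rightarrow> 'b::{banach, second_countable_topology}"
  assumes "f \<in> borel_measurable borel_compactified"
  shows "(\<integral>b. f b \<partial>jump_measure a e m) = (1 / e) *\<^sub>R (LINT b:- {Some a}|m. f b)"
proof -
  have "(\<integral>b. f b \<partial>jump_measure a e m) = (\<integral>b. (indicator (- {Some a}) b / e) *\<^sub>R f b \<partial>m)"
    unfolding jump_measure_def
    by (rule integral_density[OF prob_measurable[OF assms] indicator_measurable]) (use e in auto)
  also have "\<dots> = (\<integral>b. (1 / e) *\<^sub>R (indicator (- {Some a}) b *\<^sub>R f b) \<partial>m)"
    by (simp add: divide_inverse mult.commute)
  finally show ?thesis unfolding set_lebesgue_integral_def integral_scaleR_right .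
qed

lemma integral_jump_measure_vanishing:
  assumes "f \<in> borel_measurable borel_compactified" "f (Some a) = 0"
  shows "(\<integral>b. f b \<partial>jump_measure a e m) = (\<integral>b. f b \<partial>m) / e"
proof -
  have eq: "indicator (- {Some a}) b *\<^sub>R f b = f b" for b
    using assms(2) by (auto simp: indicator_def)
  show ?thesis unfolding integral_jump_measure[OF assms(1)] set_lebesgue_integral_def eq by simp
qed

lemma levy_triplet_jump_measure:
  "levy_triplet a d 0 (jump_measure a e m)"
  unfolding levy_triplet_def
proof (intro conjI allI)
  show "transpose (0 :: real^'n^'n) = 0" by (simp add: transpose_def vec_eq_iff)
  show "0 \<le> x \<bullet> (0 *v x)" for x :: "real^'n" by simp
  show "sets (jump_measure a e m) = sets borel_compactified"
    by (simp add: jump_measure_def m(1))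
  have ind: "(\<lambda>b. ennreal (indicator (- {Some a}) b / e)) \<in> borel_measurable m"
    using indicator_measurable by simp
  have "emeasure (jump_measure a e m) {Some a}
      = (\<integral>\<^sup>+b. ennreal (indicator (- {Some a}) b / e) * indicator {Some a} b \<partial>m)"
    unfolding jump_measure_def by (rule emeasure_density[OF ind]) (simp add: m(1) sets_singleton_Some)
  also have "\<dots> = (\<integral>\<^sup>+b. 0 \<partial>m)"
    by (rule nn_integral_cong) (auto simp: indicator_def)
  finally show "emeasure (jump_measure a e m) {Some a} = 0" by simp
  have w: "levy_weight a b \<le> 1" for b by (auto simp: levy_weight_def split: option.split)
  have "(\<integral>\<^sup>+ b. ennreal (levy_weight a b) \<partial>jump_measure a e m)
      = (\<integral>\<^sup>+b. ennreal (indicator (- {Some a}) b / e) * ennreal (levy_weight a b) \<partial>m)"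
    unfolding jump_measure_def
    by (rule nn_integral_density[OF ind])
      (use prob_measurable[OF C_compactified_measurable[OF levy_weight_C]] in simp)
  also have "\<dots> \<le> (\<integral>\<^sup>+b. ennreal (1 / e) \<partial>m)"
  proof (rule nn_integral_mono)
    fix b
    have "indicator (- {Some a}) b / e * levy_weight a b \<le> 1 / e * 1"
      using e w levy_weight_nonneg[of a b] by (intro mult_mono) (auto simp: indicator_def)
    then show "ennreal (indicator (- {Some a}) b / e) * ennreal (levy_weight a b) \<le> ennreal (1 / e)"
      using e levy_weight_nonneg[of a b] by (simp add: ennreal_mult[symmetric] ennreal_leI)
  qed
  also have "\<dots> = ennreal (1 / e) * emeasure m (space m)" by simp
  also have "\<dots> < \<infinity>" by (simp add: prob_space.emeasure_space_1[OF m(2)])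
  finally show "(\<integral>\<^sup>+ b. ennreal (levy_weight a b) \<partial>jump_measure a e m) < \<infinity>" .
qed

text \<open>The measure is finite and \<open>chi\<close> bounded, so the compensator can be
  integrated separately, and the drift is chosen to cancel it.\<close>

lemma levy_op_jump_measure:
  assumes f: "f \<in> Cc_infinity"
  shows "levy_op chi a ((1 / e) *\<^sub>R (LINT b:- {Some a}|m. chi (a, b))) 0 (jump_measure a e m) f
    = ((\<integral>b. ext0 f b \<partial>m) - f a) / e"
proof -
  interpret prob_space m by (rule m(2))
  let ?I = "\<lambda>b. indicator (- {Some a}) b *\<^sub>R chi (a, b)"
  have meas: "(\<lambda>b. ext0 f b - f a - chi (a, b) \<bullet> grad f a) \<in> borel_measurable borel_compactified"
    by (intro borel_measurable_diff borel_measurable_inner borel_measurable_const chi_measurable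
        C_compactified_measurable[OF ext0_C_compactified[OF f]])
  \<comment> \<open>At \<open>b = Some a\<close> the increment of \<open>f\<close> vanishes, but
    \<open>chi\<close> may not; the atom therefore has to be removed from the \<open>chi\<close>
    term explicitly.\<close>
  have eq: "indicator (- {Some a}) b *\<^sub>R (ext0 f b - f a - chi (a, b) \<bullet> grad f a)
      = ext0 f b - f a - ?I b \<bullet> grad f a" for b
    by (auto simp: indicator_def ext0_def)
  obtain F where F: "\<And>b. \<bar>ext0 f b\<bar> \<le> F" using Cc_bounded[OF f] by metis
  have i1: "integrable m (ext0 f)"
    by (rule integrable_const_bound[of _ F])
      (use F prob_measurable[OF C_compactified_measurable[OF ext0_C_compactified[OF f]]] in auto)
  obtain B where B: "B > 0" "\<And>p. norm (chi p) \<le> B" using chi_bound by metis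
  have i2: "integrable m ?I"
  proof (rule integrable_const_bound[of _ B])
    show "AE b in m. norm (?I b) \<le> B" using B by (auto simp: indicator_def)
    have "- {Some a} \<in> sets m"
      using sets.compl_sets[OF sets_singleton_Some[of a]] m(1) by (simp add: Compl_eq_Diff_UNIV)
    then show "?I \<in> borel_measurable m"
      using prob_measurable[OF chi_measurable[of a]] by simp
  qed
  have "(LINT b:- {Some a}|m. ext0 f b - f a - chi (a, b) \<bullet> grad f a)
      = (\<integral>b. ext0 f b - f a - ?I b \<bullet> grad f a \<partial>m)"
    unfolding set_lebesgue_integral_def eq ..
  also have "\<dots> = (\<integral>b. ext0 f b \<partial>m) - f a - (\<integral>b. ?I b \<partial>m) \<bullet> grad f a"
  proof -
    have i3: "integrable m (\<lambda>b. ?I b \<bullet> grad f a)" by (rule integrable_inner_left[OF i2])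
    have "(\<integral>b. ?I b \<bullet> grad f a \<partial>m) = (\<integral>b. ?I b \<partial>m) \<bullet> grad f a"
      by (rule integral_inner_left[OF i2])
    moreover have "(\<integral>b. (ext0 f b - f a) - ?I b \<bullet> grad f a \<partial>m)
        = (\<integral>b. ext0 f b - f a \<partial>m) - (\<integral>b. ?I b \<bullet> grad f a \<partial>m)"
      by (rule Bochner_Integration.integral_diff[OF _ i3]) (use i1 in simp)
    moreover have "(\<integral>b. ext0 f b - f a \<partial>m) = (\<integral>b. ext0 f b \<partial>m) - f a"
      using i1 by (simp add: prob_space)
    ultimately show ?thesis by simp
  qed
  finally show ?thesis
    unfolding levy_op_def integral_jump_measure[OF meas]
    by (simp add: set_lebesgue_integral_def diff_divide_distrib)
qed

end

end

theorem theorem4p1: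
  fixes chi :: "(real^'n) \<times> (real^'n) option \<Rightarrow> real^'n"
    and \<delta> :: "real^'n \<Rightarrow> real^'n"
    and \<gamma> :: "real^'n \<Rightarrow> real^'n^'n"
    and \<nu> :: "real^'n \<Rightarrow> (real^'n) option measure"
    and \<delta>n :: "nat \<Rightarrow> real^'n \<Rightarrow> real^'n"
    and \<gamma>n :: "nat \<Rightarrow> real^'n \<Rightarrow> real^'n^'n"
    and \<nu>n :: "nat \<Rightarrow> real^'n \<Rightarrow> (real^'n) option measure"
    and \<mu> :: "nat \<Rightarrow> real^'n \<Rightarrow> (real^'n) option measure"
    and \<epsilon> :: "nat \<Rightarrow> real"
    and L :: "(real^'n \<Rightarrow> real) \<Rightarrow> real^'n \<Rightarrow> real"
    and Ln :: "nat \<Rightarrow> (real^'n \<Rightarrow> real) \<Rightarrow> real^'n \<Rightarrow> real"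
    and T :: "nat \<Rightarrow> ((real^'n) option \<Rightarrow> real) \<Rightarrow> real^'n \<Rightarrow> real"
  assumes comp: "compensation chi"
    and triplet: "\<And>a. levy_triplet a (\<delta> a) (\<gamma> a) (\<nu> a)"
    and disc: "\<And>a. chi_discontinuities chi a \<in> null_sets (\<nu> a)"
    and triplet_n: "\<And>n a. levy_triplet a (\<delta>n n a) (\<gamma>n n a) (\<nu>n n a)"
    and mu_sets: "\<And>n a. sets (\<mu> n a) = sets borel_compactified"
    and mu_prob: "\<And>n a. prob_space (\<mu> n a)"
    and eps_pos: "\<And>n. 0 < \<epsilon> n"
    and eps_lim: "\<epsilon> \<longlonglongrightarrow> 0"
    and L: "\<And>f a. L f a = levy_op chi a (\<delta> a) (\<gamma> a) (\<nu> a) f"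
    and Ln: "\<And>n f a. Ln n f a = levy_op chi a (\<delta>n n a) (\<gamma>n n a) (\<nu>n n a) f"
    and T: "\<And>n f a. T n f a = (\<integral>b. f b \<partial>\<mu> n a)"
  shows
    "((\<forall>f\<in>Cc_infinity. continuous_on UNIV (L f)) \<longleftrightarrow>
        continuous_on UNIV \<delta> \<and>
        (\<forall>f\<in>C_compactified.
           continuous_on (interior {a. f (Some a) = 0}) (\<lambda>a. \<integral>b. f b \<partial>\<nu> a)) \<and>
        (\<forall>i j. continuous_on UNIV
           (\<lambda>a. \<gamma> a $ i $ j + (\<integral>b. chi (a, b) $ i * chi (a, b) $ j \<partial>\<nu> a))))
     \<and>
     ((\<forall>f\<in>Cc_infinity. continuous_on UNIV (L f)) \<longrightarrow>
       ((\<forall>f\<in>Cc_infinity. compactly_uniform_limit UNIV (\<lambda>n. Ln n f) (L f)) \<longleftrightarrow>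
        compactly_uniform_limit UNIV \<delta>n \<delta> \<and>
        (\<forall>f\<in>C_compactified. compactly_uniform_limit (interior {a. f (Some a) = 0})
           (\<lambda>n a. \<integral>b. f b \<partial>\<nu>n n a) (\<lambda>a. \<integral>b. f b \<partial>\<nu> a)) \<and>
        (\<forall>i j. compactly_uniform_limit UNIV
           (\<lambda>n a. \<gamma>n n a $ i $ j + (\<integral>b. chi (a, b) $ i * chi (a, b) $ j \<partial>\<nu>n n a))
           (\<lambda>a. \<gamma> a $ i $ j + (\<integral>b. chi (a, b) $ i * chi (a, b) $ j \<partial>\<nu> a)))))
     \<and>
     ((\<forall>f\<in>Cc_infinity. continuous_on UNIV (L f)) \<longrightarrow>
       ((\<forall>f\<in>Cc_infinity. compactly_uniform_limit UNIV
           (\<lambda>n a. (T n (ext0 f) a - f a) / \<epsilon> n) (L f)) \<longleftrightarrow>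
        compactly_uniform_limit UNIV
           (\<lambda>n a. (1 / \<epsilon> n) *\<^sub>R (LINT b:- {Some a}|\<mu> n a. chi (a, b))) \<delta> \<and>
        (\<forall>f\<in>C_compactified. compactly_uniform_limit (interior {a. f (Some a) = 0})
           (\<lambda>n a. (\<integral>b. f b \<partial>\<mu> n a) / \<epsilon> n) (\<lambda>a. \<integral>b. f b \<partial>\<nu> a)) \<and>
        (\<forall>i j. compactly_uniform_limit UNIV
           (\<lambda>n a. (LINT b:- {Some a}|\<mu> n a. chi (a, b) $ i * chi (a, b) $ j) / \<epsilon> n)
           (\<lambda>a. \<gamma> a $ i $ j + (\<integral>b. chi (a, b) $ i * chi (a, b) $ j \<partial>\<nu> a)))))"
proof (intro conjI impI)
  interpret levy_family chi \<delta> \<gamma> \<nu>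
    by unfold_locales (use comp triplet disc in auto)
  have Leq: "L f = (\<lambda>a. levy_op chi a (\<delta> a) (\<gamma> a) (\<nu> a) f)" for f
    by (rule ext) (rule L)
  show "(\<forall>f\<in>Cc_infinity. continuous_on UNIV (L f)) \<longleftrightarrow>
        continuous_on UNIV \<delta> \<and>
        (\<forall>f\<in>C_compactified.
           continuous_on (interior {a. f (Some a) = 0}) (\<lambda>a. \<integral>b. f b \<partial>\<nu> a)) \<and>
        (\<forall>i j. continuous_on UNIV
           (\<lambda>a. \<gamma> a $ i $ j + (\<integral>b. chi (a, b) $ i * chi (a, b) $ j \<partial>\<nu> a)))"
    unfolding Leq by (rule continuous_iff[unfolded modified_cov_def])
  assume cont: "\<forall>f\<in>Cc_infinity. continuous_on UNIV (L f)"
  show "(\<forall>f\<in>Cc_infinity. compactly_uniform_limit UNIV (\<lambda>n. Ln n f) (L f)) \<longleftrightarrow>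
        compactly_uniform_limit UNIV \<delta>n \<delta> \<and>
        (\<forall>f\<in>C_compactified. compactly_uniform_limit (interior {a. f (Some a) = 0})
           (\<lambda>n a. \<integral>b. f b \<partial>\<nu>n n a) (\<lambda>a. \<integral>b. f b \<partial>\<nu> a)) \<and>
        (\<forall>i j. compactly_uniform_limit UNIV
           (\<lambda>n a. \<gamma>n n a $ i $ j + (\<integral>b. chi (a, b) $ i * chi (a, b) $ j \<partial>\<nu>n n a))
           (\<lambda>a. \<gamma> a $ i $ j + (\<integral>b. chi (a, b) $ i * chi (a, b) $ j \<partial>\<nu> a)))"
  proof -
    have "Ln n f = (\<lambda>a. levy_op chi a (\<delta>n n a) (\<gamma>n n a) (\<nu>n n a) f)" for n f
      by (rule ext) (rule Ln)
    then show ?thesis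
      using convergence_iff[OF cont[unfolded Leq] triplet_n] by (simp add: Leq modified_cov_def)
  qed
  let ?d = "\<lambda>n a. (1 / \<epsilon> n) *\<^sub>R (LINT b:- {Some a}|\<mu> n a. chi (a, b))"
  let ?N = "\<lambda>n a. jump_measure a (\<epsilon> n) (\<mu> n a)"
  note \<mu> = mu_sets mu_prob eps_pos
  have "(\<forall>f\<in>Cc_infinity. compactly_uniform_limit UNIV (\<lambda>n a. levy_op chi a (?d n a) 0 (?N n a) f) (L f)) \<longleftrightarrow>
     compactly_uniform_limit UNIV ?d \<delta> \<and>
     (\<forall>f\<in>C_compactified. compactly_uniform_limit (interior {a. f (Some a) = 0})
        (\<lambda>n a. \<integral>b. f b \<partial>?N n a) (\<lambda>a. \<integral>b. f b \<partial>\<nu> a)) \<and>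
     (\<forall>i j. compactly_uniform_limit UNIV
        (\<lambda>n a. modified_cov a 0 (?N n a) i j) (\<lambda>a. modified_cov a (\<gamma> a) (\<nu> a) i j))"
    unfolding Leq by (rule convergence_iff[OF cont[unfolded Leq] levy_triplet_jump_measure[OF \<mu>]])
  moreover have "compactly_uniform_limit UNIV (\<lambda>n a. levy_op chi a (?d n a) 0 (?N n a) f) (L f) \<longleftrightarrow>
      compactly_uniform_limit UNIV (\<lambda>n a. (T n (ext0 f) a - f a) / \<epsilon> n) (L f)"
    if "f \<in> Cc_infinity" for f
    by (rule compactly_uniform_limit_cong) (simp only: levy_op_jump_measure[OF \<mu> that] T)
  moreover have "compactly_uniform_limit (interior {a. f (Some a) = 0})
        (\<lambda>n a. \<integral>b. f b \<partial>?N n a) (\<lambda>a. \<integral>b. f b \<partial>\<nu> a) \<longleftrightarrow>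
      compactly_uniform_limit (interior {a. f (Some a) = 0})
        (\<lambda>n a. (\<integral>b. f b \<partial>\<mu> n a) / \<epsilon> n) (\<lambda>a. \<integral>b. f b \<partial>\<nu> a)"
    if "f \<in> C_compactified" for f
  \<comment> \<open>Here \<open>f\<close> vanishes at the base point, so the atom removed from
    \<open>\<mu> n a\<close> does not contribute.\<close>
  proof (rule compactly_uniform_limit_cong)
    fix n a assume "a \<in> interior {a. f (Some a) = 0}"
    then have "f (Some a) = 0" using interior_subset by blast
    then show "(\<integral>b. f b \<partial>?N n a) = (\<integral>b. f b \<partial>\<mu> n a) / \<epsilon> n"
      by (rule integral_jump_measure_vanishing[OF \<mu> C_compactified_measurable[OF that]])
  qed
  moreover have "modified_cov a 0 (?N n a) i j
      = (LINT b:- {Some a}|\<mu> n a. chi (a, b) $ i * chi (a, b) $ j) / \<epsilon> n" for n a i j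
    unfolding modified_cov_def
    by (subst integral_jump_measure[OF \<mu>])
      (auto intro!: borel_measurable_times chi_nth_measurable)
  ultimately show "(\<forall>f\<in>Cc_infinity. compactly_uniform_limit UNIV
           (\<lambda>n a. (T n (ext0 f) a - f a) / \<epsilon> n) (L f)) \<longleftrightarrow>
        compactly_uniform_limit UNIV
           (\<lambda>n a. (1 / \<epsilon> n) *\<^sub>R (LINT b:- {Some a}|\<mu> n a. chi (a, b))) \<delta> \<and>
        (\<forall>f\<in>C_compactified. compactly_uniform_limit (interior {a. f (Some a) = 0})
           (\<lambda>n a. (\<integral>b. f b \<partial>\<mu> n a) / \<epsilon> n) (\<lambda>a. \<integral>b. f b \<partial>\<nu> a)) \<and>
        (\<forall>i j. compactly_uniform_limit UNIV
           (\<lambda>n a. (LINT b:- {Some a}|\<mu> n a. chi (a, b) $ i * chi (a, b) $ j) / \<epsilon> n)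
           (\<lambda>a. \<gamma> a $ i $ j + (\<integral>b. chi (a, b) $ i * chi (a, b) $ j \<partial>\<nu> a)))"
    by (simp add: modified_cov_def cong: ball_cong)
qed

end
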